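(* An austere 4-fold $M$ of type C with first normal space of dimension $\delta=3$, and such that the parameters $\lambda_1,\lambda_2,\lambda_3$ are constant on $M$, must be a generalized helicoid.
   Context: For an immersed submanifold $M^4\subset\mathbb{R}^{4+r}$ the second fundamental form is $\mathrm{II}(X,Y)=\pi_N\nabla_XY$, and $|\mathrm{II}_p|\subset S^2T_p^*M$ is the space of all quadratic forms $\nu\cdot\mathrm{II}_p$, with $\nu$ normal to $M$ at $p$. $M$ is austere if, for every normal vector $\nu$, the eigenvalues of $\nu\cdot\mathrm{II}$ with respect to the induced metric are symmetrically arranged around zero. The first normal space at $p$ is the image of $\mathrm{II}:S^2T_pM\to N_pM$; its dimension $\delta$ equals $\dim|\mathrm{II}_p|$ and is assumed constant. For real parameters satisfying $$\lambda_1\ge\lambda_2\ge0\ge\lambda_3,\qquad \lambda_1\lambda_2\lambda_3+\lambda_1+\lambda_2+\lambda_3=0,$$ let $$\mathcal{Q}_C=\left\{\begin{bmatrix}0&x_1&x_2&x_3\\ x_1&0&\lambda_3x_3&\lambda_2x_2\\ x_2&\lambda_3x_3&0&\lambda_1x_1\\ x_3&\lambda_2x_2&\lambda_1x_1&0\end{bmatrix}: x_1,x_2,x_3\in\mathbb{R}\right\}.$$ $M$ is of type C if for every $p$ the space $|\mathrm{II}_p|$ is $O(4)$-conjugate (in an orthonormal basis of $T_pM$, taken locally to be a smooth frame) to a subspace of $\mathcal{Q}_C$, the parameters $\lambda_i$ being in general functions on $M$. A generalized helicoid $M^n\subset\mathbb{R}^{2n-1}$ is the image of a parametrization $$(x_0,\dots,x_{n-1})\mapsto\big(x_0,\,x_1\cos(\mu_1x_0),\,x_1\sin(\mu_1x_0),\dots,x_s\cos(\mu_sx_0),\,x_s\sin(\mu_sx_0),\,x_{s+1},\dots,x_{n-1}\big),$$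 where $\mu_1,\dots,\mu_s$ are positive constants and $s<n$. Being a generalized helicoid is understood up to congruence (rigid motion), within a totally geodesic $\mathbb{R}^{2n-1}$ (here $n=4$), and locally, i.e. $M$ (connected) may be an open subset of such an image. *)

theory Defs
  imports "HOL-Analysis.Analysis"
begin

section \<open>Smooth maps and abstract smooth manifolds\<close>

text \<open>
  The following two notions are only meant for open sets \<open>S\<close>.
\<close>

primrec C_k_on ::
  "nat \<Rightarrow> ('a::real_normed_vector \<Rightarrow> 'b::real_normed_vector) \<Rightarrow> 'a set \<Rightarrow> bool"
where
  "C_k_on 0 f S \<longleftrightarrow> continuous_on S f"
| "C_k_on (Suc k) f S \<longleftrightarrow>
     f differentiable_on S \<and> (\<forall>v. C_k_on k (\<lambda>x. frechet_derivative f (at x) v) S)"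

definition smooth_on ::
  "('a::real_normed_vector \<Rightarrow> 'b::real_normed_vector) \<Rightarrow> 'a set \<Rightarrow> bool"
where
  "smooth_on f S \<longleftrightarrow> (\<forall>k. C_k_on k f S)"

text \<open>
  An atlas is a set of pairs \<open>(V, \<phi>)\<close>, where the local parametrization \<open>\<phi>\<close> (the inverse of a
  coordinate chart) maps the open set \<open>V\<close> homeomorphically onto an open subset of the manifold.
\<close>

type_synonym ('m, 'a) atlas = "((real ^ 'm) set \<times> (real ^ 'm \<Rightarrow> 'a)) set"

definition smooth_manifold :: "'a topology \<Rightarrow> ('m::finite, 'a) atlas \<Rightarrow> bool" where
  "smooth_manifold M A \<longleftrightarrow>
     Hausdorff_space M \<and> second_countable M \<and>
     (\<Union>(V, \<phi>)\<in>A. \<phi> ` V) = topspace M \<and>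
     (\<forall>(V, \<phi>)\<in>A. open V \<and> openin M (\<phi> ` V) \<and>
        homeomorphic_map (top_of_set V) (subtopology M (\<phi> ` V)) \<phi>) \<and>
     (\<forall>(V, \<phi>)\<in>A. \<forall>(W, \<psi>)\<in>A.
        smooth_on (\<lambda>x. inv_into W \<psi> (\<phi> x)) {x \<in> V. \<phi> x \<in> \<psi> ` W})"

definition immersed_submanifold ::
  "'a topology \<Rightarrow> ('m::finite, 'a) atlas \<Rightarrow> ('a \<Rightarrow> 'b::euclidean_space) \<Rightarrow> bool"
where
  "immersed_submanifold M A f \<longleftrightarrow>
     smooth_manifold M A \<and>
     (\<forall>(V, \<phi>)\<in>A. smooth_on (f \<circ> \<phi>) V \<and>
        (\<forall>x\<in>V. inj (frechet_derivative (f \<circ> \<phi>) (at x))))"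


section \<open>Extrinsic geometry in a local parametrization\<close>

text \<open>
  Throughout this section \<open>g\<close> is an immersion of an open subset of \<open>real ^ 'm\<close>, such as \<open>f \<circ> \<phi>\<close>
  for an immersed submanifold. The abstract tangent space at the point with coordinates \<open>x\<close> is
  identified with \<open>real ^ 'm\<close>, a coordinate vector \<open>u\<close> standing for \<open>dg\<^sub>x(u)\<close>. All notions
  below are independent of the choice of the parametrization under this identification.
\<close>

definition tangent_space ::
  "(real ^ 'm \<Rightarrow> 'b::euclidean_space) \<Rightarrow> real ^ 'm \<Rightarrow> 'b set"
where
  "tangent_space g x = range (frechet_derivative g (at x))"

definition normal_space ::
  "(real ^ 'm \<Rightarrow> 'b::euclidean_space) \<Rightarrow> real ^ 'm \<Rightarrow> 'b set"
where
  "normal_space g x = (tangent_space g x)\<^sup>\<bottom>"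

definition induced_metric ::
  "(real ^ 'm \<Rightarrow> 'b::euclidean_space) \<Rightarrow> real ^ 'm \<Rightarrow> real ^ 'm \<Rightarrow> real ^ 'm \<Rightarrow> real"
where
  "induced_metric g x u v = frechet_derivative g (at x) u \<bullet> frechet_derivative g (at x) v"

definition normal_part :: "'b::euclidean_space set \<Rightarrow> 'b \<Rightarrow> 'b" where
  "normal_part T w = (THE n. n \<in> T\<^sup>\<bottom> \<and> w - n \<in> T)"

lemma normal_part_unique:
  fixes T :: "'b::euclidean_space set"
  assumes "subspace T"
  shows "\<exists>!n. n \<in> T\<^sup>\<bottom> \<and> w - n \<in> T"
proof -
  obtain t n where tn: "t \<in> T" "n \<in> T\<^sup>\<bottom>" "w = t + n"
    using subspace_sum_orthogonal_comp[OF assms] by (metis UNIV_I set_plus_elim)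
  have "n' = n" if n': "n' \<in> T\<^sup>\<bottom>" "w - n' \<in> T" for n'
  proof -
    have "n - n' \<in> T\<^sup>\<bottom>"
      using tn n' by (intro subspace_diff subspace_orthogonal_comp)
    moreover have "(w - n') - t \<in> T"
      using subspace_diff[OF assms n'(2) tn(1)] .
    hence "n - n' \<in> T" using tn by (simp add: algebra_simps)
    ultimately have "(n - n') \<bullet> (n - n') = 0"
      by (auto simp: orthogonal_comp_def orthogonal_def)
    thus ?thesis by simp
  qed
  with tn show ?thesis by (intro ex1I[of _ n]) auto
qed

text \<open>
  \<open>\<pi>\<^sub>N(\<nabla>\<^sub>X Y)\<close> at \<open>x\<close>, where \<open>X = dg\<^sub>x(u)\<close> and \<open>Y\<close> is extended to the tangential vector field
  \<open>y \<mapsto> dg\<^sub>y(v)\<close> with constant coordinates; \<open>\<nabla>\<close> is the directional derivative in the ambient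
  Euclidean space.
\<close>

definition second_fundamental_form ::
  "(real ^ 'm \<Rightarrow> 'b::euclidean_space) \<Rightarrow> real ^ 'm \<Rightarrow> real ^ 'm \<Rightarrow> real ^ 'm \<Rightarrow> 'b"
where
  "second_fundamental_form g x u v =
     normal_part (tangent_space g x)
       (frechet_derivative (\<lambda>y. frechet_derivative g (at y) v) (at x) u)"

text \<open>
  The space \<open>|II|\<close>; a quadratic form is represented by its symmetric bilinear form.
\<close>

definition second_form_system ::
  "(real ^ 'm \<Rightarrow> 'b::euclidean_space) \<Rightarrow> real ^ 'm \<Rightarrow> (real ^ 'm \<Rightarrow> real ^ 'm \<Rightarrow> real) set"
where
  "second_form_system g x =
     {(\<lambda>u v. \<nu> \<bullet> second_fundamental_form g x u v) | \<nu>. \<nu> \<in> normal_space g x}"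

text \<open>
  The image of the linear map induced by \<open>II\<close> on the symmetric square of the tangent space.
\<close>

definition first_normal_space ::
  "(real ^ 'm \<Rightarrow> 'b::euclidean_space) \<Rightarrow> real ^ 'm \<Rightarrow> 'b set"
where
  "first_normal_space g x = span {second_fundamental_form g x u v | u v. True}"

text \<open>
  The eigenspace, for the value \<open>t\<close>, of a bilinear form \<open>b\<close> with respect to the induced metric.
\<close>

definition form_eigenspace ::
  "(real ^ 'm \<Rightarrow> 'b::euclidean_space) \<Rightarrow> real ^ 'm \<Rightarrow> (real ^ 'm \<Rightarrow> real ^ 'm \<Rightarrow> real) \<Rightarrow>
     real \<Rightarrow> (real ^ 'm) set"
where
  "form_eigenspace g x b t = {u. \<forall>w. b u w = t * induced_metric g x u w}"


section \<open>Austere submanifolds, type C\<close>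

text \<open>
  Symmetry of the spectrum is counted with multiplicity. The forms are symmetric, hence
  diagonalizable, so that the multiplicity of \<open>t\<close> is the dimension of its eigenspace (and is \<open>0\<close>
  if \<open>t\<close> is not an eigenvalue).
\<close>

definition austere :: "('m::finite, 'a) atlas \<Rightarrow> ('a \<Rightarrow> 'b::euclidean_space) \<Rightarrow> bool" where
  "austere A f \<longleftrightarrow>
     (\<forall>(V, \<phi>)\<in>A. \<forall>x\<in>V. \<forall>b\<in>second_form_system (f \<circ> \<phi>) x. \<forall>t.
        dim (form_eigenspace (f \<circ> \<phi>) x b t) = dim (form_eigenspace (f \<circ> \<phi>) x b (- t)))"

definition first_normal_dim ::
  "('m::finite, 'a) atlas \<Rightarrow> ('a \<Rightarrow> 'b::euclidean_space) \<Rightarrow> nat \<Rightarrow> bool"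
where
  "first_normal_dim A f \<delta> \<longleftrightarrow>
     (\<forall>(V, \<phi>)\<in>A. \<forall>x\<in>V. dim (first_normal_space (f \<circ> \<phi>) x) = \<delta>)"

definition type_C_params :: "real \<Rightarrow> real \<Rightarrow> real \<Rightarrow> bool" where
  "type_C_params l1 l2 l3 \<longleftrightarrow>
     l1 \<ge> l2 \<and> l2 \<ge> 0 \<and> 0 \<ge> l3 \<and> l1 * l2 * l3 + l1 + l2 + l3 = 0"

definition Q_C :: "real \<Rightarrow> real \<Rightarrow> real \<Rightarrow> (real ^ 4 ^ 4) set" where
  "Q_C l1 l2 l3 =
     {vector [vector [0,  x1,      x2,      x3],
              vector [x1, 0,       l3 * x3, l2 * x2],
              vector [x2, l3 * x3, 0,       l1 * x1],
              vector [x3, l2 * x2, l1 * x1, 0]] | x1 x2 x3. True}"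

text \<open>
  Near every point there is a smooth orthonormal frame \<open>e\<close> of the tangent bundle in which all the
  matrices of the forms in \<open>|II|\<close> lie in \<open>Q_C\<close>; these matrices form a linear subspace.
\<close>

definition type_C ::
  "'a topology \<Rightarrow> (4, 'a) atlas \<Rightarrow> ('a \<Rightarrow> 'b::euclidean_space) \<Rightarrow>
     ('a \<Rightarrow> real) \<Rightarrow> ('a \<Rightarrow> real) \<Rightarrow> ('a \<Rightarrow> real) \<Rightarrow> bool"
where
  "type_C M A f l1 l2 l3 \<longleftrightarrow>
     (\<forall>p\<in>topspace M. type_C_params (l1 p) (l2 p) (l3 p)) \<and>
     (\<forall>p\<in>topspace M. \<exists>(V, \<phi>)\<in>A. \<exists>W (e :: 4 \<Rightarrow> real ^ 4 \<Rightarrow> real ^ 4).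
        open W \<and> W \<subseteq> V \<and> p \<in> \<phi> ` W \<and> (\<forall>i. smooth_on (e i) W) \<and>
        (\<forall>x\<in>W.
           (\<forall>i j. induced_metric (f \<circ> \<phi>) x (e i x) (e j x) = (if i = j then 1 else 0)) \<and>
           (\<forall>b\<in>second_form_system (f \<circ> \<phi>) x.
              (\<chi> i j. b (e i x) (e j x)) \<in> Q_C (l1 (\<phi> x)) (l2 (\<phi> x)) (l3 (\<phi> x)))))"


section \<open>Generalized helicoids\<close>

text \<open>
  The coordinates of the standard parametrization, numbered from \<open>0\<close>: coordinate \<open>0\<close> is \<open>x\<^sub>0\<close>, the
  coordinates \<open>2j - 1\<close> and \<open>2j\<close> are \<open>x\<^sub>j cos (\<mu>\<^sub>j x\<^sub>0)\<close> and \<open>x\<^sub>j sin (\<mu>\<^sub>j x\<^sub>0)\<close> for \<open>1 \<le> j \<le> s\<close>, and the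
  coordinates \<open>2s + 1, \<dots>, n + s - 1\<close> are \<open>x\<^sub>s\<^sub>+\<^sub>1, \<dots>, x\<^sub>n\<^sub>-\<^sub>1\<close>. If \<open>s < n - 1\<close>, the remaining
  coordinates of the \<open>(2n - 1)\<close>-dimensional space are \<open>0\<close>.
\<close>

definition helicoid_coord ::
  "nat \<Rightarrow> nat \<Rightarrow> (nat \<Rightarrow> real) \<Rightarrow> (nat \<Rightarrow> real) \<Rightarrow> nat \<Rightarrow> real"
where
  "helicoid_coord n s \<mu> x k =
     (if k = 0 then x 0
      else if k \<le> 2 * s then
        (let j = (k + 1) div 2
         in x j * (if odd k then cos (\<mu> j * x 0) else sin (\<mu> j * x 0)))
      else if k < n + s then x (k - s)
      else 0)"

text \<open>
  Generalized helicoids up to congruence: the point \<open>a\<close> and the orthonormal vectors \<open>b\<close> determine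
  an isometric embedding of the \<open>(2n - 1)\<close>-dimensional Euclidean space onto a totally geodesic
  subspace of the ambient space. Congruences may reverse the orientation.
\<close>

definition generalized_helicoid :: "nat \<Rightarrow> 'b::euclidean_space set \<Rightarrow> bool" where
  "generalized_helicoid n H \<longleftrightarrow>
     (\<exists>(s::nat) (\<mu> :: nat \<Rightarrow> real) (a :: 'b) (b :: nat \<Rightarrow> 'b).
        s < n \<and> (\<forall>j\<in>{1..s}. 0 < \<mu> j) \<and>
        (\<forall>i<2 * n - 1. \<forall>k<2 * n - 1. b i \<bullet> b k = (if i = k then 1 else 0)) \<and>
        H = {a + (\<Sum>k<2 * n - 1. helicoid_coord n s \<mu> x k *\<^sub>R b k) | x. True})"

end

(*
  In an adapted orthonormal frame E_1, ..., E_4 the type C condition reads h(E_a, E_a) = 0 and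
  h(E_b, E_c) = lambda_a n_a with n_a = h(E_1, E_a), and the n_a are linearly independent because
  delta = 3.  When the lambda_a are constant, the Codazzi equations become linear equations for the
  connection coefficients.  If all lambda_a are nonzero with squares different from 1, these vanish
  and the Gauss equation is violated.  The remaining nonzero parameters are, up to order,
  (l, 0, -l), excluded by the Gauss equation alone, and (1, mu, -1), excluded by combining the Gauss
  and Ricci equations.  Hence all lambda_a are 0.

  In that case the leaves orthogonal to E_1 are flat 3-planes, and E_1 is, up to a factor kappa, the
  restriction to M of a Killing field y -> J y + u of the ambient space, J being skew.  Diagonalizing J^2 on the span of
  E_2, E_3, E_4 at one point puts M locally into a helicoid, openly because the dimensions agree.
  A helicoid is the fixed point set of a real analytic map and any two of its points are joined by a
  curve that extends to an entire one, so two helicoids sharing an open piece coincide;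
  connectedness of M then yields a single helicoid.
*)
theory Submission
  imports Defs "HOL-Complex_Analysis.Conformal_Mappings"
begin

section \<open>Calculus of smooth maps\<close>

text \<open>The Gauss and Ricci equations contain derivatives of the connection coefficients, on
  which nothing is known. The way around is always the same: when a linear combination of
  coefficients vanishes on an open set, the same combination of Gauss equations loses its
  derivatives and becomes algebraic. For the parameters (1, \<mu>, -1) this is not enough. There the
  normal derivative of \<open>n b\<close> involves \<open>n a\<close> and \<open>n c\<close> only
  with multiples of \<open>Y i c\<close> and \<open>Y i a\<close>, so the derivatives in its Ricci
  equation along these two vectors are those that the Gauss equation provides. One vanishing
  combination is lost when \<mu> = 0, since the Codazzi equations yield it only after division by
  \<mu>; there, identities between inner products of the \<open>n a\<close> are differentiated
  instead. The exceptional parameters come from a rewriting of the constraint, \<open>(lam 4 + 1) *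
  (1 + lam 2 * lam 3) = (1 - lam 2) * (1 - lam 3)\<close>: a parameter of modulus 1 forces both 1
  and -1 to occur.\<close>

lemma frechet_derivative_cong_open:
  assumes "open S" "x \<in> S" "\<And>y. y \<in> S \<Longrightarrow> f y = g y"
  shows "frechet_derivative f (at x) = frechet_derivative g (at x)"
proof -
  have "(f has_derivative d) (at x) \<longleftrightarrow> (g has_derivative d) (at x)" for d
    using assms has_derivative_transform_within_open[of f d x UNIV S g]
      has_derivative_transform_within_open[of g d x UNIV S f] by auto
  then show ?thesis
    by (simp add: frechet_derivative_def)
qed

lemma C_k_on_Suc_has_derivative:
  assumes "C_k_on (Suc k) f S" "open S" "x \<in> S"
  shows "(f has_derivative frechet_derivative f (at x)) (at x)"
  using assms by (metis C_k_on.simps(2) differentiable_on_eq_differentiable_at frechet_derivative_works)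

lemma C_k_on_Suc_frechet_derivative:
  "C_k_on (Suc k) f S \<Longrightarrow> C_k_on k (\<lambda>x. frechet_derivative f (at x) v) S"
  by simp

text \<open>\<open>C_k_on\<close> speaks of \<open>frechet_derivative\<close> as a function on the
  whole space, while the derivative rules give its value on \<open>S\<close> only. This congruence
  lets each closure property replace the derivative by its formula.\<close>

lemma C_k_on_cong:
  assumes "open S" "\<And>y. y \<in> S \<Longrightarrow> f y = g y" "C_k_on k f S"
  shows "C_k_on k g S"
  using assms(2,3)
proof (induction k arbitrary: f g)
  case 0
  then show ?case
    by (metis C_k_on.simps(1) continuous_on_cong)
next
  case (Suc k)
  have "g differentiable_on S"
    unfolding differentiable_on_eq_differentiable_at[OF \<open>open S\<close>]
  proof
    fix x assume x: "x \<in> S"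
    then have "(f has_derivative frechet_derivative f (at x)) (at x)"
      using C_k_on_Suc_has_derivative Suc.prems(2) assms(1) by blast
    then show "g differentiable at x"
      using has_derivative_transform_within_open[of f _ x UNIV S g, OF _ \<open>open S\<close> x] Suc.prems(1)
      unfolding differentiable_def by blast
  qed
  moreover have "C_k_on k (\<lambda>x. frechet_derivative g (at x) v) S" for v
  proof (rule Suc.IH[of "\<lambda>x. frechet_derivative f (at x) v"])
    show "frechet_derivative f (at y) v = frechet_derivative g (at y) v" if "y \<in> S" for y
      using frechet_derivative_cong_open[OF \<open>open S\<close> that] Suc.prems(1) by metis
    show "C_k_on k (\<lambda>x. frechet_derivative f (at x) v) S"
      using Suc.prems(2) by simp
  qed
  ultimately show ?case
    by simp
qed

lemma C_k_on_Suc_D: "C_k_on (Suc k) f S \<Longrightarrow> C_k_on k f S"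
proof (induction k arbitrary: f)
  case 0
  then show ?case
    by (simp add: differentiable_imp_continuous_on)
qed auto

lemma C_k_on_subset: "C_k_on k f S \<Longrightarrow> T \<subseteq> S \<Longrightarrow> C_k_on k f T"
proof (induction k arbitrary: f)
  case 0
  then show ?case
    using continuous_on_subset by auto
next
  case (Suc k)
  then show ?case
    using differentiable_on_subset by auto
qed

lemma smooth_on_subset: "smooth_on f S \<Longrightarrow> T \<subseteq> S \<Longrightarrow> smooth_on f T"
  using C_k_on_subset unfolding smooth_on_def by blast

lemma smooth_on_cong:
  assumes "open S" "\<And>y. y \<in> S \<Longrightarrow> f y = g y" "smooth_on f S"
  shows "smooth_on g S"
  using C_k_on_cong[OF assms(1) _, of f g] assms(2,3) unfolding smooth_on_def by blast

lemma smooth_on_imp_differentiable: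
  "smooth_on f S \<Longrightarrow> open S \<Longrightarrow> x \<in> S \<Longrightarrow> f differentiable (at x)"
  unfolding smooth_on_def
  by (metis C_k_on.simps(2) differentiable_on_eq_differentiable_at)

lemma smooth_on_has_derivative:
  "smooth_on f S \<Longrightarrow> open S \<Longrightarrow> x \<in> S \<Longrightarrow> (f has_derivative frechet_derivative f (at x)) (at x)"
  using smooth_on_imp_differentiable frechet_derivative_works by blast

lemma smooth_on_imp_continuous_on: "smooth_on f S \<Longrightarrow> continuous_on S f"
  unfolding smooth_on_def by (metis C_k_on.simps(1))

lemma smooth_on_frechet_derivative:
  "smooth_on f S \<Longrightarrow> smooth_on (\<lambda>x. frechet_derivative f (at x) v) S"
  unfolding smooth_on_def by (metis C_k_on.simps(2))

lemma C_k_on_const: "C_k_on k (\<lambda>x. c) S"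
proof (induction k arbitrary: c)
  case 0
  then show ?case by simp
next
  case (Suc k)
  then show ?case by (simp add: Suc.IH[of 0])
qed

lemma smooth_on_const: "smooth_on (\<lambda>x. c) S"
  by (simp add: smooth_on_def C_k_on_const)

lemma C_k_on_bounded_linear:
  assumes "bounded_linear L" "open S"
  shows "C_k_on k f S \<Longrightarrow> C_k_on k (\<lambda>x. L (f x)) S"
proof (induction k arbitrary: f)
  case 0
  then show ?case
    using assms(1) by (simp add: bounded_linear.continuous_on)
next
  case (Suc k)
  have der: "((\<lambda>x. L (f x)) has_derivative (\<lambda>v. L (frechet_derivative f (at x) v))) (at x)"
    if "x \<in> S" for x
    by (rule bounded_linear.has_derivative[OF assms(1)
          C_k_on_Suc_has_derivative[OF Suc.prems assms(2) that]])
  have "(\<lambda>x. L (f x)) differentiable_on S"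
    using der differentiable_at_imp_differentiable_on differentiable_def by blast
  moreover have "C_k_on k (\<lambda>x. frechet_derivative (\<lambda>x. L (f x)) (at x) v) S" for v
    by (rule C_k_on_cong[OF \<open>open S\<close> _ Suc.IH[OF C_k_on_Suc_frechet_derivative[OF Suc.prems]]])
       (simp add: frechet_derivative_at[OF der, symmetric])
  ultimately show ?case by simp
qed

lemma C_k_on_add:
  assumes "open S"
  shows "C_k_on k f S \<Longrightarrow> C_k_on k g S \<Longrightarrow> C_k_on k (\<lambda>x. f x + g x) S"
proof (induction k arbitrary: f g)
  case 0
  then show ?case by (simp add: continuous_on_add)
next
  case (Suc k)
  have der: "((\<lambda>x. f x + g x) has_derivative
      (\<lambda>v. frechet_derivative f (at x) v + frechet_derivative g (at x) v)) (at x)"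
    if "x \<in> S" for x
    by (rule has_derivative_add[OF Suc.prems[THEN C_k_on_Suc_has_derivative, OF assms that]])
  have "C_k_on k (\<lambda>x. frechet_derivative (\<lambda>x. f x + g x) (at x) v) S" for v
    by (rule C_k_on_cong[OF \<open>open S\<close> _ Suc.IH[OF Suc.prems[THEN C_k_on_Suc_frechet_derivative]]])
       (simp add: frechet_derivative_at[OF der, symmetric])
  then show ?case
    using Suc.prems by simp
qed

lemma (in bounded_bilinear) C_k_on:
  assumes "open S"
  shows "C_k_on k f S \<Longrightarrow> C_k_on k g S \<Longrightarrow> C_k_on k (\<lambda>x. prod (f x) (g x)) S"
proof (induction k arbitrary: f g)
  case 0
  then show ?case by (simp add: continuous_on)
next
  case (Suc k)
  have der: "((\<lambda>x. prod (f x) (g x)) has_derivative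
      (\<lambda>v. prod (f x) (frechet_derivative g (at x) v) + prod (frechet_derivative f (at x) v) (g x))) (at x)"
    if "x \<in> S" for x
    by (rule FDERIV[OF Suc.prems[THEN C_k_on_Suc_has_derivative, OF assms that]])
  have fg: "C_k_on k f S" "C_k_on k g S"
    using Suc.prems by (auto intro: C_k_on_Suc_D simp del: C_k_on.simps)
  have "C_k_on k (\<lambda>x. frechet_derivative (\<lambda>x. prod (f x) (g x)) (at x) v) S" for v
    by (rule C_k_on_cong[OF \<open>open S\<close> _
          C_k_on_add[OF \<open>open S\<close>
            Suc.IH[OF fg(1) Suc.prems(2)[THEN C_k_on_Suc_frechet_derivative]]
            Suc.IH[OF Suc.prems(1)[THEN C_k_on_Suc_frechet_derivative] fg(2)]]])
       (simp add: frechet_derivative_at[OF der, symmetric])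
  moreover have "(\<lambda>x. prod (f x) (g x)) differentiable_on S"
    using der differentiable_at_imp_differentiable_on differentiable_def by blast
  ultimately show ?case by simp
qed

lemma smooth_on_bounded_linear:
  "bounded_linear L \<Longrightarrow> open S \<Longrightarrow> smooth_on f S \<Longrightarrow> smooth_on (\<lambda>x. L (f x)) S"
  by (simp add: smooth_on_def C_k_on_bounded_linear)

lemma smooth_on_add:
  "open S \<Longrightarrow> smooth_on f S \<Longrightarrow> smooth_on g S \<Longrightarrow> smooth_on (\<lambda>x. f x + g x) S"
  by (simp add: smooth_on_def C_k_on_add)

lemma smooth_on_uminus: "open S \<Longrightarrow> smooth_on f S \<Longrightarrow> smooth_on (\<lambda>x. - f x) S"
  by (rule smooth_on_bounded_linear[OF bounded_linear_minus[OF bounded_linear_ident]])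

lemma smooth_on_diff:
  "open S \<Longrightarrow> smooth_on f S \<Longrightarrow> smooth_on g S \<Longrightarrow> smooth_on (\<lambda>x. f x - g x) S"
  using smooth_on_add[OF _ _ smooth_on_uminus, of S f g] by simp

lemma smooth_on_sum:
  assumes "open S" "\<And>i. i \<in> I \<Longrightarrow> smooth_on (f i) S"
  shows "smooth_on (\<lambda>x. \<Sum>i\<in>I. f i x) S"
  using assms(2)
  by (induction I rule: infinite_finite_induct) (auto intro: smooth_on_const smooth_on_add[OF assms(1)])

lemma smooth_on_scaleR:
  "open S \<Longrightarrow> smooth_on f S \<Longrightarrow> smooth_on g S \<Longrightarrow> smooth_on (\<lambda>x. f x *\<^sub>R g x) S"
  by (simp add: smooth_on_def bounded_bilinear.C_k_on[OF bounded_bilinear_scaleR])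

lemma smooth_on_mult:
  fixes f g :: "'a::real_normed_vector \<Rightarrow> real"
  shows "open S \<Longrightarrow> smooth_on f S \<Longrightarrow> smooth_on g S \<Longrightarrow> smooth_on (\<lambda>x. f x * g x) S"
  by (simp add: smooth_on_def bounded_bilinear.C_k_on[OF bounded_bilinear_mult])

lemma smooth_on_inner:
  "open S \<Longrightarrow> smooth_on f S \<Longrightarrow> smooth_on g S \<Longrightarrow> smooth_on (\<lambda>x. f x \<bullet> g x) S"
  by (simp add: smooth_on_def bounded_bilinear.C_k_on[OF bounded_bilinear_inner])

definition dird :: "('a::real_normed_vector \<Rightarrow> 'a) \<Rightarrow> ('a \<Rightarrow> 'b::real_normed_vector) \<Rightarrow> 'a \<Rightarrow> 'b" where
  "dird X F x = frechet_derivative F (at x) (X x)"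

lemma dird_eqI: "(F has_derivative F') (at x) \<Longrightarrow> dird X F x = F' (X x)"
  by (simp add: dird_def frechet_derivative_at[symmetric])

lemma dird_cong:
  "open S \<Longrightarrow> x \<in> S \<Longrightarrow> (\<And>y. y \<in> S \<Longrightarrow> f y = g y) \<Longrightarrow> dird X f x = dird X g x"
  unfolding dird_def by (metis frechet_derivative_cong_open)

lemma linear_expand_Basis:
  fixes L :: "'a::euclidean_space \<Rightarrow> 'b::real_vector"
  assumes "linear L"
  shows "L v = (\<Sum>i\<in>Basis. (v \<bullet> i) *\<^sub>R L i)"
proof -
  have "L v = L (\<Sum>i\<in>Basis. (v \<bullet> i) *\<^sub>R i)"
    by (simp add: euclidean_representation)
  then show ?thesis
    by (simp add: linear_sum[OF assms] linear_scale[OF assms])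
qed

text \<open>Smoothness is available for derivatives in a fixed direction, so the moving direction
  \<open>X x\<close> is expanded in the standard basis.\<close>

lemma smooth_on_dird:
  fixes X :: "'a::euclidean_space \<Rightarrow> 'a"
  assumes "open S" "smooth_on X S" "smooth_on F S"
  shows "smooth_on (dird X F) S"
proof (rule smooth_on_cong[OF \<open>open S\<close>])
  show "smooth_on (\<lambda>x. \<Sum>i\<in>Basis. (X x \<bullet> i) *\<^sub>R frechet_derivative F (at x) i) S"
    by (intro smooth_on_sum smooth_on_scaleR smooth_on_inner smooth_on_frechet_derivative
        smooth_on_const assms)
  fix y assume "y \<in> S"
  then have "linear (frechet_derivative F (at y))"
    by (meson assms has_derivative_linear smooth_on_has_derivative)
  then show "(\<Sum>i\<in>Basis. (X y \<bullet> i) *\<^sub>R frechet_derivative F (at y) i) = dird X F y"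
    unfolding dird_def by (rule linear_expand_Basis[symmetric])
qed

lemma dird_const: "dird X (\<lambda>x. c) x = 0"
  by (rule dird_eqI[OF has_derivative_const, THEN trans]) simp

context
  fixes S :: "'a::real_normed_vector set" and x :: 'a
  assumes S: "open S" "x \<in> S"
begin

lemma dird_add:
  "smooth_on f S \<Longrightarrow> smooth_on g S \<Longrightarrow> dird X (\<lambda>x. f x + g x) x = dird X f x + dird X g x"
  unfolding dird_def[of X f] dird_def[of X g]
  by (rule dird_eqI[THEN trans], rule has_derivative_add) (auto intro: smooth_on_has_derivative S)

lemma dird_bounded_linear:
  "bounded_linear L \<Longrightarrow> smooth_on f S \<Longrightarrow> dird X (\<lambda>x. L (f x)) x = L (dird X f x)"
  unfolding dird_def[of X f]
  by (rule dird_eqI[THEN trans], rule bounded_linear.has_derivative)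
     (auto intro: smooth_on_has_derivative S)

lemma dird_diff:
  "smooth_on f S \<Longrightarrow> smooth_on g S \<Longrightarrow> dird X (\<lambda>x. f x - g x) x = dird X f x - dird X g x"
  unfolding dird_def[of X f] dird_def[of X g]
  by (rule dird_eqI[THEN trans], rule has_derivative_diff) (auto intro: smooth_on_has_derivative S)

lemma dird_sum:
  "(\<And>i. i \<in> I \<Longrightarrow> smooth_on (f i) S) \<Longrightarrow> dird X (\<lambda>x. \<Sum>i\<in>I. f i x) x = (\<Sum>i\<in>I. dird X (f i) x)"
  unfolding dird_def[of X "f _"]
  by (rule dird_eqI[THEN trans], rule has_derivative_sum) (auto intro: smooth_on_has_derivative S)

lemma dird_bilinear:
  "bounded_bilinear B \<Longrightarrow> smooth_on f S \<Longrightarrow> smooth_on g S \<Longrightarrow>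
    dird X (\<lambda>x. B (f x) (g x)) x = B (f x) (dird X g x) + B (dird X f x) (g x)"
  unfolding dird_def[of X f] dird_def[of X g]
  by (rule dird_eqI[THEN trans], rule bounded_bilinear.FDERIV) (auto intro: smooth_on_has_derivative S)

lemmas dird_scaleR = dird_bilinear[OF bounded_bilinear_scaleR]
lemmas dird_inner = dird_bilinear[OF bounded_bilinear_inner]

end

subsection \<open>Symmetry of second derivatives\<close>

text \<open>The mean value theorem is applied first to the difference in \<open>b\<close>, seen as a
  function of \<open>a\<close>, and then to \<open>\<phi>1 a\<close>.\<close>

lemma real_second_difference_mvt:
  fixes \<phi> :: "real \<Rightarrow> real \<Rightarrow> real"
  assumes "0 < s"
    and d1: "\<And>a b. 0 \<le> a \<Longrightarrow> a \<le> s \<Longrightarrow> 0 \<le> b \<Longrightarrow> b \<le> s \<Longrightarrow>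
        ((\<lambda>a. \<phi> a b) has_real_derivative \<phi>1 a b) (at a)"
    and d12: "\<And>a b. 0 \<le> a \<Longrightarrow> a \<le> s \<Longrightarrow> 0 \<le> b \<Longrightarrow> b \<le> s \<Longrightarrow>
        ((\<lambda>b. \<phi>1 a b) has_real_derivative \<phi>12 a b) (at b)"
  obtains a b where "0 \<le> a" "a \<le> s" "0 \<le> b" "b \<le> s"
    "\<phi> s s - \<phi> s 0 - \<phi> 0 s + \<phi> 0 0 = s * s * \<phi>12 a b"
proof -
  have "\<exists>a>0. a < s \<and> (\<lambda>a. \<phi> a s - \<phi> a 0) s - (\<lambda>a. \<phi> a s - \<phi> a 0) 0 = (s - 0) * (\<phi>1 a s - \<phi>1 a 0)"
    using \<open>0 < s\<close> by (intro MVT2) (auto intro!: DERIV_diff d1)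
  then obtain a where a: "0 < a" "a < s"
    "\<phi> s s - \<phi> s 0 - (\<phi> 0 s - \<phi> 0 0) = s * (\<phi>1 a s - \<phi>1 a 0)"
    by auto
  have "\<exists>b>0. b < s \<and> \<phi>1 a s - \<phi>1 a 0 = (s - 0) * \<phi>12 a b"
    using a \<open>0 < s\<close> by (intro MVT2) (auto intro!: d12)
  then obtain b where "0 < b" "b < s" "\<phi>1 a s - \<phi>1 a 0 = s * \<phi>12 a b"
    by auto
  then show ?thesis
    using that[of a b] a by (simp add: algebra_simps)
qed

text \<open>After division by \<open>s * s\<close> the second difference tends to the mixed
  derivative. The difference is symmetric in \<open>u\<close> and \<open>v\<close>, which is how the
  symmetry of second derivatives follows below.\<close>

lemma real_second_derivative_approx:
  fixes f :: "'a::real_normed_vector \<Rightarrow> real"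
  assumes "open S" "x \<in> S" "smooth_on f S" "0 < \<epsilon>"
  shows "eventually (\<lambda>s. \<bar>f (x + s *\<^sub>R u + s *\<^sub>R v) - f (x + s *\<^sub>R u) - f (x + s *\<^sub>R v) + f x
            - s * s * frechet_derivative (\<lambda>y. frechet_derivative f (at y) u) (at x) v\<bar> \<le> s * s * \<epsilon>)
          (at_right 0)"
proof -
  define D where "D = (\<lambda>y. frechet_derivative (\<lambda>y. frechet_derivative f (at y) u) (at y) v)"
  have "smooth_on D S"
    unfolding D_def by (intro smooth_on_frechet_derivative assms)
  then have "isCont D x"
    using assms(1,2) continuous_on_eq_continuous_at smooth_on_imp_continuous_on by blast
  then obtain d1 where d1: "d1 > 0" "\<And>y. dist y x < d1 \<Longrightarrow> \<bar>D y - D x\<bar> < \<epsilon>"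
    using \<open>0 < \<epsilon>\<close> unfolding continuous_at_eps_delta dist_real_def by blast
  obtain d2 where d2: "d2 > 0" "ball x d2 \<subseteq> S"
    using assms(1,2) open_contains_ball by blast
  \<comment> \<open>Small enough that the whole parallelogram with sides
    \<open>s *\<^sub>R u\<close> and \<open>s *\<^sub>R v\<close> stays within both radii; the
    summand 1 covers \<open>u = v = 0\<close>.\<close>
  define d where "d = min d1 d2 / (norm u + norm v + 1)"
  have "d > 0"
    using d1(1) d2(1) by (simp add: d_def add_nonneg_pos)
  have near: "dist (x + a *\<^sub>R u + b *\<^sub>R v) x < min d1 d2"
    if "0 \<le> a" "a \<le> s" "0 \<le> b" "b \<le> s" "s < d" for a b s
  proof -
    have "norm (a *\<^sub>R u + b *\<^sub>R v) \<le> a * norm u + b * norm v"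
      using that by (metis abs_of_nonneg norm_scaleR norm_triangle_ineq)
    also have "\<dots> \<le> s * norm u + s * norm v"
      using that by (intro add_mono mult_right_mono) auto
    also have "\<dots> \<le> s * (norm u + norm v + 1)"
      using that by (simp add: algebra_simps)
    also have "\<dots> < d * (norm u + norm v + 1)"
      using that by (intro mult_strict_right_mono) (auto simp: add_nonneg_pos)
    also have "\<dots> = min d1 d2"
    proof -
      have "norm u + norm v + 1 > 0"
        by (simp add: add_nonneg_pos)
      then show ?thesis
        by (simp add: d_def)
    qed
    finally show ?thesis
      by (simp add: dist_norm add.assoc)
  qed
  show ?thesis
    unfolding eventually_at_right_field
  proof (intro exI[of _ d] conjI \<open>d > 0\<close> allI impI)
    fix s :: real assume s: "0 < s" "s < d"
    have inS: "x + a *\<^sub>R u + b *\<^sub>R v \<in> S" if "0 \<le> a" "a \<le> s" "0 \<le> b" "b \<le> s" for a b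
      using near[OF that s(2)] d2(2) by (auto simp: dist_commute subset_iff)
    have der1: "((\<lambda>a. f (x + a *\<^sub>R u + b *\<^sub>R v)) has_real_derivative
        frechet_derivative f (at (x + a *\<^sub>R u + b *\<^sub>R v)) u) (at a)"
      if "0 \<le> a" "a \<le> s" "0 \<le> b" "b \<le> s" for a b
    proof -
      have 1: "((\<lambda>a. x + a *\<^sub>R u + b *\<^sub>R v) has_derivative (\<lambda>h. h *\<^sub>R u)) (at a)"
        by (auto intro!: derivative_eq_intros)
      have 2: "(f has_derivative frechet_derivative f (at (x + a *\<^sub>R u + b *\<^sub>R v)))
          (at (x + a *\<^sub>R u + b *\<^sub>R v))"
        by (rule smooth_on_has_derivative[OF assms(3,1) inS[OF that]])
      have "((\<lambda>a. f (x + a *\<^sub>R u + b *\<^sub>R v)) has_derivative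
          (\<lambda>h. frechet_derivative f (at (x + a *\<^sub>R u + b *\<^sub>R v)) (h *\<^sub>R u))) (at a)"
        using has_derivative_compose[OF 1 2] .
      then show ?thesis
        by (rule has_derivative_imp_has_field_derivative)
           (simp add: linear_scale[OF has_derivative_linear[OF 2]])
    qed
    have der2: "((\<lambda>b. frechet_derivative f (at (x + a *\<^sub>R u + b *\<^sub>R v)) u) has_real_derivative
        D (x + a *\<^sub>R u + b *\<^sub>R v)) (at b)"
      if "0 \<le> a" "a \<le> s" "0 \<le> b" "b \<le> s" for a b
    proof -
      let ?F = "\<lambda>y. frechet_derivative f (at y) u"
      have 1: "((\<lambda>b. x + a *\<^sub>R u + b *\<^sub>R v) has_derivative (\<lambda>h. h *\<^sub>R v)) (at b)"
        by (auto intro!: derivative_eq_intros)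
      have 2: "(?F has_derivative frechet_derivative ?F (at (x + a *\<^sub>R u + b *\<^sub>R v)))
          (at (x + a *\<^sub>R u + b *\<^sub>R v))"
        by (rule smooth_on_has_derivative[OF smooth_on_frechet_derivative[OF assms(3)] assms(1)
              inS[OF that]])
      have "((\<lambda>b. ?F (x + a *\<^sub>R u + b *\<^sub>R v)) has_derivative
          (\<lambda>h. frechet_derivative ?F (at (x + a *\<^sub>R u + b *\<^sub>R v)) (h *\<^sub>R v))) (at b)"
        using has_derivative_compose[OF 1 2] .
      then show ?thesis
        unfolding D_def
        by (rule has_derivative_imp_has_field_derivative)
           (simp add: linear_scale[OF has_derivative_linear[OF 2]])
    qed
    obtain a b where ab: "0 \<le> a" "a \<le> s" "0 \<le> b" "b \<le> s" and
      eq: "f (x + s *\<^sub>R u + s *\<^sub>R v) - f (x + s *\<^sub>R u + 0 *\<^sub>R v) - f (x + 0 *\<^sub>R u + s *\<^sub>R v)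
        + f (x + 0 *\<^sub>R u + 0 *\<^sub>R v) = s * s * D (x + a *\<^sub>R u + b *\<^sub>R v)"
      using real_second_difference_mvt[OF s(1),
          of "\<lambda>a b. f (x + a *\<^sub>R u + b *\<^sub>R v)"
             "\<lambda>a b. frechet_derivative f (at (x + a *\<^sub>R u + b *\<^sub>R v)) u"
             "\<lambda>a b. D (x + a *\<^sub>R u + b *\<^sub>R v)"] der1 der2 by blast
    have "\<bar>D (x + a *\<^sub>R u + b *\<^sub>R v) - D x\<bar> < \<epsilon>"
      using near[OF ab s(2)] by (intro d1(2)) simp
    then have "\<bar>s * s * D (x + a *\<^sub>R u + b *\<^sub>R v) - s * s * D x\<bar> \<le> s * s * \<epsilon>"
      by (simp add: right_diff_distrib[symmetric] abs_mult s)
    then show "\<bar>f (x + s *\<^sub>R u + s *\<^sub>R v) - f (x + s *\<^sub>R u) - f (x + s *\<^sub>R v) + f x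
            - s * s * frechet_derivative (\<lambda>y. frechet_derivative f (at y) u) (at x) v\<bar> \<le> s * s * \<epsilon>"
      using eq by (simp add: D_def)
  qed
qed

lemma real_second_derivative_symmetric:
  fixes f :: "'a::real_normed_vector \<Rightarrow> real"
  assumes "open S" "x \<in> S" "smooth_on f S"
  shows "frechet_derivative (\<lambda>y. frechet_derivative f (at y) u) (at x) v
       = frechet_derivative (\<lambda>y. frechet_derivative f (at y) v) (at x) u" (is "?A = ?B")
proof (rule ccontr)
  assume "?A \<noteq> ?B"
  \<comment> \<open>Both approximations err by at most \<open>s * s * \<epsilon>\<close>, together
    by half of \<open>s * s * \<bar>?A - ?B\<bar>\<close>.\<close>
  define \<epsilon> where "\<epsilon> = \<bar>?A - ?B\<bar> / 4"
  have "\<epsilon> > 0"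
    using \<open>?A \<noteq> ?B\<close> by (simp add: \<epsilon>_def)
  have "eventually (\<lambda>s. (0::real) < s) (at_right 0)"
    by (simp add: eventually_at_right_less)
  with real_second_derivative_approx[OF assms \<open>\<epsilon> > 0\<close>, of u v]
    real_second_derivative_approx[OF assms \<open>\<epsilon> > 0\<close>, of v u]
  have "eventually (\<lambda>s::real. False) (at_right 0)"
  proof eventually_elim
    case (elim s)
    define \<Delta> where "\<Delta> = f (x + s *\<^sub>R u + s *\<^sub>R v) - f (x + s *\<^sub>R u) - f (x + s *\<^sub>R v) + f x"
    have 1: "\<bar>\<Delta> - s * s * ?A\<bar> \<le> s * s * \<epsilon>"
      using elim(1) by (simp add: \<Delta>_def)
    have "\<Delta> = f (x + s *\<^sub>R v + s *\<^sub>R u) - f (x + s *\<^sub>R v) - f (x + s *\<^sub>R u) + f x"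
      by (simp add: \<Delta>_def add.commute add.left_commute)
    then have 2: "\<bar>\<Delta> - s * s * ?B\<bar> \<le> s * s * \<epsilon>"
      using elim(2) by simp
    have "s * s * \<bar>?A - ?B\<bar> = \<bar>s * s * ?A - s * s * ?B\<bar>"
      by (simp add: right_diff_distrib[symmetric] abs_mult)
    also have "\<dots> \<le> s * s * \<epsilon> + s * s * \<epsilon>"
      using 1 2 by linarith
    finally have "s * s * \<bar>?A - ?B\<bar> \<le> s * s * (2 * \<epsilon>)"
      by (simp add: algebra_simps)
    then show False
      using elim(3) \<open>\<epsilon> > 0\<close> by (simp add: \<epsilon>_def)
  qed
  then show False
    by simp
qed

lemma second_derivative_symmetric:
  fixes f :: "'a::real_normed_vector \<Rightarrow> 'b::euclidean_space"
  assumes "open S" "x \<in> S" "smooth_on f S"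
  shows "frechet_derivative (\<lambda>y. frechet_derivative f (at y) u) (at x) v
       = frechet_derivative (\<lambda>y. frechet_derivative f (at y) v) (at x) u"
proof (rule euclidean_eqI)
  fix b :: 'b assume "b \<in> Basis"
  have sm: "smooth_on (\<lambda>y. f y \<bullet> b) S"
    using assms by (intro smooth_on_inner smooth_on_const)
  have 1: "frechet_derivative (\<lambda>y. f y \<bullet> b) (at y) u = frechet_derivative f (at y) u \<bullet> b"
    if "y \<in> S" for y u
    using dird_bounded_linear[OF assms(1) that bounded_linear_inner_left assms(3), of "\<lambda>_. u" b]
    by (simp add: dird_def)
  have 2: "frechet_derivative (\<lambda>y. frechet_derivative (\<lambda>y. f y \<bullet> b) (at y) u) (at x) v
    = frechet_derivative (\<lambda>y. frechet_derivative f (at y) u) (at x) v \<bullet> b" for u v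
  proof -
    have "frechet_derivative (\<lambda>y. frechet_derivative (\<lambda>y. f y \<bullet> b) (at y) u) (at x)
      = frechet_derivative (\<lambda>y. frechet_derivative f (at y) u \<bullet> b) (at x)"
      by (rule frechet_derivative_cong_open[OF assms(1,2)]) (simp add: 1)
    then show ?thesis
      using dird_bounded_linear[OF assms(1,2) bounded_linear_inner_left
          smooth_on_frechet_derivative[OF assms(3)], of "\<lambda>_. v" u b]
      by (simp add: dird_def)
  qed
  show "frechet_derivative (\<lambda>y. frechet_derivative f (at y) u) (at x) v \<bullet> b
       = frechet_derivative (\<lambda>y. frechet_derivative f (at y) v) (at x) u \<bullet> b"
    using real_second_derivative_symmetric[OF assms(1,2) sm, of u v] by (simp add: 2)
qed

text \<open>The product rule separates the Hessian of \<open>F\<close> from a first derivative of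
  \<open>F\<close>; only the latter sees how \<open>Y\<close> varies.\<close>

lemma dird_dird:
  fixes F :: "'a::euclidean_space \<Rightarrow> 'b::euclidean_space"
  assumes "open S" "x \<in> S" "smooth_on F S" "smooth_on X S" "smooth_on Y S"
  shows "dird X (dird Y F) x
    = frechet_derivative (\<lambda>y. frechet_derivative F (at y) (Y x)) (at x) (X x)
      + frechet_derivative F (at x) (dird X Y x)"
proof -
  have lin: "linear (frechet_derivative F (at y))" if "y \<in> S" for y
    by (meson assms that has_derivative_linear smooth_on_has_derivative)
  have sF: "smooth_on (\<lambda>y. frechet_derivative F (at y) i) S" for i
    by (rule smooth_on_frechet_derivative[OF assms(3)])
  have sY: "smooth_on (\<lambda>y. Y y \<bullet> i) S" for i
    by (intro smooth_on_inner smooth_on_const assms)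
  have "dird X (dird Y F) x = dird X (\<lambda>y. \<Sum>i\<in>Basis. (Y y \<bullet> i) *\<^sub>R frechet_derivative F (at y) i) x"
    by (rule dird_cong[OF assms(1,2)]) (simp add: dird_def linear_expand_Basis[OF lin, symmetric])
  also have "\<dots> = (\<Sum>i\<in>Basis. (Y x \<bullet> i) *\<^sub>R dird X (\<lambda>y. frechet_derivative F (at y) i) x
        + (dird X Y x \<bullet> i) *\<^sub>R frechet_derivative F (at x) i)"
    using sF sY assms
    by (simp add: dird_sum[OF assms(1,2)] smooth_on_scaleR dird_scaleR[OF assms(1,2)]
        dird_bounded_linear[OF assms(1,2) bounded_linear_inner_left])
  also have "\<dots> = dird X (\<lambda>y. \<Sum>i\<in>Basis. (Y x \<bullet> i) *\<^sub>R frechet_derivative F (at y) i) x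
        + (\<Sum>i\<in>Basis. (dird X Y x \<bullet> i) *\<^sub>R frechet_derivative F (at x) i)"
    using sF assms
    by (simp add: sum.distrib dird_sum[OF assms(1,2)] smooth_on_scaleR smooth_on_const
        dird_bounded_linear[OF assms(1,2) bounded_linear_scaleR_right])
  also have "dird X (\<lambda>y. \<Sum>i\<in>Basis. (Y x \<bullet> i) *\<^sub>R frechet_derivative F (at y) i) x
      = dird X (\<lambda>y. frechet_derivative F (at y) (Y x)) x"
    by (rule dird_cong[OF assms(1,2)]) (simp add: linear_expand_Basis[OF lin, symmetric])
  also have "(\<Sum>i\<in>Basis. (dird X Y x \<bullet> i) *\<^sub>R frechet_derivative F (at x) i)
      = frechet_derivative F (at x) (dird X Y x)"
    by (simp add: linear_expand_Basis[OF lin[OF assms(2)], symmetric])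
  finally show ?thesis
    unfolding dird_def[of X "\<lambda>y. frechet_derivative F (at y) (Y x)"] .
qed

text \<open>The Hessian terms cancel by symmetry, and the derivative of \<open>F\<close> along the
  Lie bracket of \<open>X\<close> and \<open>Y\<close> remains.\<close>

lemma dird_commutator:
  fixes F :: "'a::euclidean_space \<Rightarrow> 'b::euclidean_space"
  assumes "open S" "x \<in> S" "smooth_on F S" "smooth_on X S" "smooth_on Y S"
  shows "dird X (dird Y F) x - dird Y (dird X F) x
    = frechet_derivative F (at x) (dird X Y x - dird Y X x)"
proof -
  have "linear (frechet_derivative F (at x))"
    by (meson assms has_derivative_linear smooth_on_has_derivative)
  then show ?thesis
    using second_derivative_symmetric[OF assms(1-3), of "X x" "Y x"]
    by (simp add: dird_dird[OF assms] dird_dird[OF assms(1-3,5,4)] linear_diff)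
qed

section \<open>Moving frames\<close>

locale moving_frame =
  fixes W :: "(real ^ 4) set" and g :: "real ^ 4 \<Rightarrow> 'b::euclidean_space"
    and e :: "4 \<Rightarrow> real ^ 4 \<Rightarrow> real ^ 4"
  assumes open_W: "open W" and smooth_g: "smooth_on g W" and smooth_e: "\<And>i. smooth_on (e i) W"
    and orthonormal: "\<And>x i j. x \<in> W \<Longrightarrow> dird (e i) g x \<bullet> dird (e j) g x = (if i = j then 1 else 0)"
begin

abbreviation D :: "4 \<Rightarrow> (real ^ 4 \<Rightarrow> 'c::real_normed_vector) \<Rightarrow> real ^ 4 \<Rightarrow> 'c" where
  "D i \<equiv> dird (e i)"

abbreviation E :: "4 \<Rightarrow> real ^ 4 \<Rightarrow> 'b" where
  "E i \<equiv> D i g"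

text \<open>The coefficients of the Levi-Civita connection in the frame.\<close>

definition G :: "4 \<Rightarrow> 4 \<Rightarrow> 4 \<Rightarrow> real ^ 4 \<Rightarrow> real" where
  "G i j k x = D i (E j) x \<bullet> E k x"

definition nproj :: "real ^ 4 \<Rightarrow> 'b \<Rightarrow> 'b" where
  "nproj x v = v - (\<Sum>k\<in>UNIV. (v \<bullet> E k x) *\<^sub>R E k x)"

text \<open>The normal connection when \<open>F\<close> is a normal field; applied to
  \<open>E j\<close> it gives the second fundamental form instead.\<close>

definition nab :: "4 \<Rightarrow> (real ^ 4 \<Rightarrow> 'b) \<Rightarrow> real ^ 4 \<Rightarrow> 'b" where
  "nab i F x = nproj x (D i F x)"

definition h :: "4 \<Rightarrow> 4 \<Rightarrow> real ^ 4 \<Rightarrow> 'b" where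
  "h i j = nab i (E j)"

lemma smooth_D: "smooth_on F W \<Longrightarrow> smooth_on (D i F) W"
  by (rule smooth_on_dird[OF open_W smooth_e])

lemma smooth_G: "smooth_on (G i j k) W"
  unfolding G_def by (intro smooth_on_inner smooth_D smooth_g open_W)

lemma smooth_nab:
  assumes "smooth_on F W"
  shows "smooth_on (nab i F) W"
proof -
  have "nab i F = (\<lambda>x. D i F x - (\<Sum>k\<in>UNIV. (D i F x \<bullet> E k x) *\<^sub>R E k x))"
    by (simp add: fun_eq_iff nab_def nproj_def)
  then show ?thesis
    by (auto intro!: smooth_on_diff smooth_on_sum smooth_on_scaleR smooth_on_inner smooth_D smooth_g
        open_W assms)
qed

lemma smooth_h: "smooth_on (h i j) W"
  unfolding h_def by (intro smooth_nab smooth_D smooth_g)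

lemma linear_nproj: "linear (nproj x)"
  by (rule linearI)
     (simp_all add: nproj_def inner_add_left scaleR_add_left sum.distrib algebra_simps
       scaleR_sum_right)

lemmas nproj_add = linear_add[OF linear_nproj]
lemmas nproj_diff = linear_diff[OF linear_nproj]
lemmas nproj_scaleR = linear_scale[OF linear_nproj]
lemmas nproj_sum = linear_sum[OF linear_nproj]

context
  fixes x assumes x: "x \<in> W"
begin

lemma E_E: "E i x \<bullet> E j x = (if i = j then 1 else 0)"
  using orthonormal[OF x] .

lemma E_coeff: "(\<Sum>l\<in>UNIV. c l *\<^sub>R E l x) \<bullet> E k x = c k"
proof -
  have "(\<Sum>l\<in>UNIV. c l *\<^sub>R E l x) \<bullet> E k x = (\<Sum>l\<in>UNIV. if l = k then c l else 0)"
    unfolding inner_sum_left by (rule sum.cong) (auto simp: E_E)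
  then show ?thesis
    by simp
qed

lemma nproj_E: "nproj x (E i x) = 0"
proof -
  have "(\<Sum>k\<in>UNIV. (E i x \<bullet> E k x) *\<^sub>R E k x) = (\<Sum>k\<in>UNIV. if i = k then E k x else 0)"
    by (rule sum.cong) (auto simp: E_E)
  then show ?thesis
    by (simp add: nproj_def)
qed

lemma nproj_inner_E: "nproj x v \<bullet> E i x = 0"
proof -
  show ?thesis
    by (simp only: nproj_def inner_diff_left E_coeff diff_self)
qed

lemma nproj_normal: "(\<And>k. v \<bullet> E k x = 0) \<Longrightarrow> nproj x v = v"
  by (simp add: nproj_def)

lemma nab_E: "nab i F x \<bullet> E k x = 0"
  by (simp add: nab_def nproj_inner_E)

lemma h_E: "h i j x \<bullet> E k x = 0"
  by (simp add: h_def nab_E)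

lemma D_E: "D i (E j) x = (\<Sum>k\<in>UNIV. G i j k x *\<^sub>R E k x) + h i j x"
  by (simp add: h_def nab_def nproj_def G_def)

lemma G_antisym: "G i j k x = - G i k j x"
proof -
  have "D i (\<lambda>y. E j y \<bullet> E k y) x = D i (\<lambda>y. if j = k then 1 else 0) x"
    by (rule dird_cong[OF open_W x]) (simp add: orthonormal)
  also have "\<dots> = 0"
    by (rule dird_const)
  finally show ?thesis
    using dird_inner[OF open_W x smooth_D[OF smooth_g] smooth_D[OF smooth_g], of "e i" j k]
    by (simp add: G_def inner_commute)
qed

lemma G_diag: "G i j j x = 0"
  using G_antisym[of i j j] by simp

text \<open>Orthonormality of the images \<open>E l x\<close> makes the four vectors
  \<open>e l x\<close> independent, hence a basis of \<open>real ^ 4\<close>, and the coefficients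
  can be read off after applying the derivative of \<open>g\<close>.\<close>

lemma frame_expand: "v = (\<Sum>l\<in>UNIV. (frechet_derivative g (at x) v \<bullet> E l x) *\<^sub>R e l x)"
proof -
  have lin: "linear (frechet_derivative g (at x))"
    by (meson open_W smooth_g x has_derivative_linear smooth_on_has_derivative)
  have dg: "frechet_derivative g (at x) (e l x) = E l x" for l
    by (simp add: dird_def)
  have inj: "inj (\<lambda>l. e l x)"
    by (metis (mono_tags, lifting) E_E dg injI one_neq_zero)
  have "independent (range (\<lambda>l. e l x))"
    unfolding independent_explicit
  proof (intro conjI allI impI ballI)
    fix u v assume "(\<Sum>v\<in>range (\<lambda>l. e l x). u v *\<^sub>R v) = 0" and v: "v \<in> range (\<lambda>l. e l x)"
    then have "(\<Sum>l\<in>UNIV. u (e l x) *\<^sub>R e l x) = 0"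
      by (simp add: sum.reindex[OF inj])
    then have "frechet_derivative g (at x) (\<Sum>l\<in>UNIV. u (e l x) *\<^sub>R e l x) = 0"
      by (simp add: linear_0[OF lin])
    then have "(\<Sum>l\<in>UNIV. u (e l x) *\<^sub>R E l x) = 0"
      by (simp add: linear_sum[OF lin] linear_scale[OF lin] dg)
    then have "u (e k x) = 0" for k
      using E_coeff[of "\<lambda>l. u (e l x)" k] by simp
    then show "u v = 0"
      using v by auto
  qed simp
  moreover have "card (range (\<lambda>l. e l x)) = DIM(real ^ 4)"
    by (simp add: card_image[OF inj])
  ultimately have "UNIV \<subseteq> span (range (\<lambda>l. e l x))"
    by (intro card_ge_dim_independent) auto
  then have "v \<in> span (range (\<lambda>l. e l x))"
    by blast
  then obtain u where "v = (\<Sum>w\<in>range (\<lambda>l. e l x). u w *\<^sub>R w)"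
    using span_finite[of "range (\<lambda>l. e l x)"] by auto
  then have u: "v = (\<Sum>l\<in>UNIV. u (e l x) *\<^sub>R e l x)"
    by (simp add: sum.reindex[OF inj])
  have "frechet_derivative g (at x) v = (\<Sum>l\<in>UNIV. u (e l x) *\<^sub>R E l x)"
    by (subst u) (simp add: linear_sum[OF lin] linear_scale[OF lin] dg)
  then have "frechet_derivative g (at x) v \<bullet> E k x = u (e k x)" for k
    by (simp only: E_coeff)
  then show ?thesis
    using u by simp
qed

text \<open>The coefficients of the Lie bracket of \<open>e i\<close> and \<open>e j\<close> are
  found by applying the bracket formula to \<open>g\<close> itself; they express that the connection
  is torsion free. The same bracket then acts on any \<open>F\<close>.\<close>

lemma commutator:
  fixes F :: "real ^ 4 \<Rightarrow> 'c::euclidean_space"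
  assumes "smooth_on F W"
  shows "D i (D j F) x - D j (D i F) x = (\<Sum>l\<in>UNIV. (G i j l x - G j i l x) *\<^sub>R D l F x)"
proof -
  define b where "b = D i (e j) x - D j (e i) x"
  have linF: "linear (frechet_derivative F (at x))"
    by (meson open_W assms x has_derivative_linear smooth_on_has_derivative)
  have "frechet_derivative g (at x) b = D i (E j) x - D j (E i) x"
    unfolding b_def by (rule dird_commutator[symmetric, OF open_W x smooth_g smooth_e smooth_e])
  then have "frechet_derivative g (at x) b \<bullet> E l x = G i j l x - G j i l x" for l
    by (simp add: G_def inner_diff_left)
  then have b: "b = (\<Sum>l\<in>UNIV. (G i j l x - G j i l x) *\<^sub>R e l x)"
    using frame_expand[of b] by simp
  have "D i (D j F) x - D j (D i F) x = frechet_derivative F (at x) b"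
    unfolding b_def by (rule dird_commutator[OF open_W x assms smooth_e smooth_e])
  also have "\<dots> = (\<Sum>l\<in>UNIV. (G i j l x - G j i l x) *\<^sub>R D l F x)"
    by (subst b) (simp add: linear_sum[OF linF] linear_scale[OF linF] dird_def)
  finally show ?thesis .
qed

lemma h_sym: "h i j x = h j i x"
proof -
  have "h i j x - h j i x = nproj x (D i (E j) x - D j (E i) x)"
    by (simp add: h_def nab_def nproj_diff)
  also have "\<dots> = 0"
    by (simp add: commutator[OF smooth_g] nproj_sum nproj_scaleR nproj_E)
  finally show ?thesis
    by simp
qed

lemma nproj_D_E: "nproj x (D i (E j) x) = h i j x"
  by (simp add: h_def nab_def)

lemma nab_add: "smooth_on F W \<Longrightarrow> smooth_on F' W \<Longrightarrow> nab i (\<lambda>y. F y + F' y) x = nab i F x + nab i F' x"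
  by (simp add: nab_def dird_add[OF open_W x] nproj_add)

lemma nab_diff: "smooth_on F W \<Longrightarrow> smooth_on F' W \<Longrightarrow> nab i (\<lambda>y. F y - F' y) x = nab i F x - nab i F' x"
  by (simp add: nab_def dird_diff[OF open_W x] nproj_diff)

lemma nab_sum: "(\<And>k. smooth_on (F k) W) \<Longrightarrow> nab i (\<lambda>y. \<Sum>k\<in>I. F k y) x = (\<Sum>k\<in>I. nab i (F k) x)"
  by (simp add: nab_def dird_sum[OF open_W x] nproj_sum)

lemma nab_scaleR:
  "smooth_on c W \<Longrightarrow> smooth_on F W \<Longrightarrow>
    nab i (\<lambda>y. c y *\<^sub>R F y) x = c x *\<^sub>R nab i F x + D i c x *\<^sub>R nproj x (F x)"
  by (simp add: nab_def dird_scaleR[OF open_W x] nproj_add nproj_scaleR)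

lemma nab_scaleR_const: "smooth_on F W \<Longrightarrow> nab i (\<lambda>y. c *\<^sub>R F y) x = c *\<^sub>R nab i F x"
  by (simp add: nab_scaleR smooth_on_const dird_const)

lemma nab_cong: "(\<And>y. y \<in> W \<Longrightarrow> F y = F' y) \<Longrightarrow> nab i F x = nab i F' x"
  unfolding nab_def using dird_cong[OF open_W x] by metis

text \<open>The Weingarten formula: differentiating \<open>F \<bullet> E k = 0\<close> determines
  the tangential components.\<close>

lemma D_normal:
  assumes "smooth_on F W" "\<And>y k. y \<in> W \<Longrightarrow> F y \<bullet> E k y = 0"
  shows "D i F x = nab i F x - (\<Sum>k\<in>UNIV. (F x \<bullet> h i k x) *\<^sub>R E k x)"
proof -
  have "D i F x \<bullet> E k x = - (F x \<bullet> h i k x)" for k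
  proof -
    have "D i (\<lambda>y. F y \<bullet> E k y) x = D i (\<lambda>y. 0) x"
      by (rule dird_cong[OF open_W x]) (simp add: assms(2))
    then have "F x \<bullet> D i (E k) x + D i F x \<bullet> E k x = 0"
      by (simp add: dird_const dird_inner[OF open_W x assms(1) smooth_D[OF smooth_g]])
    moreover have "F x \<bullet> D i (E k) x = F x \<bullet> h i k x"
      by (simp add: D_E inner_add_right inner_sum_right assms(2)[OF x])
    ultimately show ?thesis
      by simp
  qed
  then show ?thesis
    by (simp add: nab_def nproj_def sum_negf)
qed

text \<open>The tangential part of the commutator of second derivatives of \<open>E k\<close>. The
  derivatives of the coefficients stand alone on the left, so that linear combinations of instances
  can be formed.\<close>

lemma gauss:
  "D i (G j k m) x - D j (G i k m) x =
     (\<Sum>l\<in>UNIV. (G i j l x - G j i l x) * G l k m x)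
     + (\<Sum>l\<in>UNIV. G j k l x * G i m l x - G i k l x * G j m l x)
     + h j k x \<bullet> h i m x - h i k x \<bullet> h j m x"
proof -
  have DG: "D i (G j k m) x = D i (D j (E k)) x \<bullet> E m x + D j (E k) x \<bullet> D i (E m) x" for i j
    unfolding G_def
    using dird_inner[OF open_W x smooth_D[OF smooth_D[OF smooth_g]] smooth_D[OF smooth_g]]
    by (simp add: add.commute)
  have in2: "D j (E k) x \<bullet> D i (E m) x = (\<Sum>l\<in>UNIV. G j k l x * G i m l x) + h j k x \<bullet> h i m x"
    for i j
  proof -
    have 1: "(\<Sum>k\<in>UNIV. a k *\<^sub>R E k x) \<bullet> (\<Sum>k\<in>UNIV. b k *\<^sub>R E k x) = (\<Sum>l\<in>UNIV. a l * b l)"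
      for a b :: "4 \<Rightarrow> real"
    proof -
      show ?thesis
        by (simp only: inner_sum_right inner_scaleR_right E_coeff mult.commute)
    qed
    have 2: "h a b x \<bullet> (\<Sum>k\<in>UNIV. c k *\<^sub>R E k x) = 0" for a b c
      by (simp add: inner_sum_right h_E)
    show ?thesis
      unfolding D_E by (simp add: inner_add_left inner_add_right 1 2 inner_commute[of _ "h i m x"])
  qed
  have "D i (D j (E k)) x \<bullet> E m x - D j (D i (E k)) x \<bullet> E m x
      = (\<Sum>l\<in>UNIV. (G i j l x - G j i l x) * G l k m x)"
    using commutator[OF smooth_D[OF smooth_g], of i j k]
    by (simp add: inner_diff_left[symmetric] inner_sum_left G_def)
  then show ?thesis
    unfolding DG in2 by (simp add: sum_subtractf)
qed

end

text \<open>The normal part of the commutator applied to a normal field; the tangential terms of the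
  Weingarten formula feed back through \<open>h\<close>.\<close>

lemma ricci:
  assumes x: "x \<in> W" and F: "smooth_on F W" and normal: "\<And>y k. y \<in> W \<Longrightarrow> F y \<bullet> E k y = 0"
  shows "nab i (nab j F) x - nab j (nab i F) x =
     (\<Sum>l\<in>UNIV. (G i j l x - G j i l x) *\<^sub>R nab l F x)
     + (\<Sum>k\<in>UNIV. (F x \<bullet> h j k x) *\<^sub>R h i k x - (F x \<bullet> h i k x) *\<^sub>R h j k x)"
proof -
  have "nproj x (D i (D j F) x) = nab i (nab j F) x - (\<Sum>k\<in>UNIV. (F x \<bullet> h j k x) *\<^sub>R h i k x)" for i j
  proof -
    have sm: "smooth_on (\<lambda>y. (F y \<bullet> h j k y) *\<^sub>R E k y) W" for k
      by (intro smooth_on_scaleR smooth_on_inner smooth_h smooth_D smooth_g F open_W)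
    have "nproj x (D i (D j F) x) = nab i (\<lambda>y. nab j F y - (\<Sum>k\<in>UNIV. (F y \<bullet> h j k y) *\<^sub>R E k y)) x"
      unfolding nab_def[of i, symmetric] by (rule nab_cong[OF x]) (rule D_normal[OF _ F normal])
    also have "\<dots> = nab i (nab j F) x - (\<Sum>k\<in>UNIV. nab i (\<lambda>y. (F y \<bullet> h j k y) *\<^sub>R E k y) x)"
      by (simp only: nab_diff[OF x smooth_nab[OF F] smooth_on_sum[OF open_W sm]] nab_sum[OF x sm])
    also have "(\<Sum>k\<in>UNIV. nab i (\<lambda>y. (F y \<bullet> h j k y) *\<^sub>R E k y) x)
        = (\<Sum>k\<in>UNIV. (F x \<bullet> h j k x) *\<^sub>R h i k x)"
      using nab_scaleR[OF x smooth_on_inner[OF open_W F smooth_h] smooth_D[OF smooth_g]]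
      by (simp add: nproj_E[OF x] h_def)
    finally show ?thesis .
  qed
  then have nab2: "nab i (nab j F) x = nproj x (D i (D j F) x) + (\<Sum>k\<in>UNIV. (F x \<bullet> h j k x) *\<^sub>R h i k x)"
    for i j
    by simp
  have "nproj x (D i (D j F) x) - nproj x (D j (D i F) x)
      = (\<Sum>l\<in>UNIV. (G i j l x - G j i l x) *\<^sub>R nab l F x)"
    unfolding nproj_diff[symmetric] commutator[OF x F]
    by (simp add: nproj_sum nproj_scaleR nab_def)
  then show ?thesis
    unfolding nab2 sum_subtractf add_diff_add by (simp only:)
qed

text \<open>The components of the covariant derivative of the second fundamental form; by
  \<open>codazzi\<close> and \<open>cubic_swap\<close> they are totally symmetric.\<close>

definition cubic :: "4 \<Rightarrow> 4 \<Rightarrow> 4 \<Rightarrow> real ^ 4 \<Rightarrow> 'b" where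
  "cubic i j k x = nab i (h j k) x - (\<Sum>l\<in>UNIV. G i j l x *\<^sub>R h l k x) - (\<Sum>l\<in>UNIV. G i k l x *\<^sub>R h j l x)"

lemma codazzi:
  assumes x: "x \<in> W"
  shows "cubic i j k x = cubic j i k x"
proof -
  have N: "nproj x (D i (D j (E k)) x) = (\<Sum>l\<in>UNIV. G j k l x *\<^sub>R h i l x) + nab i (h j k) x" for i j
  proof -
    have sm: "smooth_on (\<lambda>y. G j k l y *\<^sub>R E l y) W" for l
      by (intro smooth_on_scaleR smooth_G smooth_D smooth_g open_W)
    have "D i (D j (E k)) x = D i (\<lambda>y. (\<Sum>l\<in>UNIV. G j k l y *\<^sub>R E l y) + h j k y) x"
      by (rule dird_cong[OF open_W x]) (rule D_E)
    then have "nproj x (D i (D j (E k)) x)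
        = nab i (\<lambda>y. (\<Sum>l\<in>UNIV. G j k l y *\<^sub>R E l y) + h j k y) x"
      by (simp add: nab_def)
    also have "\<dots> = (\<Sum>l\<in>UNIV. nab i (\<lambda>y. G j k l y *\<^sub>R E l y) x) + nab i (h j k) x"
      by (simp only: nab_add[OF x smooth_on_sum[OF open_W sm] smooth_h] nab_sum[OF x sm])
    also have "(\<Sum>l\<in>UNIV. nab i (\<lambda>y. G j k l y *\<^sub>R E l y) x) = (\<Sum>l\<in>UNIV. G j k l x *\<^sub>R h i l x)"
      using nab_scaleR[OF x smooth_G smooth_D[OF smooth_g]] by (simp add: nproj_E[OF x] h_def)
    finally show ?thesis .
  qed
  have "nproj x (D i (D j (E k)) x) - nproj x (D j (D i (E k)) x)
      = (\<Sum>l\<in>UNIV. (G i j l x - G j i l x) *\<^sub>R h l k x)"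
    unfolding nproj_diff[symmetric] commutator[OF x smooth_D[OF smooth_g]]
    by (simp add: nproj_sum nproj_scaleR nproj_D_E[OF x])
  then have "nab i (h j k) x - nab j (h i k) x = (\<Sum>l\<in>UNIV. G i j l x *\<^sub>R h l k x)
      - (\<Sum>l\<in>UNIV. G j i l x *\<^sub>R h l k x)
      - (\<Sum>l\<in>UNIV. G j k l x *\<^sub>R h i l x) + (\<Sum>l\<in>UNIV. G i k l x *\<^sub>R h j l x)"
    unfolding N scaleR_diff_left sum_subtractf by (simp only: algebra_simps)
  then show ?thesis
    unfolding cubic_def by (simp only: algebra_simps)
qed

lemma cubic_swap:
  assumes x: "x \<in> W"
  shows "cubic i j k x = cubic i k j x"
proof -
  have "nab i (h j k) x = nab i (h k j) x"
    by (rule nab_cong[OF x]) (rule h_sym)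
  then show ?thesis
    by (simp add: cubic_def h_sym[OF x, of _ k] h_sym[OF x, of j])
qed

end

section \<open>The Codazzi equations in a frame of type C\<close>

lemma UNIV_4_distinct: "distinct [1, a, b, c] \<Longrightarrow> (UNIV :: 4 set) = {1, a, b, c}"
  using exhaust_4[of a] exhaust_4[of b] exhaust_4[of c] by (auto simp: UNIV_4)

lemma sum_4_distinct:
  fixes f :: "4 \<Rightarrow> 'a::comm_monoid_add"
  shows "distinct [1, a, b, c] \<Longrightarrow> sum f UNIV = f 1 + f a + f b + f c"
  by (subst UNIV_4_distinct) (auto simp: add.assoc)

text \<open>Numeral multiples of vectors are split into sums, so that equal terms cancel after
  expansion with \<open>algebra_simps\<close>.\<close>

lemma scaleR_double:
  fixes v :: "'a::real_vector" and a b c :: real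
  shows "2 *\<^sub>R v = v + v" "(2 * a) *\<^sub>R v = a *\<^sub>R v + a *\<^sub>R v"
    "(a * (2 * b)) *\<^sub>R v = (a * b) *\<^sub>R v + (a * b) *\<^sub>R v"
    "(a * (b * (2 * c))) *\<^sub>R v = (a * (b * c)) *\<^sub>R v + (a * (b * c)) *\<^sub>R v"
  by (simp_all add: scaleR_left_distrib[symmetric] scaleR_2)

text \<open>
  Index \<open>1\<close> is the distinguished direction of \<open>Q_C\<close>; the paper's \<open>\<lambda>\<^sub>1, \<lambda>\<^sub>2, \<lambda>\<^sub>3\<close> are \<open>lam 2, lam 3, lam 4\<close>.
\<close>

locale type_C_frame = moving_frame W g e
  for W :: "(real ^ 4) set" and g :: "real ^ 4 \<Rightarrow> 'b::euclidean_space"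
    and e :: "4 \<Rightarrow> real ^ 4 \<Rightarrow> real ^ 4" +
  fixes lam :: "4 \<Rightarrow> real"
  assumes h_diag: "x \<in> W \<Longrightarrow> h i i x = 0"
    and h_off: "x \<in> W \<Longrightarrow> distinct [1, a, b, c] \<Longrightarrow> h b c x = lam a *\<^sub>R h 1 a x"
    and indep: "x \<in> W \<Longrightarrow> p *\<^sub>R h 1 2 x + q *\<^sub>R h 1 3 x + r *\<^sub>R h 1 4 x = 0 \<Longrightarrow> p = 0 \<and> q = 0 \<and> r = 0"
begin

abbreviation n :: "4 \<Rightarrow> real ^ 4 \<Rightarrow> 'b" where
  "n \<equiv> h 1"

abbreviation Y :: "4 \<Rightarrow> 4 \<Rightarrow> real ^ 4 \<Rightarrow> real" where
  "Y i \<equiv> G i 1"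

lemma indep3:
  assumes "x \<in> W" "distinct [1, a, b, c]" "p *\<^sub>R n a x + q *\<^sub>R n b x + r *\<^sub>R n c x = 0"
  shows "p = 0 \<and> q = 0 \<and> r = 0"
proof -
  consider "a = 2" "b = 3" "c = 4" | "a = 2" "b = 4" "c = 3" | "a = 3" "b = 2" "c = 4"
    | "a = 3" "b = 4" "c = 2" | "a = 4" "b = 2" "c = 3" | "a = 4" "b = 3" "c = 2"
    using assms(2) exhaust_4[of a] exhaust_4[of b] exhaust_4[of c] by auto
  then show ?thesis
    using indep[OF assms(1), of p q r] indep[OF assms(1), of p r q] indep[OF assms(1), of q p r]
      indep[OF assms(1), of r p q] indep[OF assms(1), of q r p] indep[OF assms(1), of r q p]
      assms(3)
    by cases (auto simp: add.commute add.left_commute)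
qed

lemma n_nonzero:
  assumes "x \<in> W" "a \<noteq> 1"
  shows "n a x \<noteq> 0"
proof -
  have "n 2 x \<noteq> 0" "n 3 x \<noteq> 0" "n 4 x \<noteq> 0"
    using indep[OF assms(1), of 1 0 0] indep[OF assms(1), of 0 1 0] indep[OF assms(1), of 0 0 1]
    by auto
  then show ?thesis
    using assms(2) exhaust_4[of a] by auto
qed

text \<open>This is where constancy of the parameters enters: no derivative of \<open>lam a\<close>
  appears.\<close>

lemma nab_h_off:
  assumes "x \<in> W" "distinct [1, a, b, c]"
  shows "nab i (h b c) x = lam a *\<^sub>R nab i (n a) x"
proof -
  have "nab i (h b c) x = nab i (\<lambda>y. lam a *\<^sub>R n a y) x"
    by (rule nab_cong[OF assms(1)]) (rule h_off[OF _ assms(2)])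
  then show ?thesis
    by (simp add: nab_scaleR_const[OF assms(1) smooth_h])
qed

lemma nab_h_diag: "x \<in> W \<Longrightarrow> nab i (h j j) x = 0"
  using nab_cong[of x "h j j" "\<lambda>y. 0 *\<^sub>R n 2 y" i] nab_scaleR_const[of x "n 2" i 0] smooth_h
  by (simp add: h_diag)

context
  fixes x :: "real ^ 4" and a b c :: 4
  assumes x: "x \<in> W" and abc: "distinct [1, a, b, c]"
begin

lemma h_values:
  "h a b x = lam c *\<^sub>R n c x" "h b a x = lam c *\<^sub>R n c x" "h b c x = lam a *\<^sub>R n a x"
  "h c b x = lam a *\<^sub>R n a x" "h a c x = lam b *\<^sub>R n b x" "h c a x = lam b *\<^sub>R n b x"
  using abc by (auto intro!: h_off[OF x])

lemmas h_simps = h_diag[OF x] h_values h_sym[OF x, of a 1] h_sym[OF x, of b 1] h_sym[OF x, of c 1]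

lemmas G_simps = G_diag[OF x] G_antisym[OF x, of _ a 1] G_antisym[OF x, of _ b 1]
  G_antisym[OF x, of _ c 1]

lemma cubic_1_1: "cubic i 1 1 x = -2 *\<^sub>R (Y i a x *\<^sub>R n a x + Y i b x *\<^sub>R n b x + Y i c x *\<^sub>R n c x)"
  unfolding cubic_def sum_4_distinct[OF abc]
  by (simp add: nab_h_diag[OF x] h_simps G_simps scaleR_double algebra_simps)

lemma cubic_1_a: "cubic i 1 a x = nab i (n a) x - (lam b * Y i c x + G i a b x) *\<^sub>R n b x
    - (lam c * Y i b x + G i a c x) *\<^sub>R n c x"
  unfolding cubic_def sum_4_distinct[OF abc]
  using abc by (simp add: h_simps G_simps algebra_simps)

lemma cubic_a_a: "cubic i a a x = 2 *\<^sub>R (Y i a x *\<^sub>R n a x - (lam b * G i a c x) *\<^sub>R n b x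
    - (lam c * G i a b x) *\<^sub>R n c x)"
  unfolding cubic_def sum_4_distinct[OF abc]
  using abc by (simp add: nab_h_diag[OF x] h_simps G_simps scaleR_double algebra_simps)

lemma cubic_b_c: "cubic i b c x = lam a *\<^sub>R nab i (n a) x + (Y i c x - lam b * G i b a x) *\<^sub>R n b x
    + (Y i b x - lam c * G i c a x) *\<^sub>R n c x"
  unfolding cubic_def sum_4_distinct[OF abc] nab_h_off[OF x abc]
  using abc by (simp add: h_simps G_simps algebra_simps)

end

context
  fixes x :: "real ^ 4" and a b c :: 4
  assumes x: "x \<in> W" and abc: "distinct [1, a, b, c]"
begin

text \<open>As \<open>h 1 1\<close> vanishes on \<open>W\<close>, \<open>cubic c 1 1\<close>
  contains no derivative of a normal field. The Codazzi equation therefore expresses the derivative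
  of \<open>n c\<close> along \<open>E 1\<close> through connection coefficients; the next two
  lemmas do the same for the other directions.\<close>

lemma nab_1_n: "nab 1 (n c) x = (lam a * Y 1 b x - 2 * Y c a x + G 1 c a x) *\<^sub>R n a x
    + (lam b * Y 1 a x - 2 * Y c b x + G 1 c b x) *\<^sub>R n b x - (2 * Y c c x) *\<^sub>R n c x"
proof -
  have "cubic c 1 1 x = cubic 1 1 c x"
    using codazzi[OF x, of c 1 1] cubic_swap[OF x, of 1 c 1] by simp
  moreover have "distinct [1, c, a, b]"
    using abc by auto
  ultimately show ?thesis
    by (simp add: cubic_1_1[OF x abc] cubic_1_a[OF x, of c a b] algebra_simps scaleR_double)
qed

lemma nab_a_n_a: "nab a (n a) x = (2 * Y 1 a x) *\<^sub>R n a x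
    + (lam b * Y a c x - 2 * lam b * G 1 a c x + G a a b x) *\<^sub>R n b x
    + (lam c * Y a b x - 2 * lam c * G 1 a b x + G a a c x) *\<^sub>R n c x"
proof -
  have "cubic a 1 a x = cubic 1 a a x"
    by (rule codazzi[OF x])
  then show ?thesis
    by (simp add: cubic_a_a[OF x abc] cubic_1_a[OF x abc] scaleR_double algebra_simps)
qed

lemma nab_b_n_a: "nab b (n a) x =
    ((1 + lam a * lam c) * Y 1 b x + (lam a + lam c) * G 1 c a x - 2 * lam c * Y c a x) *\<^sub>R n a x
    + ((1 + lam b * lam c) * Y 1 a x + (lam b + lam c) * G 1 c b x - 2 * lam c * Y c b x
        + lam b * Y b c x + G b a b x) *\<^sub>R n b x
    + (lam c * Y b b x - 2 * lam c * Y c c x + G b a c x) *\<^sub>R n c x"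
proof -
  have cba: "distinct [1, c, b, a]" 
    using abc by auto
  have "cubic b 1 a x = cubic 1 b a x"
    by (rule codazzi[OF x])
  then show ?thesis
    by (simp add: cubic_1_a[OF x abc] cubic_b_c[OF x cba] nab_1_n G_antisym[OF x, of 1 a c]
        G_antisym[OF x, of 1 b c] algebra_simps scaleR_double)
qed

end

text \<open>With all derivatives of the \<open>n a\<close> known, the remaining Codazzi equations
  are vector equations whose coefficients can be compared, \<open>n a\<close>, \<open>n b\<close>,
  \<open>n c\<close> being independent. The first three relations belong to the index triple
  \<open>b b c\<close>, the fourth to \<open>a b c\<close>. Further instances arise by permuting
  \<open>a\<close>, \<open>b\<close>, \<open>c\<close>.\<close>

lemma frame_relations:
  assumes x: "x \<in> W" and abc: "distinct [1, a, b, c]"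
  shows
  "lam a * ((1 + lam a * lam c) * Y 1 b x + (lam a + lam c) * G 1 c a x + 2 * G c b c x - 2 * lam c * Y c a x) = 0"
  "lam a * ((1 + lam b * lam c) * Y 1 a x + (lam b + lam c) * G 1 c b x)
    + (1 + lam a * lam b) * Y b c x + (lam a + lam b) * G b a b x = 2 * (1 + lam a * lam c) * Y c b x"
  "(1 + lam a * lam c) * Y b b x + (lam a + lam c) * G b a c x + 2 * lam c * G c b a x
    = 2 * lam a * lam c * Y c c x"
  "(1 + lam a * lam b) * Y b c x + (lam a + lam b) * G b b a x = 2 * lam a * (Y 1 a x + lam b * G 1 b c x)"
proof -
  have bca: "distinct [1, b, a, c]" "distinct [1, b, c, a]"
    using abc by auto
  have "cubic b b c x = cubic c b b x"
    using codazzi[OF x, of b c b] cubic_swap[OF x, of b b c] by simp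
  then have "(lam a * ((1 + lam a * lam c) * Y 1 b x + (lam a + lam c) * G 1 c a x + 2 * G c b c x - 2 * lam c * Y c a x)) *\<^sub>R n a x
    + (lam a * ((1 + lam b * lam c) * Y 1 a x + (lam b + lam c) * G 1 c b x)
    + (1 + lam a * lam b) * Y b c x + (lam a + lam b) * G b a b x - 2 * (1 + lam a * lam c) * Y c b x) *\<^sub>R n b x
    + ((1 + lam a * lam c) * Y b b x + (lam a + lam c) * G b a c x + 2 * lam c * G c b a x
    - 2 * lam a * lam c * Y c c x) *\<^sub>R n c x = 0"
    by (simp add: cubic_b_c[OF x abc] cubic_a_a[OF x bca(2)] nab_b_n_a[OF x abc] scaleR_double
        G_antisym[OF x, of b b a] G_antisym[OF x, of b c a] algebra_simps)
  from indep3[OF x abc this] show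
    "lam a * ((1 + lam a * lam c) * Y 1 b x + (lam a + lam c) * G 1 c a x + 2 * G c b c x - 2 * lam c * Y c a x) = 0"
    "lam a * ((1 + lam b * lam c) * Y 1 a x + (lam b + lam c) * G 1 c b x)
      + (1 + lam a * lam b) * Y b c x + (lam a + lam b) * G b a b x = 2 * (1 + lam a * lam c) * Y c b x"
    "(1 + lam a * lam c) * Y b b x + (lam a + lam c) * G b a c x + 2 * lam c * G c b a x
      = 2 * lam a * lam c * Y c c x"
    by auto
  have "cubic a b c x = cubic b a c x"
    by (rule codazzi[OF x])
  then have "(2 * lam a * (Y 1 a x + lam b * G 1 b c x)
      - ((1 + lam a * lam b) * Y b c x + (lam a + lam b) * G b b a x)) *\<^sub>R n a x
    + ((1 + lam a * lam b) * Y a c x + (lam a + lam b) * G a a b x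
      - 2 * lam b * (Y 1 b x + lam a * G 1 a c x)) *\<^sub>R n b x
    + (Y a b x - lam c * G a c a x + lam a * (lam c * Y a b x - 2 * lam c * G 1 a b x + G a a c x)
      - (Y b a x - lam c * G b c b x
        + lam b * (lam c * Y b a x - 2 * lam c * G 1 b a x + G b b c x))) *\<^sub>R n c x = 0"
    by (simp add: cubic_b_c[OF x abc] cubic_b_c[OF x bca(1)] nab_a_n_a[OF x abc] nab_a_n_a[OF x bca(1)]
        scaleR_double G_antisym[OF x, of b a b] G_antisym[OF x, of a b a] algebra_simps)
  from indep3[OF x abc this] show
    "(1 + lam a * lam b) * Y b c x + (lam a + lam b) * G b b a x = 2 * lam a * (Y 1 a x + lam b * G 1 b c x)"
    by auto
qed

end

section \<open>Excluding nonzero parameters\<close>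

text \<open>
  For each choice of the index \<open>a\<close> the Codazzi equations decouple into a system for
  \<open>Y 1 a, G 1 b c, Y b c, Y c b, G b a b, G c a c\<close>, while the remaining coefficients satisfy a second system
  that is cyclic in \<open>a, b, c\<close>. The new unknowns \<open>Y \<plusminus> A Z\<close> triangularize them.
\<close>

lemma generic_block1:
  fixes A B C Y Z p q r s :: real
  assumes con: "A * B * C + A + B + C = 0"
    and e1: "(1 + A * B) * p - (A + B) * s = 2 * A * (Y + B * Z)"
    and e2: "(1 + A * C) * q - (A + C) * r = 2 * A * (Y - C * Z)"
    and e3: "A * ((1 + B * C) * Y - (B + C) * Z) + (1 + A * B) * p + (A + B) * s = 2 * (1 + A * C) * q"
    and e4: "A * ((1 + B * C) * Y + (B + C) * Z) + (1 + A * C) * q + (A + C) * r = 2 * (1 + A * B) * p"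
    and e5: "(1 + B * C) * Y + (B + C) * Z + 2 * s - 2 * B * p = 0"
    and e6: "(1 + B * C) * Y - (B + C) * Z + 2 * r - 2 * C * q = 0"
    and nz: "A \<noteq> 0" "B \<noteq> 0" "C \<noteq> 0" "B\<^sup>2 \<noteq> 1" "C\<^sup>2 \<noteq> 1"
  shows "Y = 0 \<and> p = 0 \<and> q = 0"
proof -
  \<comment> \<open>With \<open>M = 1 + B * C\<close> the constraint reads
    \<open>A * M = - (B + C)\<close>, and multiplication by \<open>M\<close> turns the factors
    \<open>1 + A * B\<close> and \<open>1 + A * C\<close> into \<open>1 - B\<^sup>2\<close> and
    \<open>1 - C\<^sup>2\<close>, which are nonzero. \<open>P\<close> and \<open>Q\<close> are
    shifts of \<open>p\<close> and \<open>q\<close> that simplify the equations \<open>1\<close> to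
    \<open>4\<close> below.\<close>
  define M u v P Q where "M = 1 + B * C" and "u = (Y - A * Z) / 2" and "v = (Y + A * Z) / 2"
    and "P = p - C * u" and "Q = q - B * v"
  have AM: "A * M = - (B + C)"
    using con by (simp add: M_def algebra_simps)
  have MB: "M * (1 + A * B) = 1 - B\<^sup>2" and MC: "M * (1 + A * C) = 1 - C\<^sup>2"
    unfolding M_def using con by algebra+
  have ABM: "(A + B) * M = - C * (1 - B\<^sup>2)" and ACM: "(A + C) * M = - B * (1 - C\<^sup>2)"
    unfolding M_def using con by algebra+
  have Y: "Y = u + v" and AZ: "A * Z = v - u"
    by (simp_all add: u_def v_def field_simps)
  have BCZ: "(B + C) * Z = - M * (v - u)"
    unfolding AZ[symmetric] using AM by algebra
  have s: "s = B * p - M * u" and r: "r = C * q - M * v"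
    using e5 e6 BCZ unfolding M_def[symmetric] Y by (simp_all add: algebra_simps)
  have p: "p = P + C * u" and q: "q = Q + B * v"
    by (simp_all add: P_def Q_def)
  have e1': "(1 - B\<^sup>2) * p + (A + B) * M * u = 2 * A * (u + v) + 2 * B * (v - u)"
    using e1 unfolding s Y AZ[symmetric] by (simp add: algebra_simps power2_eq_square)
  have e2': "(1 - C\<^sup>2) * q + (A + C) * M * v = 2 * A * (u + v) - 2 * C * (v - u)"
    using e2 unfolding r Y AZ[symmetric] by (simp add: algebra_simps power2_eq_square)
  have e3': "2 * A * M * v + (1 + 2 * A * B + B\<^sup>2) * p - (A + B) * M * u = 2 * (1 + A * C) * q"
    using e3 unfolding s Y BCZ M_def[symmetric] by (simp add: algebra_simps power2_eq_square)
  have e4': "2 * A * M * u + (1 + 2 * A * C + C\<^sup>2) * q - (A + C) * M * v = 2 * (1 + A * B) * p"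
    using e4 unfolding r Y BCZ M_def[symmetric] by (simp add: algebra_simps power2_eq_square)
  have 1: "M * ((1 + A * B) * P) = 2 * (A - B) * u + 2 * (A + B) * v"
  proof -
    have "M * ((1 + A * B) * P) = (1 - B\<^sup>2) * p - (1 - B\<^sup>2) * C * u"
      unfolding mult.assoc[symmetric] MB by (simp add: P_def algebra_simps)
    then show ?thesis
      using e1' unfolding ABM by (simp add: algebra_simps)
  qed
  have 2: "M * ((1 + A * C) * Q) = 2 * (A + C) * u + 2 * (A - C) * v"
  proof -
    have "M * ((1 + A * C) * Q) = (1 - C\<^sup>2) * q - (1 - C\<^sup>2) * B * v"
      unfolding mult.assoc[symmetric] MC by (simp add: Q_def algebra_simps)
    then show ?thesis
      using e2' unfolding ACM by (simp add: algebra_simps)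
  qed
  have 3: "(1 + A * B) * P - (1 + A * C) * Q = 2 * A * u + 2 * B * v"
  proof -
    have "2 * (1 + A * B) * p - 2 * (1 + A * C) * q = 2 * A * (u + v) + 2 * B * (v - u) - 2 * A * M * v"
      using e1' e3' by (simp add: algebra_simps)
    then show ?thesis
      unfolding p q mult.assoc AM using con by algebra
  qed
  have 4: "(1 + A * C) * Q - (1 + A * B) * P = 2 * C * u + 2 * A * v"
  proof -
    have "2 * (1 + A * C) * q - 2 * (1 + A * B) * p = 2 * A * (u + v) - 2 * C * (v - u) - 2 * A * M * u"
      using e2' e4' by (simp add: algebra_simps)
    then show ?thesis
      unfolding p q mult.assoc AM using con by algebra
  qed
  \<comment> \<open>Multiplied by \<open>M\<close>, equation \<open>3\<close> can be compared with
    the difference of \<open>1\<close> and \<open>2\<close>. This eliminates \<open>P\<close> and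
    \<open>Q\<close> and, by \<open>AM\<close>, also \<open>u\<close>; equation \<open>4\<close>
    likewise isolates \<open>u\<close>.\<close>
  have "M * (2 * A * u + 2 * B * v) = - 2 * (B + C) * u + 2 * (B + C) * v"
    unfolding 3[symmetric] right_diff_distrib 1 2 by (simp add: algebra_simps)
  then have "C * (1 - B\<^sup>2) * v = 0"
    using AM unfolding M_def by algebra
  then have v: "v = 0"
    using nz by simp
  have "M * (2 * C * u + 2 * A * v) = 2 * (B + C) * u - 2 * (B + C) * v"
    unfolding 4[symmetric] right_diff_distrib 1 2 by (simp add: algebra_simps)
  then have "B * (1 - C\<^sup>2) * u = 0"
    using AM unfolding M_def by algebra
  then have u: "u = 0"
    using nz by simp
  have "(1 - B\<^sup>2) * p = 0" "(1 - C\<^sup>2) * q = 0"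
    using e1' e2' u v by simp_all
  then show ?thesis
    using u v Y nz by simp
qed

text \<open>In the variables \<open>ya + A * za\<close>, \<open>ya - A * za\<close> and their cyclic
  images every equation expresses one unknown by two others. Eliminating four of them leaves
  \<open>a1\<close> and \<open>a2\<close>, each times \<open>ta + tb + tc - ta * tb * tc\<close>,
  and the constraint makes this factor equal to 2.\<close>

lemma generic_block2:
  fixes A B C ya yb yc za zb zc :: real
  assumes con: "A * B * C + A + B + C = 0"
    and e1: "(1 + A * C) * yb - (A + C) * zb - 2 * C * zc = 2 * A * C * yc"
    and e2: "(1 + B * A) * yc - (B + A) * zc - 2 * A * za = 2 * B * A * ya"
    and e3: "(1 + C * B) * ya - (C + B) * za - 2 * B * zb = 2 * C * B * yb"
    and e4: "(1 + A * B) * yc + (A + B) * zc + 2 * B * zb = 2 * A * B * yb"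
    and e5: "(1 + B * C) * ya + (B + C) * za + 2 * C * zc = 2 * B * C * yc"
    and e6: "(1 + C * A) * yb + (C + A) * zb + 2 * A * za = 2 * C * A * ya"
    and nz: "A\<^sup>2 \<noteq> 1" "B\<^sup>2 \<noteq> 1" "C\<^sup>2 \<noteq> 1"
  shows "ya = 0"
proof -
  define a1 a2 b1 b2 c1 c2 where "a1 = ya + A * za" and "a2 = ya - A * za" and "b1 = yb + B * zb"
    and "b2 = yb - B * zb" and "c1 = yc + C * zc" and "c2 = yc - C * zc"
  have "(1 + A * B) * (1 + B * C) = 1 - B\<^sup>2" "(1 + A * B) * (1 + A * C) = 1 - A\<^sup>2"
    using con by algebra+
  then have ne: "1 + A * B \<noteq> 0" "1 + A * C \<noteq> 0" "1 + B * C \<noteq> 0"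
    using nz by auto
  define ta tb tc where "ta = (1 - B * C) / (1 + B * C)" and "tb = (1 - A * C) / (1 + A * C)"
    and "tc = (1 - A * B) / (1 + A * B)"
  have "(1 + A * C) * b1 = (1 + A * C) * c1 - (1 - A * C) * c2"
    "(1 + A * B) * c1 = (1 + A * B) * a1 - (1 - A * B) * a2"
    "(1 + B * C) * a1 = (1 + B * C) * b1 - (1 - B * C) * b2"
    "(1 + A * C) * b2 = (1 + A * C) * a2 - (1 - A * C) * a1"
    "(1 + A * B) * c2 = (1 + A * B) * b2 - (1 - A * B) * b1"
    "(1 + B * C) * a2 = (1 + B * C) * c2 - (1 - B * C) * c1"
    unfolding a1_def a2_def b1_def b2_def c1_def c2_def using con e1 e2 e3 e4 e5 e6 by algebra+
  then have "b1 = c1 - tb * c2" "c1 = a1 - tc * a2" "a1 = b1 - ta * b2"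
    "b2 = a2 - tb * a1" "c2 = b2 - tc * b1" "a2 = c2 - ta * c1"
    using ne by (simp_all add: ta_def tb_def tc_def field_simps)
  then have "a1 * (ta + tb + tc - ta * tb * tc) = 0" "a2 * (ta + tb + tc - ta * tb * tc) = 0"
    by algebra+
  moreover have "ta + tb + tc - ta * tb * tc = 2"
  proof -
    have "(1 - B * C) * (1 + A * C) * (1 + A * B) + (1 - A * C) * (1 + B * C) * (1 + A * B)
        + (1 - A * B) * (1 + B * C) * (1 + A * C) - (1 - B * C) * (1 - A * C) * (1 - A * B)
        = 2 * ((1 + B * C) * (1 + A * C) * (1 + A * B))"
      using con by algebra
    moreover have "ta + tb + tc - ta * tb * tc = ((1 - B * C) * (1 + A * C) * (1 + A * B)
        + (1 - A * C) * (1 + B * C) * (1 + A * B) + (1 - A * B) * (1 + B * C) * (1 + A * C)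
        - (1 - B * C) * (1 - A * C) * (1 - A * B)) / ((1 + B * C) * (1 + A * C) * (1 + A * B))"
      unfolding ta_def tb_def tc_def using ne by (simp add: divide_simps) (simp add: algebra_simps)
    ultimately show ?thesis
      using ne by simp
  qed
  ultimately have "a1 = 0" "a2 = 0"
    by auto
  then show ?thesis
    by (simp add: a1_def a2_def)
qed

context type_C_frame
begin

lemma block1:
  assumes x: "x \<in> W" and abc: "distinct [1, a, b, c]"
  shows "(1 + lam a * lam b) * Y b c x - (lam a + lam b) * G b a b x = 2 * lam a * (Y 1 a x + lam b * G 1 b c x)"
    "(1 + lam a * lam c) * Y c b x - (lam a + lam c) * G c a c x = 2 * lam a * (Y 1 a x - lam c * G 1 b c x)"
    "lam a * ((1 + lam b * lam c) * Y 1 a x - (lam b + lam c) * G 1 b c x)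
      + (1 + lam a * lam b) * Y b c x + (lam a + lam b) * G b a b x = 2 * (1 + lam a * lam c) * Y c b x"
    "lam a * ((1 + lam b * lam c) * Y 1 a x + (lam b + lam c) * G 1 b c x)
      + (1 + lam a * lam c) * Y c b x + (lam a + lam c) * G c a c x = 2 * (1 + lam a * lam b) * Y b c x"
    "lam c * ((1 + lam b * lam c) * Y 1 a x + (lam b + lam c) * G 1 b c x + 2 * G b a b x - 2 * lam b * Y b c x) = 0"
    "lam b * ((1 + lam b * lam c) * Y 1 a x - (lam b + lam c) * G 1 b c x + 2 * G c a c x - 2 * lam c * Y c b x) = 0"
proof -
  have acb: "distinct [1, a, c, b]" "distinct [1, c, a, b]" "distinct [1, b, a, c]"
    using abc by auto
  note R = frame_relations[OF x abc] frame_relations[OF x acb(1)] frame_relations[OF x acb(2)]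
    frame_relations[OF x acb(3)]
  note anti = G_antisym[OF x, of 1 c b] G_antisym[OF x, of b b a] G_antisym[OF x, of c c a]
  show "(1 + lam a * lam b) * Y b c x - (lam a + lam b) * G b a b x = 2 * lam a * (Y 1 a x + lam b * G 1 b c x)"
    using R(4) by (simp add: anti)
  show "(1 + lam a * lam c) * Y c b x - (lam a + lam c) * G c a c x = 2 * lam a * (Y 1 a x - lam c * G 1 b c x)"
    using R(8) by (simp add: anti)
  show "lam a * ((1 + lam b * lam c) * Y 1 a x - (lam b + lam c) * G 1 b c x)
      + (1 + lam a * lam b) * Y b c x + (lam a + lam b) * G b a b x = 2 * (1 + lam a * lam c) * Y c b x"
    using R(2) by (simp add: anti)
  show "lam a * ((1 + lam b * lam c) * Y 1 a x + (lam b + lam c) * G 1 b c x)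
      + (1 + lam a * lam c) * Y c b x + (lam a + lam c) * G c a c x = 2 * (1 + lam a * lam b) * Y b c x"
    using R(6) by (simp add: anti mult.commute add.commute)
  show "lam c * ((1 + lam b * lam c) * Y 1 a x + (lam b + lam c) * G 1 b c x + 2 * G b a b x - 2 * lam b * Y b c x) = 0"
    using R(9) by (simp add: mult.commute add.commute)
  show "lam b * ((1 + lam b * lam c) * Y 1 a x - (lam b + lam c) * G 1 b c x + 2 * G c a c x - 2 * lam c * Y c b x) = 0"
    using R(13) by (simp add: anti)
qed

lemma block2:
  assumes x: "x \<in> W" and abc: "distinct [1, a, b, c]"
  shows "(1 + lam a * lam c) * Y b b x - (lam a + lam c) * G b c a x - 2 * lam c * G c a b x = 2 * lam a * lam c * Y c c x"
    "(1 + lam a * lam b) * Y c c x + (lam a + lam b) * G c a b x + 2 * lam b * G b c a x = 2 * lam a * lam b * Y b b x"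
proof -
  have acb: "distinct [1, a, c, b]"
    using abc by auto
  show "(1 + lam a * lam c) * Y b b x - (lam a + lam c) * G b c a x - 2 * lam c * G c a b x = 2 * lam a * lam c * Y c c x"
    using frame_relations(3)[OF x abc] by (simp add: G_antisym[OF x, of b a c] G_antisym[OF x, of c b a])
  show "(1 + lam a * lam b) * Y c c x + (lam a + lam b) * G c a b x + 2 * lam b * G b c a x = 2 * lam a * lam b * Y b b x"
    using frame_relations(3)[OF x acb] by simp
qed

lemma D_eq_0:
  assumes "x \<in> W" "\<And>y. y \<in> W \<Longrightarrow> f y = 0"
  shows "D i f x = 0"
  using dird_cong[OF open_W assms(1), of f "\<lambda>_. 0" "e i"] assms(2) by (simp add: dird_const)

text \<open>If all \<open>Y i a\<close> vanish, \<open>E 1\<close> is parallel and the planes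
  containing it have curvature 0. By the Gauss equation, however, the plane of \<open>E 1\<close>
  and \<open>E 2\<close> has curvature minus the squared norm of \<open>n 2\<close>, because
  \<open>h 1 1\<close> and \<open>h 2 2\<close> vanish.\<close>

lemma G_zero_imp_False:
  assumes "W \<noteq> {}" "\<And>x i a. x \<in> W \<Longrightarrow> Y i a x = 0"
  shows False
proof -
  obtain x where x: "x \<in> W"
    using assms(1) by blast
  have "D i (Y j a) x = 0" for i j a
    by (rule D_eq_0[OF x assms(2)])
  then have "n 2 x \<bullet> n 2 x = 0"
    using gauss[OF x, of 1 2 1 2] by (simp add: assms(2)[OF x] h_diag[OF x] h_sym[OF x, of 2 1])
  then show False
    using n_nonzero[OF x, of 2] by simp
qed

lemma generic_imp_False:
  assumes "W \<noteq> {}" and con: "lam 2 * lam 3 * lam 4 + lam 2 + lam 3 + lam 4 = 0"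
    and nz: "\<And>a. a \<noteq> 1 \<Longrightarrow> lam a \<noteq> 0" "\<And>a. a \<noteq> 1 \<Longrightarrow> (lam a)\<^sup>2 \<noteq> 1"
  shows False
proof (rule G_zero_imp_False[OF assms(1)])
  fix x i k assume x: "x \<in> W"
  have con': "lam a * lam b * lam c + lam a + lam b + lam c = 0" if "distinct [1, a, b, c]" for a b c
    using con that exhaust_4[of a] exhaust_4[of b] exhaust_4[of c] by (auto simp: algebra_simps)
  have 1: "Y 1 a x = 0 \<and> Y b c x = 0 \<and> Y c b x = 0" if abc: "distinct [1, a, b, c]" for a b c
  proof (rule generic_block1[OF con'[OF abc] block1(1-4)[OF x abc]])
    show "(1 + lam b * lam c) * Y 1 a x + (lam b + lam c) * G 1 b c x + 2 * G b a b x - 2 * lam b * Y b c x = 0"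
      "(1 + lam b * lam c) * Y 1 a x - (lam b + lam c) * G 1 b c x + 2 * G c a c x - 2 * lam c * Y c b x = 0"
      using block1(5,6)[OF x abc] nz(1) abc by auto
  qed (use nz abc in auto)
  have 2: "Y a a x = 0" if abc: "distinct [1, a, b, c]" for a b c
  proof -
    have bca: "distinct [1, b, c, a]" "distinct [1, c, a, b]"
      using abc by auto
    show ?thesis
      by (rule generic_block2[OF con'[OF abc] block2(1)[OF x abc] block2(1)[OF x bca(1)]
            block2(1)[OF x bca(2)] block2(2)[OF x abc] block2(2)[OF x bca(1)] block2(2)[OF x bca(2)]])
         (use nz abc in auto)
  qed
  show "Y i k x = 0"
    using 1[of 2 3 4] 1[of 3 2 4] 1[of 4 2 3] 2[of 2 3 4] 2[of 3 2 4] 2[of 4 2 3]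
      exhaust_4[of i] exhaust_4[of k] G_diag[OF x, of _ 1] by auto
qed

end

section \<open>The exceptional parameters (l, 0, -l)\<close>

context type_C_frame
begin

lemma D_add_scale_eq_0:
  fixes f f' :: "real ^ 4 \<Rightarrow> real"
  assumes "x \<in> W" "smooth_on f W" "smooth_on f' W" "\<And>y. y \<in> W \<Longrightarrow> f y = k * f' y"
  shows "D i f x = k * D i f' x"
proof -
  have "D i f x = D i (\<lambda>y. k * f' y) x"
    using dird_cong[OF open_W assms(1,4)] .
  also have "\<dots> = k * D i f' x"
    by (rule dird_bounded_linear[OF open_W assms(1) bounded_linear_mult_right assms(3)])
  finally show ?thesis .
qed

lemma index_cases:
  fixes a b c i :: 4
  shows "distinct [1, a, b, c] \<Longrightarrow> i = 1 \<or> i = a \<or> i = b \<or> i = c"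
  using UNIV_4_distinct[of a b c] by auto

lemma null_middle_relations:
  assumes abc: "distinct [1, a, b, c]" and l: "lam a = l" "lam b = 0" "lam c = - l"
    and nz: "l \<noteq> 0" "l\<^sup>2 \<noteq> 1" and x: "x \<in> W"
  shows "Y i b x = 0 \<and> Y i a x = - l * G i b c x \<and> Y i c x = - l * G i a b x"
proof -
  have d: "distinct [1, b, c, a]" "distinct [1, c, a, b]" "distinct [1, c, b, a]"
    using abc by auto
  \<comment> \<open>Each relation below is obtained multiplied by the nonzero factor
    \<open>l * (1 - l\<^sup>2)\<close>.\<close>
  have red: "t = 0" if "l * ((1 - l\<^sup>2) * t) = 0" for t
    using that nz by simp
  note A1 = block1[OF x abc, unfolded l] and B1 = block1[OF x d(1), unfolded l]
    and C1 = block1[OF x d(2), unfolded l]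
  note A2 = block2[OF x abc, unfolded l] and B2 = block2[OF x d(1), unfolded l]
    and C2 = block2[OF x d(2), unfolded l]
  have 1: "Y 1 a x + l * G 1 b c x = 0"
    by (rule red) (use A1 in algebra)
  have 2: "Y c b x = 0"
    by (rule red) (use A1 1 in algebra)
  have 3: "Y 1 b x = 0"
    by (rule red) (use B1 in algebra)
  have 4: "Y c a x = 0"
    by (rule red) (use B1 3 in algebra)
  have 5: "Y a c x = 0"
    by (rule red) (use B1 3 in algebra)
  have 6: "Y 1 c x + l * G 1 a b x = 0"
    by (rule red) (use C1 in algebra)
  have 7: "Y a b x = 0"
    by (rule red) (use C1 6 in algebra)
  have 8: "Y b c x - l * G b a b x * (-1) = 0"
    by (rule red) (use A1 1 2 in algebra)
  have 9: "Y b a x + l * G b b c x = 0"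
    by (rule red) (use C1 6 7 G_antisym[OF x, of b b c] in algebra)
  have 10: "Y c a x + l * G c b c x = 0"
    by (rule red) (use B1 G_antisym[OF x, of c b c] in algebra)
  have 11: "Y a c x + l * G a a b x = 0"
    by (rule red) (use B1 G_antisym[OF x, of a a b] in algebra)
  have 12: "Y a a x + l * G a b c x = 0"
    by (rule red) (use A2 B2 C2 in algebra)
  have 13: "Y c c x + l * G c a b x = 0"
    by (rule red) (use A2 B2 C2 in algebra)
  have 14: "Y b b x = 0"
    by (rule red) (use A2 B2 C2 12 13 in algebra)
  show ?thesis
    using index_cases[OF abc, of i] 1 2 3 4 5 6 7 8 9 10 11 12 13 14
    by (auto simp: algebra_simps add_eq_0_iff)
qed

text \<open>\<open>Y i a + l * G i b c\<close> vanishes on \<open>W\<close> for every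
  \<open>i\<close>, so in the same combination of Gauss equations the derivatives cancel, and so do
  the products of coefficients. What remains is algebraic in \<open>h\<close>; for the planes
  \<open>a, 1\<close> and \<open>c, b\<close> it gives
  \<open>n a \<bullet> n a = l\<^sup>2 * (n c \<bullet> n c)\<close> and the same with
  \<open>a\<close> and \<open>c\<close> exchanged, against
  \<open>l\<^sup>2 \<noteq> 1\<close>.\<close>

lemma null_middle_imp_False:
  assumes "W \<noteq> {}" and abc: "distinct [1, a, b, c]" and l: "lam a = l" "lam b = 0" "lam c = - l"
    and nz: "l \<noteq> 0" "l\<^sup>2 \<noteq> 1"
  shows False
proof -
  obtain x where x: "x \<in> W"
    using assms(1) by blast
  note rel = null_middle_relations[OF abc l nz]
  note bd = rel[OF x, THEN conjunct1] and ad = rel[OF x, THEN conjunct2, THEN conjunct1]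
    and cd = rel[OF x, THEN conjunct2, THEN conjunct2]
  have "h j 1 x \<bullet> h i a x - h i 1 x \<bullet> h j a x + l * (h j b x \<bullet> h i c x - h i b x \<bullet> h j c x) = 0" for i j
  proof -
    have "D i (Y j a) x = - l * D i (G j b c) x" for i j
      by (rule D_add_scale_eq_0[OF x smooth_G smooth_G]) (use rel in blast)
    then show ?thesis
      using gauss[OF x, of i j 1 a] arg_cong[OF gauss[OF x, of i j b c], of "\<lambda>t. l * t"]
      unfolding sum_4_distinct[OF abc]
      by (simp add: G_diag[OF x] bd cd ad G_antisym[OF x, of _ _ 1] G_antisym[OF x, of _ b a]
          G_antisym[OF x, of _ c a] algebra_simps)
  qed
  from this[of a 1] this[of c b]
  have na: "n a x \<bullet> n a x = l\<^sup>2 * (n c x \<bullet> n c x)" and nc: "n c x \<bullet> n c x = l\<^sup>2 * (n a x \<bullet> n a x)"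
    using nz(1) h_simps[OF x abc] l by (auto simp: power2_eq_square algebra_simps)
  have "n a x \<noteq> 0"
    using n_nonzero[OF x] abc by simp
  moreover have "(1 - l\<^sup>2) * ((1 + l\<^sup>2) * (n a x \<bullet> n a x)) = 0"
    using na nc by algebra
  ultimately show False
    using nz(2) by (simp add: add_nonneg_eq_0_iff)
qed

text \<open>When \<open>lam a = 1\<close> and \<open>lam c = - 1\<close> the argument for generic
  parameters breaks down, and only relations between the coefficients are extracted. The third one
  appears multiplied by \<mu>, hence its premise \<open>0 < \<mu>\<close>; the last four tie pairs
  of coefficients by the ratio of \<open>1 + \<mu>\<close> to \<open>1 - \<mu>\<close>.\<close>

lemma unit_relations:
  assumes abc: "distinct [1, a, b, c]" and l: "lam a = 1" "lam b = \<mu>" "lam c = -1"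
    and x: "x \<in> W" and mu: "0 \<le> \<mu>"
  shows "Y i a x = - G i b c x" "Y i c x = - G i a b x" "0 < \<mu> \<Longrightarrow> Y i b x = G i c a x"
    "(1 + \<mu>) * Y b c x = (1 - \<mu>) * Y 1 a x" "(1 - \<mu>) * Y b a x = - (1 + \<mu>) * Y 1 c x"
    "(1 - \<mu>) * Y c a x = (1 + \<mu>) * Y a c x" "(1 + \<mu>) * Y c c x = - (1 - \<mu>) * Y a a x"
proof -
  have d: "distinct [1, b, c, a]" "distinct [1, c, a, b]" "distinct [1, c, b, a]"
    using abc by auto
  have mu1: "1 + \<mu> \<noteq> 0"
    using mu by simp
  note A1 = block1[OF x abc, unfolded l] and B1 = block1[OF x d(1), unfolded l]
    and C1 = block1[OF x d(2), unfolded l]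
  note A2 = block2[OF x abc, unfolded l] and B2 = block2[OF x d(1), unfolded l]
    and C2 = block2[OF x d(2), unfolded l]
  have 1: "Y 1 a x = - G 1 b c x"
    using A1(2) by simp
  have 2: "Y 1 c x = - G 1 a b x"
    using C1(1) by simp
  have 3: "Y a a x = - G a b c x" "Y c c x = - G c a b x"
    using A2 B2 C2 by simp_all
  have 4: "Y c a x = - G c b c x" "Y a c x = - G a a b x"
    using B1(5,6) G_antisym[OF x, of c b c] G_antisym[OF x, of a a b] by simp_all
  have 5: "Y b c x = - G b a b x"
  proof -
    have "(1 + \<mu>) * (Y b c x + G b a b x) = 0"
      using A1(3) 1 by (simp add: algebra_simps)
    then show ?thesis
      using mu1 by simp
  qed
  have 6: "Y b a x = - G b b c x"
    using C1(3,6) 2 G_antisym[OF x, of b b c] by (simp add: algebra_simps)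
  show "Y i a x = - G i b c x" "Y i c x = - G i a b x"
    using index_cases[OF abc, of i] 1 2 3 4 5 6 by auto
  show "(1 + \<mu>) * Y b c x = (1 - \<mu>) * Y 1 a x"
    using A1(4) 1 by (simp add: algebra_simps)
  show "(1 - \<mu>) * Y b a x = - (1 + \<mu>) * Y 1 c x" 
    using C1(3) 2 by (simp add: algebra_simps)
  show "(1 - \<mu>) * Y c a x = (1 + \<mu>) * Y a c x" 
    using B1(3) 4 G_antisym[OF x, of c b c] by (simp add: algebra_simps)
  show "(1 + \<mu>) * Y c c x = - (1 - \<mu>) * Y a a x"
    using B2(1) 3 by (simp add: algebra_simps)
  show "Y i b x = G i c a x" if "0 < \<mu>"
  proof -
    have red: "t = 0" if "\<mu> * t = 0" for t
      using that \<open>0 < \<mu>\<close> by simp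
    have 1: "Y 1 b x - G 1 c a x = 0"
      by (rule red) (use B1 4 in algebra)
    have 2: "Y a b x - G a c a x = 0"
      by (rule red) (use C1 2 6 in algebra)
    have 3: "Y c b x - G c c a x = 0"
      by (rule red) (use A1 \<open>Y 1 a x = _\<close> 5 G_antisym[OF x, of c c a] in algebra)
    have 4: "Y b b x - G b c a x = 0"
      by (rule red) (use A2 B2 C2 3 in algebra)
    show ?thesis
      using index_cases[OF abc, of i] 1 2 3 4 by auto
  qed
qed

end

section \<open>The exceptional parameters (1, mu, -1)\<close>

locale unit_frame = type_C_frame W g e lam
  for W :: "(real ^ 4) set" and g :: "real ^ 4 \<Rightarrow> 'b::euclidean_space"
    and e :: "4 \<Rightarrow> real ^ 4 \<Rightarrow> real ^ 4" and lam :: "4 \<Rightarrow> real" +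
  fixes a b c :: 4 and \<mu> :: real
  assumes abc: "distinct [1, a, b, c]"
    and lam_a: "lam a = 1" and lam_b: "lam b = \<mu>" and lam_c: "lam c = - 1" and mu: "0 \<le> \<mu>"
begin

lemmas lam_simps = lam_a lam_b lam_c

context
  fixes x assumes x: "x \<in> W"
begin

text \<open>The first two unit relations say that the almost complex structure with
  \<open>E 1 \<mapsto> E b\<close> and \<open>E c \<mapsto> E a\<close> is parallel; the
  \<open>Y i l\<close> and \<open>G i c a\<close> remain as unknowns.\<close>

lemma G_table:
  "G i a 1 x = - Y i a x" "G i b 1 x = - Y i b x" "G i c 1 x = - Y i c x"
  "G i a b x = - Y i c x" "G i b a x = Y i c x" "G i b c x = - Y i a x" "G i c b x = Y i a x"
  "G i a c x = - G i c a x"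
  using unit_relations(1,2)[OF abc lam_simps x mu, of i]
    G_antisym[OF x, of i a 1] G_antisym[OF x, of i b 1] G_antisym[OF x, of i c 1]
    G_antisym[OF x, of i b a] G_antisym[OF x, of i c b] G_antisym[OF x, of i a c]
  by auto

lemmas h_table = h_simps[OF x abc, unfolded lam_simps]

end

lemma Y_a_scaled: "y \<in> W \<Longrightarrow> Y i a y = - 1 * G i b c y"
  by (simp add: G_table)

text \<open>Since \<open>Y i a + G i b c\<close> vanishes on \<open>W\<close>, the sum of the two
  corresponding Gauss equations is algebraic in \<open>h\<close>; it is read off for the planes
  \<open>a, 1\<close> and \<open>c, 1\<close>.\<close>

lemma gauss_null:
  assumes x: "x \<in> W"
  shows "n a x \<bullet> n c x = 0" "n a x \<bullet> n a x = n c x \<bullet> n c x + \<mu> * (n b x \<bullet> n b x)"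
proof -
  have "h j 1 x \<bullet> h i a x - h i 1 x \<bullet> h j a x + (h j b x \<bullet> h i c x - h i b x \<bullet> h j c x) = 0" for i j
  proof -
    have "D i (Y j a) x = - 1 * D i (G j b c) x" for i j
      by (rule D_add_scale_eq_0[OF x smooth_G smooth_G Y_a_scaled])
    then show ?thesis
      using gauss[OF x, of i j 1 a] gauss[OF x, of i j b c]
      unfolding sum_4_distinct[OF abc]
      by (simp add: G_diag[OF x] G_table[OF x] algebra_simps)
  qed
  from this[of a 1] this[of c 1]
  show "n a x \<bullet> n c x = 0" "n a x \<bullet> n a x = n c x \<bullet> n c x + \<mu> * (n b x \<bullet> n b x)"
    by (simp_all add: h_table[OF x] inner_commute)
qed

end

text \<open>For \<mu> = 1 the factors \<open>1 - \<mu>\<close> in the unit relations vanish and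
  leave \<open>Y i c = 0\<close> for all \<open>i\<close>. In the Gauss equation for the plane
  \<open>1, c\<close> everything but the squared norm of \<open>n c\<close> then cancels.\<close>

lemma (in type_C_frame) unit_one_imp_False:
  assumes "W \<noteq> {}" and abc: "distinct [1, a, b, c]" and l: "lam a = 1" "lam b = 1" "lam c = - 1"
  shows False
proof -
  interpret unit_frame W g e lam a b c 1
    by unfold_locales (use abc l in auto)
  have rel: "Y i c y = 0" if "y \<in> W" for i y
    using unit_relations(5-7)[OF abc l that] index_cases[OF abc, of i] unit_relations(4-7)[OF abc l that]
    by auto
  have rel2: "Y i b y = G i c a y" if "y \<in> W" for i y
    using unit_relations(3)[OF abc l that] by simp
  obtain x where x: "x \<in> W"
    using assms(1) by blast
  have "D i (Y j c) x = 0" for i j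
    by (rule D_eq_0[OF x rel])
  then have "n c x \<bullet> n c x = 0"
    using gauss[OF x, of 1 c 1 c] unfolding sum_4_distinct[OF abc]
    by (simp add: G_diag[OF x] G_table[OF x] rel[OF x] rel2[OF x, symmetric] h_table[OF x])
  then show False
    using n_nonzero[OF x, of c] abc by simp
qed

text \<open>\<open>k\<close> stands for \<open>(1 + \<mu>) / (1 - \<mu>)\<close>, the ratio that up
  to sign ties \<open>Y 1 a\<close> to \<open>Y b c\<close>, \<open>Y b a\<close> to
  \<open>Y 1 c\<close>, \<open>Y c a\<close> to \<open>Y a c\<close> and \<open>Y a a\<close> to
  \<open>Y c c\<close>. Characterizing it by a polynomial equation keeps the long identities below
  free of division.\<close>

locale proper_unit_frame = unit_frame +
  fixes k :: real
  assumes mu1: "\<mu> \<noteq> 1" and k_eq: "(1 - \<mu>) * k = 1 + \<mu>"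
begin

lemma k_mu: "k * \<mu> = k - 1 - \<mu>"
  using k_eq by (simp add: algebra_simps)

lemma k_mu': "k * (\<mu> * z) = k * z - z - \<mu> * z"
  using k_mu by (metis left_diff_distrib mult.assoc mult_1)

lemma k_pos: "k \<noteq> 0" "1 + k \<noteq> 0"
proof -
  show "k \<noteq> 0"
    using k_eq mu by auto
  have "(1 - \<mu>) * (1 + k) = 2"
    using k_eq by (simp add: algebra_simps)
  then show "1 + k \<noteq> 0"
    by auto
qed

lemma Y_table:
  assumes x: "x \<in> W"
  shows "Y 1 a x = k * Y b c x" "Y b a x = - k * Y 1 c x" "Y c a x = k * Y a c x" "Y a a x = - k * Y c c x"
proof -
  have red: "s = k * t" if "(1 - \<mu>) * s = (1 + \<mu>) * t" for s t
  proof -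
    have "(1 - \<mu>) * (s - k * t) = 0"
      unfolding right_diff_distrib that mult.assoc[symmetric] k_eq by simp
    then show ?thesis
      using mu1 by simp
  qed
  note u = unit_relations[OF abc lam_simps x mu]
  show "Y 1 a x = k * Y b c x"
    by (rule red) (use u in simp)
  show "Y c a x = k * Y a c x"
    by (rule red) (use u in simp)
  have "- Y b a x = k * Y 1 c x" "- Y a a x = k * Y c c x"
    by (rule red; use u in \<open>simp add: algebra_simps\<close>)+
  then show "Y b a x = - k * Y 1 c x" "Y a a x = - k * Y c c x"
    by auto
qed

text \<open>
  The coefficients are chosen so that \<open>nab i (n b) = kap i *\<^sub>R n b + (K * Y i c) *\<^sub>R n a - (K * om i) *\<^sub>R n c\<close>.
\<close>

definition K where "K = 2 * (1 + k)"

definition om :: "4 \<Rightarrow> real ^ 4 \<Rightarrow> real" where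
  "om i y = (1 / k) * Y i a y"

definition kap :: "4 \<Rightarrow> real ^ 4 \<Rightarrow> real" where
  "kap i y = 2 * (if i = 1 then - Y b b y else if i = a then Y c b y else if i = b then Y 1 b y
     else - Y a b y)"

lemma om_table:
  assumes "x \<in> W"
  shows "om 1 x = Y b c x" "om a x = - Y c c x" "om b x = - Y 1 c x" "om c x = Y a c x"
  using k_pos by (simp_all add: om_def Y_table[OF assms])

lemma kap_table: "kap 1 x = - 2 * Y b b x" "kap a x = 2 * Y c b x" "kap b x = 2 * Y 1 b x"
  "kap c x = - 2 * Y a b x"
  using abc by (auto simp: kap_def)

lemma perms: "distinct [1, a, c, b]" "distinct [1, b, a, c]" "distinct [1, b, c, a]"
  "distinct [1, c, a, b]" "distinct [1, c, b, a]"
  using abc by auto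

text \<open>The relation \<open>Y i b = G i c a\<close> is known for positive \<mu>; multiplied by
  \<mu> it also holds for \<mu> = 0. In this form, and as \<open>k_Y_b\<close>, it serves both cases
  up to and including the Ricci equations.\<close>

lemma mu_Y_b: "y \<in> W \<Longrightarrow> \<mu> * Y i b y = \<mu> * G i c a y"
  using unit_relations(3)[OF abc lam_simps _ mu, of y i] mu by (cases "\<mu> = 0") auto

lemma nab_n_b:
  assumes x: "x \<in> W"
  shows "nab i (n b) x = kap i x *\<^sub>R n b x + (K * Y i c x) *\<^sub>R n a x - (K * om i x) *\<^sub>R n c x"
proof -
  have "nab 1 (n b) x = kap 1 x *\<^sub>R n b x + (K * Y 1 c x) *\<^sub>R n a x - (K * om 1 x) *\<^sub>R n c x"
    unfolding nab_1_n[OF x perms(1)] K_def kap_table om_table[OF x]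
    by (simp add: lam_simps G_table[OF x] Y_table[OF x] algebra_simps scaleR_double)
  moreover have "nab b (n b) x = kap b x *\<^sub>R n b x + (K * Y b c x) *\<^sub>R n a x - (K * om b x) *\<^sub>R n c x"
    unfolding nab_a_n_a[OF x perms(2)] K_def kap_table om_table[OF x]
    by (simp add: lam_simps G_table[OF x] Y_table[OF x] algebra_simps scaleR_double)
  moreover have "nab a (n b) x = kap a x *\<^sub>R n b x + (K * Y a c x) *\<^sub>R n a x - (K * om a x) *\<^sub>R n c x"
    unfolding nab_b_n_a[OF x perms(2)] K_def kap_table om_table[OF x]
    using mu_Y_b[OF x, of 1]
    by (simp add: lam_simps G_table[OF x] Y_table[OF x] algebra_simps scaleR_double)
  moreover have "nab c (n b) x = kap c x *\<^sub>R n b x + (K * Y c c x) *\<^sub>R n a x - (K * om c x) *\<^sub>R n c x"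
    unfolding nab_b_n_a[OF x perms(3)] K_def kap_table om_table[OF x]
    using mu_Y_b[OF x, of 1]
    by (simp add: lam_simps G_table[OF x] Y_table[OF x] algebra_simps scaleR_double)
  ultimately show ?thesis
    using index_cases[OF abc, of i] by auto
qed

end

context proper_unit_frame
begin

text \<open>\<open>k - 1\<close> is a multiple of \<mu>, so \<open>mu_Y_b\<close> makes
  \<open>(k - 1) * (Y i b - G i c a)\<close> vanish.\<close>

lemma k_Y_b: "y \<in> W \<Longrightarrow> k * Y i b y = Y i b y + k * G i c a y - G i c a y"
proof -
  assume y: "y \<in> W"
  have "(1 - \<mu>) * (k - 1) = 2 * \<mu>"
    using k_eq by (simp add: algebra_simps)
  then have "(1 - \<mu>) * ((k - 1) * (Y i b y - G i c a y)) = 2 * (\<mu> * Y i b y - \<mu> * G i c a y)"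
    by algebra
  then have "(k - 1) * (Y i b y - G i c a y) = 0"
    using mu1 mu_Y_b[OF y, of i] by simp
  then show ?thesis
    by (simp add: algebra_simps)
qed

lemma k_mu'': "\<mu> * (k * z) = k * z - z - \<mu> * z"
  using k_mu'[of z] by (simp add: mult.left_commute)

lemma nab_n_a:
  assumes x: "x \<in> W"
  shows
    "nab 1 (n a) x = (2 * k * Y c c x) *\<^sub>R n a x + ((\<mu> - 1) * Y 1 c x - 2 * Y a b x) *\<^sub>R n b x
      + (- Y 1 b x - G 1 c a x - 2 * Y a c x) *\<^sub>R n c x"
    "nab a (n a) x = (2 * k * Y b c x) *\<^sub>R n a x
      + ((\<mu> - 1) * Y a c x + 2 * \<mu> * G 1 c a x) *\<^sub>R n b x
      + (- Y a b x - G a c a x - 2 * Y 1 c x) *\<^sub>R n c x"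
    "nab b (n a) x = (2 * k * Y a c x) *\<^sub>R n a x + ((\<mu> - 1) * Y b c x + 2 * Y c b x) *\<^sub>R n b x
      + (2 * Y c c x - Y b b x - G b c a x) *\<^sub>R n c x"
    "nab c (n a) x = (2 * k * Y 1 c x) *\<^sub>R n a x + ((\<mu> - 1) * Y c c x - 2 * \<mu> * Y b b x) *\<^sub>R n b x
      + (2 * Y b c x - Y c b x - G c c a x) *\<^sub>R n c x"
     unfolding nab_1_n[OF x perms(3)] nab_a_n_a[OF x abc] nab_b_n_a[OF x abc] nab_b_n_a[OF x perms(1)]
    by (simp_all add: lam_simps G_table[OF x] Y_table[OF x] algebra_simps scaleR_double k_mu' k_mu'')

lemma nab_n_c:
  assumes x: "x \<in> W"
  shows
    "nab 1 (n c) x = (Y 1 b x + G 1 c a x - 2 * k * Y a c x) *\<^sub>R n a x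
      + ((1 + \<mu>) * k * Y b c x - 2 * Y c b x) *\<^sub>R n b x + (- 2 * Y c c x) *\<^sub>R n c x"
    "nab a (n c) x = (Y a b x + G a c a x + 2 * k * Y 1 c x) *\<^sub>R n a x
      + (- (1 + \<mu>) * k * Y c c x - 2 * \<mu> * Y b b x) *\<^sub>R n b x + (2 * Y b c x) *\<^sub>R n c x"
    "nab b (n c) x = (Y b b x + G b c a x + 2 * k * Y c c x) *\<^sub>R n a x
      + (- (1 + \<mu>) * k * Y 1 c x - 2 * Y a b x) *\<^sub>R n b x + (- 2 * Y a c x) *\<^sub>R n c x"
    "nab c (n c) x = (Y c b x + G c c a x - 2 * k * Y b c x) *\<^sub>R n a x
      + ((1 + \<mu>) * k * Y a c x - 2 * \<mu> * G 1 c a x) *\<^sub>R n b x + (2 * Y 1 c x) *\<^sub>R n c x"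
  unfolding nab_1_n[OF x abc] nab_a_n_a[OF x perms(4)] nab_b_n_a[OF x perms(4)] nab_b_n_a[OF x perms(5)]
  by (simp_all add: lam_simps G_table[OF x] Y_table[OF x] algebra_simps scaleR_double k_mu' k_mu'')

lemma smooth_kap: "smooth_on (kap i) W"
proof -
  have 1: "smooth_on (\<lambda>y. r * Y j l y) W" for r j l
    by (rule smooth_on_bounded_linear[OF bounded_linear_mult_right open_W smooth_G])
  have "kap i = (if i = 1 then (\<lambda>y. - 2 * Y b b y) else if i = a then (\<lambda>y. 2 * Y c b y)
      else if i = b then (\<lambda>y. 2 * Y 1 b y) else (\<lambda>y. - 2 * Y a b y))"
    by (auto simp: kap_def fun_eq_iff)
  then show ?thesis
    by (auto simp only: 1 split: if_splits)
qed

lemma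
  shows smooth_om: "smooth_on (om i) W" and D_om: "x \<in> W \<Longrightarrow> D j (om i) x = (1 / k) * D j (Y i a) x"
proof -
  have om: "om i = (\<lambda>y. (1 / k) * Y i a y)"
    by (simp add: fun_eq_iff om_def)
  show "smooth_on (om i) W"
    unfolding om by (rule smooth_on_bounded_linear[OF bounded_linear_mult_right open_W smooth_G])
  show "x \<in> W \<Longrightarrow> D j (om i) x = (1 / k) * D j (Y i a) x"
    unfolding om by (rule dird_bounded_linear[OF open_W _ bounded_linear_mult_right smooth_G])
qed

lemma nab_nab_n_b:
  assumes x: "x \<in> W"
  shows "nab i (nab j (n b)) x = kap j x *\<^sub>R nab i (n b) x + D i (kap j) x *\<^sub>R n b x
    + (K * Y j c x) *\<^sub>R nab i (n a) x + (K * D i (Y j c) x) *\<^sub>R n a x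
    - (K * om j x) *\<^sub>R nab i (n c) x - (K / k * D i (Y j a) x) *\<^sub>R n c x"
proof -
  have sm: "smooth_on (\<lambda>y. kap j y *\<^sub>R n b y) W" "smooth_on (\<lambda>y. Y j c y *\<^sub>R n a y) W"
    "smooth_on (\<lambda>y. om j y *\<^sub>R n c y) W"
    by (intro smooth_on_scaleR open_W smooth_kap smooth_h smooth_G smooth_om)+
  have smK: "smooth_on (\<lambda>y. K *\<^sub>R (Y j c y *\<^sub>R n a y)) W" "smooth_on (\<lambda>y. K *\<^sub>R (om j y *\<^sub>R n c y)) W"
    by (intro smooth_on_scaleR[OF open_W smooth_on_const] sm)+
  have nn: "nproj x (n l x) = n l x" for l
    by (rule nproj_normal[OF x]) (rule h_E[OF x])
  have "nab i (nab j (n b)) x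
      = nab i (\<lambda>y. kap j y *\<^sub>R n b y + K *\<^sub>R (Y j c y *\<^sub>R n a y) - K *\<^sub>R (om j y *\<^sub>R n c y)) x"
    by (rule nab_cong[OF x]) (simp add: nab_n_b)
  also have "\<dots> = nab i (\<lambda>y. kap j y *\<^sub>R n b y) x + K *\<^sub>R nab i (\<lambda>y. Y j c y *\<^sub>R n a y) x
      - K *\<^sub>R nab i (\<lambda>y. om j y *\<^sub>R n c y) x"
    by (simp only: nab_diff[OF x smooth_on_add[OF open_W sm(1) smK(1)] smK(2)]
        nab_add[OF x sm(1) smK(1)] nab_scaleR_const[OF x sm(2)] nab_scaleR_const[OF x sm(3)])
  also have "\<dots> = kap j x *\<^sub>R nab i (n b) x + D i (kap j) x *\<^sub>R n b x
    + (K * Y j c x) *\<^sub>R nab i (n a) x + (K * D i (Y j c) x) *\<^sub>R n a x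
    - (K * om j x) *\<^sub>R nab i (n c) x - (K / k * D i (Y j a) x) *\<^sub>R n c x"
    unfolding nab_scaleR[OF x smooth_kap smooth_h] nab_scaleR[OF x smooth_G smooth_h]
      nab_scaleR[OF x smooth_om smooth_h] nn D_om[OF x]
    by (simp add: scaleR_add_right)
  finally show ?thesis .
qed

text \<open>What the Gauss equation gives for \<open>D i (Y j m) - D j (Y i m)\<close> apart from
  the bracket term.\<close>

definition dY :: "4 \<Rightarrow> 4 \<Rightarrow> 4 \<Rightarrow> real ^ 4 \<Rightarrow> real" where
  "dY m i j x = (\<Sum>l\<in>UNIV. G j 1 l x * G i m l x - G i 1 l x * G j m l x)
     + h j 1 x \<bullet> h i m x - h i 1 x \<bullet> h j m x"

text \<open>The coefficients of \<open>n a\<close> and \<open>n c\<close> in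
  \<open>nab i (n b)\<close> are multiples of \<open>Y i c\<close> and \<open>Y i a\<close>. In the
  antisymmetrized second derivative their derivatives are supplied by the Gauss equation, and the
  bracket terms on both sides cancel. Along \<open>n a\<close> and \<open>n c\<close> the Ricci
  equation thus becomes algebraic; derivatives of \<open>kap\<close> occur along \<open>n b\<close>
  alone.\<close>

lemma ricci_n_b:
  assumes x: "x \<in> W"
    and R: "(\<Sum>l\<in>UNIV. (n b x \<bullet> h j l x) *\<^sub>R h i l x - (n b x \<bullet> h i l x) *\<^sub>R h j l x)
      = Ra *\<^sub>R n a x + Rb *\<^sub>R n b x + Rc *\<^sub>R n c x"
    and ia: "nab i (n a) x = ia1 *\<^sub>R n a x + ia2 *\<^sub>R n b x + ia3 *\<^sub>R n c x"
    and ic: "nab i (n c) x = ic1 *\<^sub>R n a x + ic2 *\<^sub>R n b x + ic3 *\<^sub>R n c x"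
    and ja: "nab j (n a) x = ja1 *\<^sub>R n a x + ja2 *\<^sub>R n b x + ja3 *\<^sub>R n c x"
    and jc: "nab j (n c) x = jc1 *\<^sub>R n a x + jc2 *\<^sub>R n b x + jc3 *\<^sub>R n c x"
  shows "K * (dY c i j x + kap j x * Y i c x - kap i x * Y j c x + Y j c x * ia1 - Y i c x * ja1
      - om j x * ic1 + om i x * jc1) = Ra"
    and "K * (- dY a i j x / k - kap j x * om i x + kap i x * om j x + Y j c x * ia3 - Y i c x * ja3
      - om j x * ic3 + om i x * jc3) = Rc"
proof -
  \<comment> \<open>The coefficients of the Lie bracket of \<open>e i\<close> and \<open>e j\<close>
    in the frame.\<close>
  define s where "s l = G i j l x - G j i l x" for l
  define t where "t m = (\<Sum>l\<in>UNIV. s l * Y l m x)" for m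
  have dY: "D i (Y j m) x = D j (Y i m) x + t m + dY m i j x" for m
    using gauss[OF x, of i j 1 m] by (simp add: dY_def s_def t_def)
  have nb: "n b y \<bullet> E l y = 0" if "y \<in> W" for y l
    by (rule h_E[OF that])
  define skap where "skap = (\<Sum>l\<in>UNIV. s l * kap l x)"
  have sn: "(\<Sum>l\<in>UNIV. s l *\<^sub>R nab l (n b) x)
      = skap *\<^sub>R n b x + (K * t c) *\<^sub>R n a x - (K / k * t a) *\<^sub>R n c x"
    unfolding nab_n_b[OF x] skap_def t_def sum_4_distinct[OF abc] om_def
    by (simp add: algebra_simps)
  have "(K * (dY c i j x + kap j x * Y i c x - kap i x * Y j c x + Y j c x * ia1 - Y i c x * ja1
      - om j x * ic1 + om i x * jc1) - Ra) *\<^sub>R n a x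
    + (kap j x * kap i x + D i (kap j) x + K * Y j c x * ia2 - K * om j x * ic2
       - (kap i x * kap j x + D j (kap i) x + K * Y i c x * ja2 - K * om i x * jc2) - skap - Rb) *\<^sub>R n b x
    + (K * (- dY a i j x / k - kap j x * om i x + kap i x * om j x + Y j c x * ia3 - Y i c x * ja3
      - om j x * ic3 + om i x * jc3) - Rc) *\<^sub>R n c x = 0"
    using ricci[OF x smooth_h nb, of i j]
    unfolding nab_nab_n_b[OF x] R s_def[symmetric] sn
    unfolding nab_n_b[OF x] ia ic ja jc dY
    by (simp add: algebra_simps)
  from indep3[OF x abc this] show "K * (dY c i j x + kap j x * Y i c x - kap i x * Y j c x + Y j c x * ia1 - Y i c x * ja1
      - om j x * ic1 + om i x * jc1) = Ra"
    and "K * (- dY a i j x / k - kap j x * om i x + kap i x * om j x + Y j c x * ia3 - Y i c x * ja3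
      - om j x * ic3 + om i x * jc3) = Rc"
    by auto
qed

end

section \<open>The Ricci equations of \<open>n b\<close>, direction by direction\<close>

context proper_unit_frame
begin

lemma ricci_n_b_scaled:
  "K * (- d / k - z1 + z2 + z3 - z4 - z5 + z6) = Rc \<Longrightarrow>
    K * (- d + k * (- z1 + z2 + z3 - z4 - z5 + z6)) = k * Rc"
  using k_pos by (auto simp: field_simps)

text \<open>\<open>R\<close> is the curvature of the normal bundle applied to \<open>n b\<close>,
  computed from \<open>h\<close> alone; \<open>gauss_null\<close> and \<open>k_Y_b\<close> then
  simplify the outcome. The other pairs of directions are treated alike.\<close>

lemma ricci_1_a:
  assumes x: "x \<in> W"
  shows "K * (Y c b x * Y 1 c x + Y b b x * Y a c x + Y c c x * Y 1 b x + Y b c x * Y a b x) = 0"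
    and "K * (2 * k * (Y a b x * Y 1 c x + Y b b x * Y c c x - Y 1 b x * Y a c x - Y c b x * Y b c x + Y 1 c x * Y 1 c x + Y b c x * Y b c x - Y a c x * Y a c x - Y c c x * Y c c x) - (n a x \<bullet> n a x)) = k * (1 + \<mu>) * (n b x \<bullet> n b x)"
proof -
  have R: "(\<Sum>l\<in>UNIV. (n b x \<bullet> h a l x) *\<^sub>R h 1 l x - (n b x \<bullet> h 1 l x) *\<^sub>R h a l x)
      = (0) *\<^sub>R n a x + (- (1 + \<mu>) * (n b x \<bullet> n c x)) *\<^sub>R n b x + ((1 + \<mu>) * (n b x \<bullet> n b x)) *\<^sub>R n c x"
    unfolding sum_4_distinct[OF abc] by (simp add: h_table[OF x] algebra_simps inner_commute scaleR_double)
  note Q = ricci_n_b[OF x R nab_n_a(1)[OF x] nab_n_c(1)[OF x] nab_n_a(2)[OF x] nab_n_c(2)[OF x]]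
  note T = G_diag[OF x] G_table[OF x] om_table[OF x] kap_table Y_table[OF x] h_table[OF x] inner_commute
  show "K * (Y c b x * Y 1 c x + Y b b x * Y a c x + Y c c x * Y 1 b x + Y b c x * Y a b x) = 0"
    using Q(1) k_Y_b[OF x, of 1] k_Y_b[OF x, of a] gauss_null[OF x]
    unfolding dY_def sum_4_distinct[OF abc] by (simp add: T, algebra)
  show "K * (2 * k * (Y a b x * Y 1 c x + Y b b x * Y c c x - Y 1 b x * Y a c x - Y c b x * Y b c x + Y 1 c x * Y 1 c x + Y b c x * Y b c x - Y a c x * Y a c x - Y c c x * Y c c x) - (n a x \<bullet> n a x)) = k * (1 + \<mu>) * (n b x \<bullet> n b x)"
    using ricci_n_b_scaled[OF Q(2)] k_Y_b[OF x, of 1] k_Y_b[OF x, of a] gauss_null[OF x]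
    unfolding dY_def sum_4_distinct[OF abc] by (simp add: T, algebra)
qed

lemma ricci_1_c:
  assumes x: "x \<in> W"
  shows "K * (2 * (Y b b x * Y c c x + Y c b x * Y b c x - Y a b x * Y 1 c x - Y 1 b x * Y a c x) + 2 * k * (Y c c x * Y c c x + Y a c x * Y a c x - Y 1 c x * Y 1 c x - Y b c x * Y b c x) + (n c x \<bullet> n c x)) = (\<mu> - 1) * (n b x \<bullet> n b x)"
    and "K * k * (Y b c x * Y a b x - Y c c x * Y 1 b x + Y c b x * Y 1 c x - Y a c x * Y b b x) = 0"
proof -
  have R: "(\<Sum>l\<in>UNIV. (n b x \<bullet> h c l x) *\<^sub>R h 1 l x - (n b x \<bullet> h 1 l x) *\<^sub>R h c l x)
      = ((\<mu> - 1) * (n b x \<bullet> n b x)) *\<^sub>R n a x + ((1 - \<mu>) * (n a x \<bullet> n b x)) *\<^sub>R n b x + (0) *\<^sub>R n c x"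
    unfolding sum_4_distinct[OF abc] by (simp add: h_table[OF x] algebra_simps inner_commute scaleR_double)
  note Q = ricci_n_b[OF x R nab_n_a(1)[OF x] nab_n_c(1)[OF x] nab_n_a(4)[OF x] nab_n_c(4)[OF x]]
  note T = G_diag[OF x] G_table[OF x] om_table[OF x] kap_table Y_table[OF x] h_table[OF x] inner_commute
  show "K * (2 * (Y b b x * Y c c x + Y c b x * Y b c x - Y a b x * Y 1 c x - Y 1 b x * Y a c x) + 2 * k * (Y c c x * Y c c x + Y a c x * Y a c x - Y 1 c x * Y 1 c x - Y b c x * Y b c x) + (n c x \<bullet> n c x)) = (\<mu> - 1) * (n b x \<bullet> n b x)"
    using Q(1) k_Y_b[OF x, of 1] k_Y_b[OF x, of c] gauss_null[OF x]
    unfolding dY_def sum_4_distinct[OF abc] by (simp add: T, algebra)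
  show "K * k * (Y b c x * Y a b x - Y c c x * Y 1 b x + Y c b x * Y 1 c x - Y a c x * Y b b x) = 0"
    using ricci_n_b_scaled[OF Q(2)] k_Y_b[OF x, of 1] k_Y_b[OF x, of c] gauss_null[OF x]
    unfolding dY_def sum_4_distinct[OF abc] by (simp add: T, algebra)
qed

lemma ricci_a_c:
  assumes x: "x \<in> W"
  shows "K * (4 * k * (Y c c x * Y b c x - Y a c x * Y 1 c x) - 4 * (Y a b x * Y a c x + Y c b x * Y c c x) + \<mu> * (n b x \<bullet> n c x)) = 2 * (n b x \<bullet> n c x)"
    and "K * (4 * k * (Y c b x * Y a c x - Y a b x * Y c c x - Y c c x * Y 1 c x - Y a c x * Y b c x) + \<mu> * (n a x \<bullet> n b x)) = - 2 * k * (n a x \<bullet> n b x)"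
proof -
  have R: "(\<Sum>l\<in>UNIV. (n b x \<bullet> h c l x) *\<^sub>R h a l x - (n b x \<bullet> h a l x) *\<^sub>R h c l x)
      = (2 * (n b x \<bullet> n c x)) *\<^sub>R n a x + (0) *\<^sub>R n b x + (- 2 * (n a x \<bullet> n b x)) *\<^sub>R n c x"
    unfolding sum_4_distinct[OF abc] by (simp add: h_table[OF x] algebra_simps inner_commute scaleR_double)
  note Q = ricci_n_b[OF x R nab_n_a(2)[OF x] nab_n_c(2)[OF x] nab_n_a(4)[OF x] nab_n_c(4)[OF x]]
  note T = G_diag[OF x] G_table[OF x] om_table[OF x] kap_table Y_table[OF x] h_table[OF x] inner_commute
  show "K * (4 * k * (Y c c x * Y b c x - Y a c x * Y 1 c x) - 4 * (Y a b x * Y a c x + Y c b x * Y c c x) + \<mu> * (n b x \<bullet> n c x)) = 2 * (n b x \<bullet> n c x)"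
    using Q(1) k_Y_b[OF x, of a] k_Y_b[OF x, of c] gauss_null[OF x]
    unfolding dY_def sum_4_distinct[OF abc] by (simp add: T, algebra)
  show "K * (4 * k * (Y c b x * Y a c x - Y a b x * Y c c x - Y c c x * Y 1 c x - Y a c x * Y b c x) + \<mu> * (n a x \<bullet> n b x)) = - 2 * k * (n a x \<bullet> n b x)"
    using ricci_n_b_scaled[OF Q(2)] k_Y_b[OF x, of a] k_Y_b[OF x, of c] gauss_null[OF x]
    unfolding dY_def sum_4_distinct[OF abc] by (simp add: T, algebra)
qed

lemma ricci_1_b:
  assumes x: "x \<in> W"
  shows "K * (4 * (Y 1 b x * Y 1 c x + Y b b x * Y b c x) + 4 * k * (Y c c x * Y b c x - Y a c x * Y 1 c x) + (n b x \<bullet> n c x)) = - 2 * (n b x \<bullet> n c x)"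
    and "K * (4 * k * (Y 1 b x * Y b c x - Y b b x * Y 1 c x + Y a c x * Y b c x + Y c c x * Y 1 c x) + (n a x \<bullet> n b x)) = - 2 * k * (n a x \<bullet> n b x)"
proof -
  have R: "(\<Sum>l\<in>UNIV. (n b x \<bullet> h b l x) *\<^sub>R h 1 l x - (n b x \<bullet> h 1 l x) *\<^sub>R h b l x)
      = (- 2 * (n b x \<bullet> n c x)) *\<^sub>R n a x + (0) *\<^sub>R n b x + (2 * (n a x \<bullet> n b x)) *\<^sub>R n c x"
    unfolding sum_4_distinct[OF abc] by (simp add: h_table[OF x] algebra_simps inner_commute scaleR_double)
  note Q = ricci_n_b[OF x R nab_n_a(1)[OF x] nab_n_c(1)[OF x] nab_n_a(3)[OF x] nab_n_c(3)[OF x]]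
  note T = G_diag[OF x] G_table[OF x] om_table[OF x] kap_table Y_table[OF x] h_table[OF x] inner_commute
  show "K * (4 * (Y 1 b x * Y 1 c x + Y b b x * Y b c x) + 4 * k * (Y c c x * Y b c x - Y a c x * Y 1 c x) + (n b x \<bullet> n c x)) = - 2 * (n b x \<bullet> n c x)"
    using Q(1) k_Y_b[OF x, of 1] k_Y_b[OF x, of b] gauss_null[OF x]
    unfolding dY_def sum_4_distinct[OF abc] by (simp add: T, algebra)
  show "K * (4 * k * (Y 1 b x * Y b c x - Y b b x * Y 1 c x + Y a c x * Y b c x + Y c c x * Y 1 c x) + (n a x \<bullet> n b x)) = - 2 * k * (n a x \<bullet> n b x)"
    using ricci_n_b_scaled[OF Q(2)] k_Y_b[OF x, of 1] k_Y_b[OF x, of b] gauss_null[OF x]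
    unfolding dY_def sum_4_distinct[OF abc] by (simp add: T, algebra)
qed

end

text \<open>The letters stand for \<open>P = Y b c\<close>, \<open>w = Y 1 c\<close>,
  \<open>q = Y a c\<close>, \<open>r = Y c c\<close>, for \<open>t0\<close>, \<open>t1\<close>,
  \<open>t2\<close>, \<open>t3\<close> = \<open>Y 1 b\<close>, \<open>Y a b\<close>,
  \<open>Y b b\<close>, \<open>Y c b\<close>, and for inner products of \<open>n a\<close>,
  \<open>n b\<close>, \<open>n c\<close>. \<open>R1\<close> and \<open>R2\<close> make
  \<open>(t1, t3)\<close> proportional to \<open>(w, - P)\<close>; \<open>R3\<close> and
  \<open>R4\<close> with \<open>S1\<close> and \<open>S2\<close> determine the factor, and then
  \<open>R5\<close> and \<open>R6\<close> force \<open>gab = gbc = 0\<close>. By \<open>S3\<close>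
  and \<open>S4\<close> this gives \<open>q = r = 0\<close>, after which the equations for the norms
  contradict \<open>0 < Gb\<close>.\<close>

lemma unit_system_inconsistent:
  fixes P w q r t0 t1 t2 t3 Ga Gb Gc gab gbc k \<mu> K :: real
  assumes k: "(1 - \<mu>) * k = 1 + \<mu>" and mu: "0 < \<mu>" "\<mu> \<noteq> 1" and K: "K = 2 * (1 + k)"
    and pos: "0 < Gb" "0 < Gc" and Ga: "Ga = Gc + \<mu> * Gb"
    and R1: "K * (t3 * w + t2 * q + r * t0 + P * t1) = 0"
    and R2: "K * k * (P * t1 - r * t0 + t3 * w - q * t2) = 0"
    and R3: "K * (2 * k * (t1 * w + t2 * r - t0 * q - t3 * P + w * w + P * P - q * q - r * r) - Ga)
      = k * (1 + \<mu>) * Gb"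
    and R4: "K * (2 * (t2 * r + t3 * P - t1 * w - t0 * q) + 2 * k * (r * r + q * q - w * w - P * P) + Gc)
      = (\<mu> - 1) * Gb"
    and R5: "K * (4 * k * (r * P - q * w) - 4 * (t1 * q + t3 * r) + \<mu> * gbc) = 2 * gbc"
    and R6: "K * (4 * k * (t3 * q - t1 * r - r * w - q * P) + \<mu> * gab) = - 2 * k * gab"
    and S1: "4 * k * (P * P + w * w) = Gb - Ga - Gc"
    and S2: "4 * k * (q * q + r * r) = Ga + Gc - \<mu>\<^sup>2 * Gb"
    and S3: "4 * k * (P * q + r * w) = (1 - \<mu>) * gab"
    and S4: "4 * k * (r * P - q * w) = (1 + \<mu>) * gbc"
  shows False
proof -
  \<comment> \<open>\<open>s\<close> equals \<open>2 / (1 - \<mu>)\<close>; with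
    \<open>k = s - 1\<close> and \<open>s * \<mu> = s - 2\<close> all relations between the
    parameters are polynomial.\<close>
  define s where "s = 1 + k"
  have s: "(1 - \<mu>) * s = 2" and ks: "k = s - 1" and Ks: "K = 2 * s"
    using k K by (simp_all add: s_def algebra_simps)
  have smu: "s * \<mu> = s - 2"
    using s by (simp add: algebra_simps)
  have nz: "s \<noteq> 0" "k \<noteq> 0" "K \<noteq> 0" "k \<noteq> 1"
  proof -
    show "s \<noteq> 0" "k \<noteq> 0"
      using s k mu by auto
    then show "K \<noteq> 0"
      using Ks by simp
    show "k \<noteq> 1"
      using k mu by auto
  qed
  define A \<tau> where "A = P * P + w * w" and "\<tau> = t1 * w - t3 * P"
  have e: "t3 * w + t1 * P = 0"
  proof -
    have "t3 * w + t2 * q + r * t0 + P * t1 = 0" "P * t1 - r * t0 + t3 * w - q * t2 = 0"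
      using R1 R2 nz by auto
    then show ?thesis
      by (simp add: algebra_simps)
  qed
  have t1: "t1 * A = w * \<tau>" and t3: "t3 * A = - P * \<tau>"
    unfolding A_def \<tau>_def using e by algebra+
  have A: "2 * k * s * A = Gb - s * Gc"
    using S1 s Ga unfolding A_def by algebra
  have B: "2 * k * s * (q * q + r * r) = s * Gc + \<mu> * Gb"
    using S2 s Ga by algebra
  have tau: "s * (4 * k * \<tau> - 3 * s * Gc) = (2 * k - 3) * Gb"
    using R3 R4 A B Ga smu ks unfolding Ks A_def \<tau>_def by algebra
  \<comment> \<open>\<open>1\<close> and \<open>2\<close> evaluate the factors by which
    \<open>gab\<close> and \<open>gbc\<close> get multiplied below. These are multiples of the
    positive \<open>Gc\<close> and \<open>Ga\<close>, so both inner products vanish.\<close>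
  have 1: "2 * (2 * \<tau> + (3 - 2 * k) * A) = 5 * Gc"
  proof -
    have "k * s * (2 * (2 * \<tau> + (3 - 2 * k) * A) - 5 * Gc) = 0"
      using tau A ks by algebra
    then show ?thesis
      using nz by simp
  qed
  have 2: "2 * k * (2 * \<tau> + (3 * k - 2) * A) = 5 * Ga"
  proof -
    have "s * (2 * k * (2 * \<tau> + (3 * k - 2) * A) - 5 * Ga) = 0"
      using tau A ks Ga smu by algebra
    then show ?thesis
      using nz by simp
  qed
  have gab: "gab = 0"
  proof -
    have "4 * k * K * (t3 * q - t1 * r) = (6 - 4 * k) * gab"
      using R6 S3 s ks smu unfolding Ks by algebra
    then have "gab * (2 * (2 * \<tau> + (3 - 2 * k) * A)) = 0"
      using t1 t3 S3 s unfolding Ks by algebra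
    then show ?thesis
      using 1 pos by simp
  qed
  have gbc: "gbc = 0"
  proof -
    have "4 * K * (t1 * q + t3 * r) = (6 * k - 4) * gbc"
      using R5 S4 s ks smu unfolding Ks by algebra
    then have "gbc * (2 * k * (2 * \<tau> + (3 * k - 2) * A)) = 0"
      using t1 t3 S4 s ks smu unfolding Ks by algebra
    moreover have "0 < Ga"
      using pos mu Ga by (simp add: add_pos_pos)
    ultimately show ?thesis
      using 2 by simp
  qed
  have "A \<noteq> 0"
  proof
    assume "A = 0"
    then have "P = 0" "w = 0"
      by (auto simp: A_def sum_squares_eq_zero_iff)
    then show False
      using 1 \<open>A = 0\<close> pos by (simp add: \<tau>_def)
  qed
  moreover have "P * q + r * w = 0" "r * P - q * w = 0"
    using S3 S4 gab gbc nz by auto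
  then have "A * q = 0" "A * r = 0"
    unfolding A_def by algebra+
  ultimately have qr: "q = 0" "r = 0"
    by auto
  have "s * Gc = - \<mu> * Gb"
    using B qr by simp
  then have c1: "s * s * Gc = - (k - 1) * Gb"
    using smu ks by algebra
  have "s * (s * (2 * k * (\<tau> + A) - Ga)) * 2 = 2 * k * k * Gb"
    using R3 qr smu ks unfolding Ks A_def \<tau>_def by algebra
  then have "s * s * (3 * k - 1) * Gc = (2 * k + 1) * (k - 1) * Gb"
    using tau A Ga smu ks by algebra
  then have "5 * k * (k - 1) * Gb = 0"
    using c1 by algebra
  then show False
    using nz pos by simp
qed

context proper_unit_frame
begin

text \<open>For positive \<mu> also \<open>Y i b - G i c a\<close> vanishes on \<open>W\<close>, and
  the difference of the two corresponding Gauss equations is free of derivatives.\<close>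

lemma gauss_middle:
  assumes x: "x \<in> W" and mu: "0 < \<mu>"
  shows "4 * k * (Y b c x * Y b c x + Y 1 c x * Y 1 c x) = n b x \<bullet> n b x - n a x \<bullet> n a x - n c x \<bullet> n c x"
    "4 * k * (Y a c x * Y a c x + Y c c x * Y c c x) = n a x \<bullet> n a x + n c x \<bullet> n c x - \<mu>\<^sup>2 * (n b x \<bullet> n b x)"
    "4 * k * (Y b c x * Y a c x + Y c c x * Y 1 c x) = (1 - \<mu>) * (n a x \<bullet> n b x)"
    "4 * k * (Y c c x * Y b c x - Y a c x * Y 1 c x) = (1 + \<mu>) * (n b x \<bullet> n c x)"
proof -
  have rel: "Y i b y = 1 * G i c a y" if "y \<in> W" for i y
    using unit_relations(3)[OF abc lam_simps that _ mu] mu by simp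
  have D: "D i (Y j b) x = 1 * D i (G j c a) x" for i j
    by (rule D_add_scale_eq_0[OF x smooth_G smooth_G rel])
  have Q: "(\<Sum>l\<in>UNIV. (G i j l x - G j i l x) * (Y l b x - G l c a x))
     + (\<Sum>l\<in>UNIV. G j 1 l x * G i b l x - G i 1 l x * G j b l x)
     - (\<Sum>l\<in>UNIV. G j c l x * G i a l x - G i c l x * G j a l x)
     + h j 1 x \<bullet> h i b x - h i 1 x \<bullet> h j b x - h j c x \<bullet> h i a x + h i c x \<bullet> h j a x = 0" for i j
    using gauss[OF x, of i j 1 b] gauss[OF x, of i j c a] D
    by (simp add: right_diff_distrib sum_subtractf)
  note T = G_diag[OF x] G_table[OF x] Y_table[OF x] h_table[OF x] inner_commute rel[OF x] gauss_null(1)[OF x]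
  show "4 * k * (Y b c x * Y b c x + Y 1 c x * Y 1 c x) = n b x \<bullet> n b x - n a x \<bullet> n a x - n c x \<bullet> n c x"
    using Q[of 1 b] unfolding sum_4_distinct[OF abc] by (simp add: T algebra_simps)
  show "4 * k * (Y a c x * Y a c x + Y c c x * Y c c x) = n a x \<bullet> n a x + n c x \<bullet> n c x - \<mu>\<^sup>2 * (n b x \<bullet> n b x)"
    using Q[of a c] unfolding sum_4_distinct[OF abc] by (simp add: T algebra_simps power2_eq_square)
  show "4 * k * (Y b c x * Y a c x + Y c c x * Y 1 c x) = (1 - \<mu>) * (n a x \<bullet> n b x)"
    using Q[of 1 a] unfolding sum_4_distinct[OF abc] by (simp add: T algebra_simps)
  show "4 * k * (Y c c x * Y b c x - Y a c x * Y 1 c x) = (1 + \<mu>) * (n b x \<bullet> n c x)"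
    using Q[of 1 c] unfolding sum_4_distinct[OF abc] by (simp add: T algebra_simps)
qed

lemma unit_positive_imp_False:
  assumes "W \<noteq> {}" "0 < \<mu>"
  shows False
proof -
  obtain x where x: "x \<in> W"
    using assms(1) by blast
  have "0 < n b x \<bullet> n b x" "0 < n c x \<bullet> n c x"
    using n_nonzero[OF x] abc by auto
  from unit_system_inconsistent[OF k_eq assms(2) mu1 K_def this gauss_null(2)[OF x] ricci_1_a(1)[OF x]
      ricci_1_c(2)[OF x] ricci_1_a(2)[OF x] ricci_1_c(1)[OF x] ricci_a_c[OF x] gauss_middle[OF x assms(2)]]
  show False .
qed

text \<open>The normal connection is metric, because the tangential terms of the Weingarten formula
  are orthogonal to the \<open>n m\<close>.\<close>

lemma D_inner_n:
  assumes x: "x \<in> W"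
  shows "D i (\<lambda>y. n l y \<bullet> n m y) x = nab i (n l) x \<bullet> n m x + n l x \<bullet> nab i (n m) x"
proof -
  have D: "D i (n l) x = nab i (n l) x - (\<Sum>k\<in>UNIV. (n l x \<bullet> h i k x) *\<^sub>R E k x)" for l
    by (rule D_normal[OF x smooth_h]) (rule h_E)
  have "(\<Sum>k\<in>UNIV. c k *\<^sub>R E k x) \<bullet> n m x = 0" "n m x \<bullet> (\<Sum>k\<in>UNIV. c k *\<^sub>R E k x) = 0" for c m
    using h_E[OF x] by (simp_all add: inner_sum_left inner_sum_right inner_commute)
  then have "D i (n l) x \<bullet> n m x = nab i (n l) x \<bullet> n m x" "n l x \<bullet> D i (n m) x = n l x \<bullet> nab i (n m) x"
    unfolding D by (simp_all add: inner_diff_left inner_diff_right)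
  then show ?thesis
    using dird_inner[OF open_W x smooth_h smooth_h] by (simp add: add.commute)
qed

text \<open>For \<mu> = 0 the relation behind \<open>gauss_middle\<close> is missing. Instead,
  \<open>gauss_null\<close> says that \<open>n a\<close> and \<open>n c\<close> are orthogonal and
  of equal length throughout \<open>W\<close>. Differentiating this, and then the orthogonality of
  \<open>n b\<close> to both, found on the way, supplies the missing equations.\<close>

lemma unit_null_imp_False:
  assumes "W \<noteq> {}" "\<mu> = 0"
  shows False
proof -
  have k1: "k = 1"
    using k_eq assms(2) by simp
  have K4: "proper_unit_frame.K 1 = 4"
    using K_def unfolding k1 by simp
  have Gac: "nab i (n a) x \<bullet> n c x + n a x \<bullet> nab i (n c) x = 0"
    and Gaa: "nab i (n a) x \<bullet> n a x = n c x \<bullet> nab i (n c) x" if x: "x \<in> W" for x i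
  proof -
    have "D i (\<lambda>y. n a y \<bullet> n c y) x = 0"
      by (rule D_eq_0[OF x]) (rule gauss_null(1))
    then show "nab i (n a) x \<bullet> n c x + n a x \<bullet> nab i (n c) x = 0"
      by (simp add: D_inner_n[OF x])
    have "D i (\<lambda>y. n a y \<bullet> n a y) x = D i (\<lambda>y. n c y \<bullet> n c y) x"
      by (rule dird_cong[OF open_W x]) (simp add: gauss_null(2) assms(2))
    then show "nab i (n a) x \<bullet> n a x = n c x \<bullet> nab i (n c) x"
      by (simp add: D_inner_n[OF x] inner_commute)
  qed
  \<comment> \<open>The derivatives along \<open>E a\<close> form a linear system for
    \<open>n b \<bullet> n c\<close> and \<open>n a \<bullet> n b\<close> with determinant
    \<open>(Y a c x)\<^sup>2 + (Y c c x)\<^sup>2\<close> up to sign; if that is nonzero, the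
    derivatives along \<open>E 1\<close> give a contradiction.\<close>
  have flat: "Y a c x = 0 \<and> Y c c x = 0 \<and> n a x \<bullet> n b x = 0 \<and> n b x \<bullet> n c x = 0" if x: "x \<in> W" for x
  proof -
    have pos: "0 < n a x \<bullet> n a x"
      using n_nonzero[OF x, of a] abc by simp
    note g = gauss_null[OF x, unfolded assms(2)]
    note inn = nab_n_a[OF x] nab_n_c[OF x] inner_add_left inner_add_right inner_commute
      assms(2) k1 g
    have 1: "Y a c x * (n b x \<bullet> n c x) + Y c c x * (n a x \<bullet> n b x) = 0"
      using Gac[OF x, of a] by (simp add: inn algebra_simps Y_table[OF x])
    have 2: "Y c c x * (n b x \<bullet> n c x) = Y a c x * (n a x \<bullet> n b x)"
      using Gaa[OF x, of a] by (simp add: inn algebra_simps Y_table[OF x])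
    have qr: "Y a c x = 0 \<and> Y c c x = 0"
    proof (rule ccontr)
      assume "\<not> ?thesis"
      then have ne: "Y a c x * Y a c x + Y c c x * Y c c x \<noteq> 0"
        by (simp add: sum_squares_eq_zero_iff)
      have "(Y a c x * Y a c x + Y c c x * Y c c x) * (n b x \<bullet> n c x) = 0"
        "(Y a c x * Y a c x + Y c c x * Y c c x) * (n a x \<bullet> n b x) = 0"
        using 1 2 by algebra+
      then have z: "n b x \<bullet> n c x = 0" "n a x \<bullet> n b x = 0"
        using ne by (metis mult_eq_0_iff)+
      have "Y a c x * (n c x \<bullet> n c x) = 0"
        using Gac[OF x, of 1] by (simp add: inn algebra_simps z)
      moreover have "Y c c x * (n c x \<bullet> n c x) = 0"
        using Gaa[OF x, of 1] by (simp add: inn algebra_simps z)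
      ultimately show False
        using ne pos g by auto
    qed
    then show ?thesis
      using ricci_a_c[OF x] by (auto simp: K4 k1 assms(2))
  qed
  obtain x where x: "x \<in> W"
    using assms(1) by blast
  note F = flat[OF x]
  have pos: "0 < n a x \<bullet> n a x" "0 < n b x \<bullet> n b x"
    using n_nonzero[OF x] abc by auto
  note g = gauss_null[OF x, unfolded assms(2)]
  have pw: "Y b c y * Y b c y + Y 1 c y * Y 1 c y \<noteq> 0" if y: "y \<in> W" for y
  proof
    assume "Y b c y * Y b c y + Y 1 c y * Y 1 c y = 0"
    then have "Y b c y = 0" "Y 1 c y = 0"
      by (auto simp: sum_squares_eq_zero_iff)
    then have "- (4 * (n a y \<bullet> n a y)) = n b y \<bullet> n b y"
      using ricci_1_a(2)[OF y] flat[OF y] by (simp add: K4 k1 assms(2))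
    moreover have "0 < n a y \<bullet> n a y" "0 < n b y \<bullet> n b y"
      using n_nonzero[OF y] abc by auto
    ultimately show False
      by linarith
  qed
  have t: "Y 1 b y = 0 \<and> Y b b y = 0" if y: "y \<in> W" for y
  proof -
    have "Y 1 b y * Y 1 c y + Y b b y * Y b c y = 0" "Y 1 b y * Y b c y - Y b b y * Y 1 c y = 0"
      using ricci_1_b[OF y] flat[OF y] by (simp_all add: K4 k1 assms(2))
    then have "(Y b c y * Y b c y + Y 1 c y * Y 1 c y) * Y 1 b y = 0"
      "(Y b c y * Y b c y + Y 1 c y * Y 1 c y) * Y b b y = 0"
      by algebra+
    then show ?thesis
      using pw[OF y] by (metis mult_eq_0_iff)
  qed
  define Ga Gb P w t1 t3 where "Ga = n a x \<bullet> n a x" and "Gb = n b x \<bullet> n b x" and "P = Y b c x"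
    and "w = Y 1 c x" and "t1 = Y a b x" and "t3 = Y c b x"
  have R3: "8 * (t1 * w - t3 * P + w * w + P * P) = 4 * Ga + Gb"
    using ricci_1_a(2)[OF x] F t[OF x]
    by (simp add: K4 k1 assms(2) Ga_def Gb_def P_def w_def t1_def t3_def algebra_simps)
  have G: "2 * (w * t1 - P * t3) - 2 * (w * w + P * P) + Gb = 0"
  proof -
    have "D i (Y 1 b) x = 0" "D i (Y b b) x = 0" for i
      using D_eq_0[OF x] t by blast+
    then show ?thesis
      using gauss[OF x, of 1 b 1 b] t[OF x] F unfolding sum_4_distinct[OF abc]
      by (simp add: G_diag[OF x] G_table[OF x] Y_table[OF x] h_table[OF x] k1 Gb_def P_def w_def
          t1_def t3_def algebra_simps)
  qed
  have d1: "(w + 2 * t1) * Gb = 4 * w * Ga"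
  proof -
    have "D 1 (\<lambda>y. n a y \<bullet> n b y) x = 0"
      by (rule D_eq_0[OF x]) (simp add: flat)
    then show ?thesis
      using F g by (simp add: D_inner_n[OF x] nab_n_a[OF x] nab_n_b[OF x] inner_add_left inner_diff_left
          inner_add_right inner_diff_right inner_commute K4 k1 assms(2) Ga_def Gb_def w_def t1_def algebra_simps)
  qed
  have d2: "(P - 2 * t3) * Gb = 4 * P * Ga"
  proof -
    have "D 1 (\<lambda>y. n b y \<bullet> n c y) x = 0"
      by (rule D_eq_0[OF x]) (simp add: flat)
    then show ?thesis
      using F g by (simp add: D_inner_n[OF x] nab_n_c[OF x] nab_n_b[OF x] inner_add_left inner_diff_left
          inner_add_right inner_diff_right inner_commute K4 k1 assms(2) Ga_def Gb_def P_def t3_def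
          om_table[OF x, unfolded k1] algebra_simps)
  qed
  \<comment> \<open>\<open>d1\<close> times \<open>w\<close> plus \<open>d2\<close> times
    \<open>P\<close> relates \<open>t1 * w - t3 * P\<close> to \<open>w * w + P * P\<close>; by
    \<open>R3\<close> and \<open>G\<close> both can then be eliminated.\<close>
  have "(Gb + 4 * Ga)\<^sup>2 = 0"
    using R3 G d1 d2 by algebra
  then show False
    using pos by (simp add: Ga_def Gb_def)
qed

end

lemma (in type_C_frame) unit_imp_False:
  assumes "W \<noteq> {}" and abc: "distinct [1, a, b, c]"
    and l: "lam a = 1" "lam b = \<mu>" "lam c = - 1" and mu: "0 \<le> \<mu>"
  shows False
proof (cases "\<mu> = 1")
  case True
  then show False
    using unit_one_imp_False[OF assms(1) abc] l by simp
next
  case False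
  interpret proper_unit_frame W g e lam a b c \<mu> "(1 + \<mu>) / (1 - \<mu>)"
    by unfold_locales (use abc l mu False in auto)
  show False
    using unit_positive_imp_False unit_null_imp_False assms(1) mu by fastforce
qed

text \<open>If some parameter is nonzero, the constraint and the sign conditions make
  \<open>lam 2\<close> positive and \<open>lam 4\<close> negative. By \<open>fac\<close>, parameters
  of modulus 1 occur only in the pattern 1, \<mu>, -1; a vanishing \<open>lam 3\<close> forces
  \<open>lam 4 = - lam 2\<close>; everything else is generic.\<close>

lemma (in type_C_frame) lam_eq_0:
  assumes "W \<noteq> {}" and par: "type_C_params (lam 2) (lam 3) (lam 4)"
  shows "lam a = 0 \<or> a = 1"
proof (rule ccontr)
  assume a: "\<not> (lam a = 0 \<or> a = 1)"
  have ord: "lam 3 \<le> lam 2" "0 \<le> lam 3" "lam 4 \<le> 0"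
    and con: "lam 2 * lam 3 * lam 4 + lam 2 + lam 3 + lam 4 = 0"
    using par by (auto simp: type_C_params_def)
  have con': "lam 4 * (1 + lam 2 * lam 3) = - (lam 2 + lam 3)"
    using con by (simp add: algebra_simps)
  have pos: "0 < 1 + lam 2 * lam 3"
    using ord by (simp add: add_pos_nonneg)
  have "lam 2 \<noteq> 0"
    using a ord con' exhaust_4[of a] by auto
  then have l2: "0 < lam 2"
    using ord by auto
  then have "lam 4 \<noteq> 0"
    using con' ord by auto
  then have l4: "lam 4 < 0"
    using ord by simp
  have m4: "(lam 4)\<^sup>2 = 1 \<longleftrightarrow> lam 4 = - 1"
    using l4 by (auto simp: power2_eq_1_iff)
  have fac: "(lam 4 + 1) * (1 + lam 2 * lam 3) = (1 - lam 2) * (1 - lam 3)"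
    using con' by algebra
  have m2: "lam 4 = - 1" if "lam 2 = 1 \<or> lam 3 = 1"
  proof -
    have "(lam 4 + 1) * (1 + lam 2 * lam 3) = 0"
      using fac that by auto
    then show ?thesis
      using pos by auto
  qed
  show False
  proof (cases "lam 4 = - 1")
    case True
    then have "(1 - lam 2) * (1 - lam 3) = 0"
      using fac by simp
    then consider "lam 2 = 1" | "lam 3 = 1"
      by auto
    then show False
    proof cases
      case 1
      then show False
        using unit_imp_False[OF assms(1), of 2 3 4 "lam 3"] True ord by auto
    next
      case 2
      then show False
        using unit_imp_False[OF assms(1), of 3 2 4 "lam 2"] True ord by auto
    qed
  next
    case False
    show False
    proof (cases "lam 3 = 0")
      case True
      then show False
        using null_middle_imp_False[OF assms(1), of 2 3 4 "lam 2"] con' \<open>lam 4 \<noteq> - 1\<close> l2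
        by (auto simp: power2_eq_1_iff)
    next
      case l3: False
      have "lam a \<noteq> 0 \<and> (lam a)\<^sup>2 \<noteq> 1" if "a \<noteq> 1" for a
        using that exhaust_4[of a] l2 l4 l3 ord m4 m2 False by (auto simp: power2_eq_1_iff)
      then show False
        using generic_imp_False[OF assms(1) con] by blast
    qed
  qed
qed

section \<open>Frames adapted to a submanifold of type C\<close>

context moving_frame
begin

lemma normal_part_eq_nproj:
  assumes x: "x \<in> W"
  shows "normal_part (tangent_space g x) w = nproj x w"
proof -
  have lin: "linear (frechet_derivative g (at x))"
    by (rule has_derivative_linear[OF smooth_on_has_derivative[OF smooth_g open_W x]])
  have ET: "E l x \<in> tangent_space g x" for l
    by (simp add: dird_def tangent_space_def)
  have sub: "subspace (tangent_space g x)"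
    unfolding tangent_space_def by (rule linear_subspace_image[OF lin subspace_UNIV])
  have "nproj x w \<bullet> t = 0" if t: "t \<in> tangent_space g x" for t
  proof -
    obtain v where v: "t = frechet_derivative g (at x) v"
      using t unfolding tangent_space_def by blast
    define c where "c l = frechet_derivative g (at x) v \<bullet> E l x" for l
    have "v = (\<Sum>l\<in>UNIV. c l *\<^sub>R e l x)"
      unfolding c_def by (rule frame_expand[OF x])
    then have "t = (\<Sum>l\<in>UNIV. c l *\<^sub>R E l x)"
      unfolding v by (simp add: linear_sum[OF lin] linear_scale[OF lin] dird_def)
    then show ?thesis
      by (simp add: inner_sum_right nproj_inner_E[OF x])
  qed
  then have "nproj x w \<in> (tangent_space g x)\<^sup>\<bottom>"
    by (auto simp: orthogonal_comp_def orthogonal_def inner_commute)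
  moreover have "w - nproj x w \<in> tangent_space g x"
    unfolding nproj_def using sub ET by (auto intro!: subspace_sum subspace_scale)
  ultimately show ?thesis
    unfolding normal_part_def using normal_part_unique[OF sub, of w] by (intro the1_equality) auto
qed

text \<open>The definition extends the second vector with constant coordinates, whereas
  \<open>h\<close> extends it along the frame. By \<open>dird_dird\<close> the two derivatives
  differ by a tangent vector, which the normal projection kills.\<close>

lemma second_fundamental_form_frame:
  assumes x: "x \<in> W"
  shows "second_fundamental_form g x (e i x) (e j x) = h i j x"
proof -
  have "D i (E j) x = frechet_derivative (\<lambda>y. frechet_derivative g (at y) (e j x)) (at x) (e i x)
      + frechet_derivative g (at x) (D i (e j) x)"
    by (rule dird_dird[OF open_W x smooth_g smooth_e smooth_e])
  moreover have "nproj x (frechet_derivative g (at x) v) = 0" for v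
  proof -
    have lin: "linear (frechet_derivative g (at x))"
      by (rule has_derivative_linear[OF smooth_on_has_derivative[OF smooth_g open_W x]])
    define c where "c l = frechet_derivative g (at x) v \<bullet> E l x" for l
    have "v = (\<Sum>l\<in>UNIV. c l *\<^sub>R e l x)"
      unfolding c_def by (rule frame_expand[OF x])
    then have "frechet_derivative g (at x) v = (\<Sum>l\<in>UNIV. c l *\<^sub>R E l x)"
      by (simp add: linear_sum[OF lin] linear_scale[OF lin] dird_def)
    then show ?thesis
      by (simp add: nproj_sum nproj_scaleR nproj_E[OF x])
  qed
  ultimately show ?thesis
    by (simp add: second_fundamental_form_def normal_part_eq_nproj[OF x] h_def nab_def nproj_add)
qed

text \<open>Linearity in the direction of the inner derivative is not immediate from the definition;
  the symmetry of second derivatives moves that direction to the outer slot.\<close>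

lemma second_fundamental_form_expand:
  assumes x: "x \<in> W"
  shows "second_fundamental_form g x u v \<in> span (range (\<lambda>(i, j). h i j x))"
proof -
  let ?H = "\<lambda>v. frechet_derivative (\<lambda>y. frechet_derivative g (at y) v) (at x)"
  have linH: "linear (?H v)" for v
    by (rule has_derivative_linear[OF smooth_on_has_derivative[OF smooth_on_frechet_derivative
          [OF smooth_g] open_W x]])
  have sym: "?H v u = ?H u v" for u v
    by (rule second_derivative_symmetric[OF open_W x smooth_g])
  define c where "c l = frechet_derivative g (at x) u \<bullet> E l x" for l
  have u: "u = (\<Sum>l\<in>UNIV. c l *\<^sub>R e l x)"
    unfolding c_def by (rule frame_expand[OF x])
  define d where "d l = frechet_derivative g (at x) v \<bullet> E l x" for l
  have v: "v = (\<Sum>l\<in>UNIV. d l *\<^sub>R e l x)"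
    unfolding d_def by (rule frame_expand[OF x])
  have "?H v u = (\<Sum>i\<in>UNIV. c i *\<^sub>R ?H v (e i x))"
    by (subst u) (simp add: linear_sum[OF linH] linear_scale[OF linH])
  also have "\<dots> = (\<Sum>i\<in>UNIV. c i *\<^sub>R (\<Sum>j\<in>UNIV. d j *\<^sub>R ?H (e j x) (e i x)))"
  proof (rule sum.cong[OF refl])
    fix i
    have "?H v (e i x) = ?H (e i x) v"
      by (rule sym)
    also have "\<dots> = (\<Sum>j\<in>UNIV. d j *\<^sub>R ?H (e i x) (e j x))"
      by (subst v) (simp add: linear_sum[OF linH] linear_scale[OF linH])
    finally show "c i *\<^sub>R ?H v (e i x) = c i *\<^sub>R (\<Sum>j\<in>UNIV. d j *\<^sub>R ?H (e j x) (e i x))"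
      by (simp add: sym)
  qed
  finally have "second_fundamental_form g x u v
      = (\<Sum>i\<in>UNIV. c i *\<^sub>R (\<Sum>j\<in>UNIV. d j *\<^sub>R nproj x (?H (e j x) (e i x))))"
    by (simp add: second_fundamental_form_def normal_part_eq_nproj[OF x] nproj_sum nproj_scaleR)
  also have "\<dots> = (\<Sum>i\<in>UNIV. c i *\<^sub>R (\<Sum>j\<in>UNIV. d j *\<^sub>R h i j x))"
    by (simp add: second_fundamental_form_frame[OF x, symmetric] second_fundamental_form_def
        normal_part_eq_nproj[OF x])
  also have "\<dots> \<in> span (range (\<lambda>(i, j). h i j x))"
    by (intro span_sum span_scale span_base) (auto intro!: range_eqI[of _ _ "(_, _)"])
  finally show ?thesis .
qed

end

lemma dim_3_imp_independent:
  fixes u v w :: "'b::euclidean_space"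
  assumes "3 \<le> dim {u, v, w}" "p *\<^sub>R u + q *\<^sub>R v + r *\<^sub>R w = 0"
  shows "p = 0 \<and> q = 0 \<and> r = 0"
proof -
  have key: "p = 0" if "3 \<le> dim {u, v, w}" "p *\<^sub>R u + q *\<^sub>R v + r *\<^sub>R w = 0" for u v w :: 'b and p q r
  proof (rule ccontr)
    assume "p \<noteq> 0"
    then have "u = (1 / p) *\<^sub>R (p *\<^sub>R u)"
      by simp
    also have "p *\<^sub>R u = - (q *\<^sub>R v + r *\<^sub>R w)"
      using that(2) by (metis add.assoc eq_neg_iff_add_eq_0)
    also have "(1 / p) *\<^sub>R - (q *\<^sub>R v + r *\<^sub>R w) \<in> span {v, w}"
      by (intro span_scale span_neg span_add span_base) auto
    finally have "u \<in> span {v, w}" .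
    then have "dim {u, v, w} = dim {v, w}"
      by (metis dim_span span_redundant)
    also have "\<dots> \<le> card {v, w}"
      by (rule dim_le_card') simp
    also have "\<dots> \<le> 2"
      by (simp add: card_insert_if)
    finally show False
      using that(1) by simp
  qed
  have "{v, u, w} = {u, v, w}" "{w, u, v} = {u, v, w}"
    by auto
  then have 3: "3 \<le> dim {v, u, w}" "3 \<le> dim {w, u, v}"
    using assms(1) by metis+
  have e: "q *\<^sub>R v + p *\<^sub>R u + r *\<^sub>R w = p *\<^sub>R u + q *\<^sub>R v + r *\<^sub>R w"
    "r *\<^sub>R w + p *\<^sub>R u + q *\<^sub>R v = p *\<^sub>R u + q *\<^sub>R v + r *\<^sub>R w"
    by (simp_all add: add.commute add.left_commute)
  show ?thesis
    using key[OF assms] key[OF 3(1) e(1)[THEN trans, OF assms(2)]]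
      key[OF 3(2) e(2)[THEN trans, OF assms(2)]] by (intro conjI)
qed

lemma vector_4:
  "(vector [w, x, y, z] :: ('a::zero) ^ 4) $ 1 = w" "(vector [w, x, y, z] :: ('a::zero) ^ 4) $ 2 = x"
  "(vector [w, x, y, z] :: ('a::zero) ^ 4) $ 3 = y" "(vector [w, x, y, z] :: ('a::zero) ^ 4) $ 4 = z"
  by (simp_all add: vector_def)

text \<open>Membership in \<open>Q_C\<close> gives scalar identities for
  \<open>\<nu> \<bullet> h i j x\<close> with normal \<nu>. Taking for \<nu> the very vector that is
  to vanish, \<open>h i i x\<close> or the difference of the two sides of the off-diagonal identity,
  both normal, turns them into vector identities. The first normal space is then spanned by
  \<open>h 1 2 x\<close>, \<open>h 1 3 x\<close>, \<open>h 1 4 x\<close>, which are independent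
  because its dimension is 3.\<close>

lemma type_C_frame_exists:
  fixes f :: "'a \<Rightarrow> real ^ 'n"
  assumes imm: "immersed_submanifold M A f" and C: "type_C M A f l1 l2 l3"
    and dim: "first_normal_dim A f 3"
    and const: "\<And>p. p \<in> topspace M \<Longrightarrow> l1 p = m1 \<and> l2 p = m2 \<and> l3 p = m3"
    and p: "p \<in> topspace M"
  obtains V \<phi> W e where "(V, \<phi>) \<in> A" "W \<subseteq> V" "p \<in> \<phi> ` W"
    "type_C_frame W (f \<circ> \<phi>) e (\<lambda>i. if i = 2 then m1 else if i = 3 then m2 else m3)"
proof -
  have "\<exists>(V, \<phi>)\<in>A. \<exists>W (e :: 4 \<Rightarrow> real ^ 4 \<Rightarrow> real ^ 4).
        open W \<and> W \<subseteq> V \<and> p \<in> \<phi> ` W \<and> (\<forall>i. smooth_on (e i) W) \<and>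
        (\<forall>x\<in>W.
           (\<forall>i j. induced_metric (f \<circ> \<phi>) x (e i x) (e j x) = (if i = j then 1 else 0)) \<and>
           (\<forall>b\<in>second_form_system (f \<circ> \<phi>) x.
              (\<chi> i j. b (e i x) (e j x)) \<in> Q_C (l1 (\<phi> x)) (l2 (\<phi> x)) (l3 (\<phi> x))))"
    using C[unfolded type_C_def, THEN conjunct2] p by (rule bspec)
  then obtain V \<phi> and W and e :: "4 \<Rightarrow> real ^ 4 \<Rightarrow> real ^ 4" where
    V: "(V, \<phi>) \<in> A" and W: "open W" "W \<subseteq> V" "p \<in> \<phi> ` W" and e: "\<forall>i. smooth_on (e i) W"
    and eQ: "\<forall>x\<in>W.
           (\<forall>i j. induced_metric (f \<circ> \<phi>) x (e i x) (e j x) = (if i = j then 1 else 0)) \<and>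
           (\<forall>b\<in>second_form_system (f \<circ> \<phi>) x.
              (\<chi> i j. b (e i x) (e j x)) \<in> Q_C (l1 (\<phi> x)) (l2 (\<phi> x)) (l3 (\<phi> x)))"
    by (elim bexE case_prodE exE conjE) (hypsubst, rule that, assumption+)
  note orth = eQ[THEN bspec, THEN conjunct1, rule_format]
    and Q = eQ[THEN bspec, THEN conjunct2, THEN bspec]
  let ?g = "f \<circ> \<phi>"
  let ?lam = "\<lambda>i::4. if i = 2 then m1 else if i = 3 then m2 else m3"
  have "\<phi> x \<in> topspace M" if "x \<in> W" for x
  proof -
    have "(\<Union>(V, \<phi>)\<in>A. \<phi> ` V) = topspace M"
      using imm by (simp add: immersed_submanifold_def smooth_manifold_def)
    then show ?thesis
      using V W that by blast
  qed
  then have const': "l1 (\<phi> x) = m1" "l2 (\<phi> x) = m2" "l3 (\<phi> x) = m3" if "x \<in> W" for x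
    using const that by auto
  have "smooth_on ?g V"
    using imm[unfolded immersed_submanifold_def, THEN conjunct2, THEN bspec, OF V] by simp
  then have "smooth_on ?g W"
    using smooth_on_subset W(2) by blast
  then interpret moving_frame W ?g e
    by unfold_locales (use W e orth in \<open>auto simp: induced_metric_def dird_def\<close>)
  have mat: "\<exists>x1 x2 x3. \<forall>i j. \<nu> \<bullet> h i j x = (vector [vector [0, x1, x2, x3],
              vector [x1, 0, m3 * x3, m2 * x2],
              vector [x2, m3 * x3, 0, m1 * x1],
              vector [x3, m2 * x2, m1 * x1, 0]] :: real ^ 4 ^ 4) $ i $ j"
    if x: "x \<in> W" and \<nu>: "\<nu> \<in> normal_space ?g x" for x \<nu>
  proof -
    have "(\<lambda>u v. \<nu> \<bullet> second_fundamental_form ?g x u v) \<in> second_form_system ?g x"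
      using \<nu> unfolding second_form_system_def by blast
    from Q[OF x this] obtain x1 x2 x3 where eq:
      "(\<chi> i j. \<nu> \<bullet> h i j x) = (vector [vector [0, x1, x2, x3],
              vector [x1, 0, m3 * x3, m2 * x2],
              vector [x2, m3 * x3, 0, m1 * x1],
              vector [x3, m2 * x2, m1 * x1, 0]] :: real ^ 4 ^ 4)"
      unfolding Q_C_def const'[OF x] second_fundamental_form_frame[OF x] by blast
    have "\<nu> \<bullet> h i j x = (vector [vector [0, x1, x2, x3],
              vector [x1, 0, m3 * x3, m2 * x2],
              vector [x2, m3 * x3, 0, m1 * x1],
              vector [x3, m2 * x2, m1 * x1, 0]] :: real ^ 4 ^ 4) $ i $ j" for i j
      using arg_cong[OF eq, of "\<lambda>m. m $ i $ j"] by (simp only: vec_lambda_beta)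
    then show ?thesis
      by blast
  qed
  have mat_diag: "\<nu> \<bullet> h i i x = 0"
    and mat_off: "\<nu> \<bullet> h 2 3 x = m3 * (\<nu> \<bullet> h 1 4 x)" "\<nu> \<bullet> h 3 2 x = m3 * (\<nu> \<bullet> h 1 4 x)"
      "\<nu> \<bullet> h 2 4 x = m2 * (\<nu> \<bullet> h 1 3 x)" "\<nu> \<bullet> h 4 2 x = m2 * (\<nu> \<bullet> h 1 3 x)"
      "\<nu> \<bullet> h 3 4 x = m1 * (\<nu> \<bullet> h 1 2 x)" "\<nu> \<bullet> h 4 3 x = m1 * (\<nu> \<bullet> h 1 2 x)"
    if x: "x \<in> W" and \<nu>: "\<nu> \<in> normal_space ?g x" for x \<nu> i
  proof -
    obtain x1 x2 x3 where m: "\<forall>i j. \<nu> \<bullet> h i j x = (vector [vector [0, x1, x2, x3],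
              vector [x1, 0, m3 * x3, m2 * x2],
              vector [x2, m3 * x3, 0, m1 * x1],
              vector [x3, m2 * x2, m1 * x1, 0]] :: real ^ 4 ^ 4) $ i $ j"
      using mat[OF x \<nu>] by blast
    note m = m[rule_format]
    show "\<nu> \<bullet> h i i x = 0"
      using m[of 1 1] m[of 2 2] m[of 3 3] m[of 4 4] exhaust_4[of i] by (auto simp: vector_4)
    show "\<nu> \<bullet> h 2 3 x = m3 * (\<nu> \<bullet> h 1 4 x)" "\<nu> \<bullet> h 3 2 x = m3 * (\<nu> \<bullet> h 1 4 x)"
      "\<nu> \<bullet> h 2 4 x = m2 * (\<nu> \<bullet> h 1 3 x)" "\<nu> \<bullet> h 4 2 x = m2 * (\<nu> \<bullet> h 1 3 x)"
      "\<nu> \<bullet> h 3 4 x = m1 * (\<nu> \<bullet> h 1 2 x)" "\<nu> \<bullet> h 4 3 x = m1 * (\<nu> \<bullet> h 1 2 x)"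
      using m[of 1 2] m[of 1 3] m[of 1 4] m[of 2 3] m[of 3 2] m[of 2 4] m[of 4 2] m[of 3 4] m[of 4 3]
      by (simp_all add: vector_4)
  qed
  have normal: "v \<in> normal_space ?g x" if x: "x \<in> W" and v: "\<And>k. v \<bullet> E k x = 0" for x v
  proof -
    have "v = normal_part (tangent_space ?g x) v"
      using normal_part_eq_nproj[OF x] nproj_normal[OF x v] by simp
    moreover have "subspace (tangent_space ?g x)"
      unfolding tangent_space_def
      by (rule linear_subspace_image[OF has_derivative_linear[OF smooth_on_has_derivative
            [OF smooth_g open_W x]] subspace_UNIV])
    ultimately show ?thesis
      unfolding normal_space_def normal_part_def using theI'[OF normal_part_unique, of "tangent_space ?g x" v]
      by metis
  qed
  have diag: "h i i x = 0" if x: "x \<in> W" for x i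
  proof -
    have "h i i x \<bullet> h i i x = 0"
      by (rule mat_diag[OF x normal[OF x h_E[OF x]]])
    then show ?thesis
      by simp
  qed
  have off: "h b c x = ?lam a *\<^sub>R h 1 a x" if x: "x \<in> W" and abc: "distinct [1, a, b, c]" for x a b c
  proof -
    let ?v = "h b c x - ?lam a *\<^sub>R h 1 a x"
    have "?v \<in> normal_space ?g x"
      by (rule normal[OF x]) (simp add: inner_diff_left h_E[OF x])
    from mat_off[OF x this] have "?v \<bullet> h b c x = ?lam a * (?v \<bullet> h 1 a x)"
      using abc exhaust_4[of a] exhaust_4[of b] exhaust_4[of c] by auto
    then have "?v \<bullet> ?v = 0"
      by (simp add: inner_diff_right)
    then show ?thesis
      by simp
  qed
  have ind: "p = 0 \<and> q = 0 \<and> r = 0"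
    if x: "x \<in> W" and z: "p *\<^sub>R h 1 2 x + q *\<^sub>R h 1 3 x + r *\<^sub>R h 1 4 x = 0" for x p q r
  proof (rule dim_3_imp_independent[OF _ z])
    let ?N = "{h 1 2 x, h 1 3 x, h 1 4 x}"
    have n: "h 1 a x \<in> span ?N" for a
      using diag[OF x, of 1] exhaust_4[of a] by (auto intro: span_base span_zero)
    have "h i j x \<in> span ?N" for i j
    proof -
      have off': "h i j x \<in> span ?N" if "distinct [1, a, i, j]" for a
        unfolding off[OF x that] by (rule span_scale[OF n])
      show ?thesis
        using diag[OF x, of i] n h_sym[OF x, of i 1] off'[of 2] off'[of 3] off'[of 4]
          exhaust_4[of i] exhaust_4[of j] by (auto simp: span_zero)
    qed
    then have "span (range (\<lambda>(i, j). h i j x)) \<subseteq> span ?N"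
      by (intro span_minimal) auto
    then have "first_normal_space ?g x \<subseteq> span ?N"
      unfolding first_normal_space_def using second_fundamental_form_expand[OF x]
      by (intro span_minimal) auto
    then have "dim (first_normal_space ?g x) \<le> dim (span ?N)"
      by (rule dim_subset)
    moreover have "dim (first_normal_space ?g x) = 3"
      using dim[unfolded first_normal_dim_def, THEN bspec, OF V] W(2) x by auto
    ultimately show "3 \<le> dim ?N"
      by simp
  qed
  have "type_C_frame W ?g e ?lam"
    by unfold_locales (use diag off ind in auto)
  then show ?thesis
    using that V W by blast
qed

section \<open>The flat case\<close>

locale flat_frame = type_C_frame W g e lam
  for W :: "(real ^ 4) set" and g :: "real ^ 4 \<Rightarrow> 'b::euclidean_space"
    and e :: "4 \<Rightarrow> real ^ 4 \<Rightarrow> real ^ 4" and lam :: "4 \<Rightarrow> real" +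
  assumes lam_0: "a \<noteq> 1 \<Longrightarrow> lam a = 0"
begin

lemmas sum4 = sum_4_distinct[of 2 3 4, simplified]

text \<open>For \<open>a \<noteq> 1\<close> this is the component of \<open>D 1 (E a)\<close>
  orthogonal to \<open>E 2\<close>, \<open>E 3\<close>, \<open>E 4\<close>.\<close>

definition Wv :: "4 \<Rightarrow> real ^ 4 \<Rightarrow> 'b" where
  "Wv a x = n a x - Y 1 a x *\<^sub>R E 1 x"

text \<open>
  On a helicoid \<open>E 1\<close> is proportional to a Killing field \<open>y \<mapsto> J y + u\<close>; \<open>Kf\<close> is the skew map that \<open>J\<close> must
  be proportional to, since \<open>Wv c\<close> is the derivative of \<open>E 1\<close> along \<open>E c\<close> up to a multiple of \<open>E 1\<close>.
\<close>

definition Kf :: "'b \<Rightarrow> real ^ 4 \<Rightarrow> 'b" where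
  "Kf y x = ((E 2 x \<bullet> y) *\<^sub>R Wv 2 x - (Wv 2 x \<bullet> y) *\<^sub>R E 2 x)
    + ((E 3 x \<bullet> y) *\<^sub>R Wv 3 x - (Wv 3 x \<bullet> y) *\<^sub>R E 3 x)
    + ((E 4 x \<bullet> y) *\<^sub>R Wv 4 x - (Wv 4 x \<bullet> y) *\<^sub>R E 4 x)"

text \<open>The coefficient of \<open>E 1\<close> when \<open>D 1 (Wv a)\<close> is expanded in the
  \<open>Wv\<close> and the frame. \<open>D_1_Kf\<close> shows that these functions are the only
  obstruction to \<open>Kf\<close> being constant along \<open>E 1\<close>.\<close>

definition rho :: "4 \<Rightarrow> real ^ 4 \<Rightarrow> real" where
  "rho a x = G 1 a 2 x * Y 1 2 x + G 1 a 3 x * Y 1 3 x + G 1 a 4 x * Y 1 4 x - D 1 (Y 1 a) x"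

lemma smooth_E: "smooth_on (E i) W"
  by (rule smooth_D[OF smooth_g])

lemma smooth_Wv: "smooth_on (Wv a) W"
proof -
  have "Wv a = (\<lambda>x. n a x - Y 1 a x *\<^sub>R E 1 x)"
    by (simp add: fun_eq_iff Wv_def)
  then show ?thesis
    by (auto intro!: smooth_on_diff smooth_on_scaleR open_W smooth_h smooth_G smooth_E)
qed

lemma smooth_Kf: "smooth_on (Kf y) W"
proof -
  have "Kf y = (\<lambda>x. ((E 2 x \<bullet> y) *\<^sub>R Wv 2 x - (Wv 2 x \<bullet> y) *\<^sub>R E 2 x)
    + ((E 3 x \<bullet> y) *\<^sub>R Wv 3 x - (Wv 3 x \<bullet> y) *\<^sub>R E 3 x)
    + ((E 4 x \<bullet> y) *\<^sub>R Wv 4 x - (Wv 4 x \<bullet> y) *\<^sub>R E 4 x))"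
    by (simp add: fun_eq_iff Kf_def)
  then show ?thesis
    by (auto intro!: smooth_on_diff smooth_on_add smooth_on_scaleR smooth_on_inner smooth_on_const
        open_W smooth_Wv smooth_E)
qed

lemma distinct_obtain:
  fixes a :: 4
  assumes "a \<noteq> 1"
  obtains b c where "distinct [1, a, b, c]"
proof -
  have "distinct [1, 2, 3, 4 :: 4]" "distinct [1, 3, 2, 4 :: 4]" "distinct [1, 4, 2, 3 :: 4]"
    by simp_all
  then show ?thesis
    using that assms exhaust_4[of a] by metis
qed

lemma distinct_obtain2:
  fixes a b :: 4
  assumes "a \<noteq> 1" "b \<noteq> 1" "a \<noteq> b"
  obtains c where "distinct [1, a, b, c]"
proof -
  obtain c d where cd: "distinct [1, a, c, d]"
    using distinct_obtain[OF assms(1)] .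
  then have "b = c \<or> b = d"
    using index_cases[OF cd, of b] assms by auto
  then show ?thesis
    using that[of d] that[of c] cd by auto
qed

context
  fixes x assumes x: "x \<in> W"
begin

lemma Y_0:
  assumes "c \<noteq> 1"
  shows "Y c a x = 0"
proof (cases "a = 1")
  case True
  then show ?thesis
    by (simp add: G_diag[OF x])
next
  case a: False
  show ?thesis
  proof (cases "a = c")
    case True
    obtain b d where "distinct [1, b, c, d]"
      using distinct_obtain[OF assms] by (metis distinct_length_2_or_more)
    from frame_relations(3)[OF x this] this show ?thesis
      using True by (auto simp: lam_0)
  next
    case False
    then obtain d where d: "distinct [1, a, c, d]"
      using distinct_obtain2 a assms by blast
    then have "distinct [1, d, a, c]" "distinct [1, d, c, a]"
      by auto
    \<comment> \<open>With vanishing parameters this relation says that one of the two mixed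
      coefficients is twice the other; both orders together give 0.\<close>
    from frame_relations(2)[OF x this(1)] frame_relations(2)[OF x this(2)] d show ?thesis
      by (auto simp: lam_0)
  qed
qed

lemma h_0:
  assumes "a \<noteq> 1" "b \<noteq> 1"
  shows "h a b x = 0"
proof (cases "a = b")
  case True
  then show ?thesis
    by (simp add: h_diag[OF x])
next
  case False
  then obtain c where c: "distinct [1, a, b, c]"
    using distinct_obtain2 assms by blast
  then have "distinct [1, c, a, b]"
    by auto
  from h_off[OF x this] c show ?thesis
    by (auto simp: lam_0)
qed

lemma h_1: "a \<noteq> 1 \<Longrightarrow> h a 1 x = n a x"
  by (rule h_sym[OF x])

lemma G_1: "c \<noteq> 1 \<Longrightarrow> G c a 1 x = 0"
  using G_antisym[OF x, of c a 1] Y_0[of c a] by simp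

lemma G_anti: "G i 3 2 x = - G i 2 3 x" "G i 4 2 x = - G i 2 4 x" "G i 4 3 x = - G i 3 4 x"
  "G i 2 2 x = 0" "G i 3 3 x = 0" "G i 4 4 x = 0" "a \<noteq> 1 \<Longrightarrow> G i a 1 x = - Y i a x"
  by (simp_all only: G_antisym[OF x, of i 3 2] G_antisym[OF x, of i 4 2] G_antisym[OF x, of i 4 3]
      G_antisym[OF x, of i a 1] G_diag[OF x])

lemma D_c_E: "c \<noteq> 1 \<Longrightarrow> a \<noteq> 1 \<Longrightarrow> D c (E a) x = G c a 2 x *\<^sub>R E 2 x + G c a 3 x *\<^sub>R E 3 x + G c a 4 x *\<^sub>R E 4 x"
  by (simp add: D_E[OF x] sum4 G_1 h_0)

lemma D_c_E1: "c \<noteq> 1 \<Longrightarrow> D c (E 1) x = n c x"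
  by (simp add: D_E[OF x] sum4 Y_0 h_1)

lemma D_1_E1: "D 1 (E 1) x = Y 1 2 x *\<^sub>R E 2 x + Y 1 3 x *\<^sub>R E 3 x + Y 1 4 x *\<^sub>R E 4 x"
  by (simp add: D_E[OF x] sum4 G_diag[OF x] h_diag[OF x])

lemma D_1_E: "a \<noteq> 1 \<Longrightarrow> D 1 (E a) x = Wv a x + G 1 a 2 x *\<^sub>R E 2 x + G 1 a 3 x *\<^sub>R E 3 x + G 1 a 4 x *\<^sub>R E 4 x"
  by (simp add: D_E[OF x] sum4 Wv_def G_anti(7))

lemma nab_1: 
  assumes "a \<noteq> 1"
  shows "nab 1 (n a) x = G 1 a 2 x *\<^sub>R n 2 x + G 1 a 3 x *\<^sub>R n 3 x + G 1 a 4 x *\<^sub>R n 4 x"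
proof -
  have "a = 2 \<or> a = 3 \<or> a = 4"
    using exhaust_4[of a] assms by auto
  then show ?thesis
    using nab_1_n[OF x, of 3 4 2] nab_1_n[OF x, of 2 4 3] nab_1_n[OF x, of 2 3 4]
    by (auto simp: lam_0 Y_0 G_diag[OF x])
qed

lemma nab_c:
  assumes "a \<noteq> 1" "c \<noteq> 1"
  shows "nab c (n a) x = Y 1 c x *\<^sub>R n a x + Y 1 a x *\<^sub>R n c x
    + G c a 2 x *\<^sub>R n 2 x + G c a 3 x *\<^sub>R n 3 x + G c a 4 x *\<^sub>R n 4 x"
proof -
  have "a = 2 \<or> a = 3 \<or> a = 4" "c = 2 \<or> c = 3 \<or> c = 4"
    using exhaust_4[of a] exhaust_4[of c] assms by auto
  then show ?thesis
    using nab_a_n_a[OF x, of 2 3 4] nab_a_n_a[OF x, of 3 2 4] nab_a_n_a[OF x, of 4 2 3]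
      nab_b_n_a[OF x, of 2 3 4] nab_b_n_a[OF x, of 2 4 3] nab_b_n_a[OF x, of 3 2 4]
      nab_b_n_a[OF x, of 3 4 2] nab_b_n_a[OF x, of 4 2 3] nab_b_n_a[OF x, of 4 3 2]
    by (auto simp: lam_0 Y_0 G_diag[OF x] scaleR_double algebra_simps)
qed

lemma D_n: "D i (n a) x = nab i (n a) x - (n a x \<bullet> h i 1 x) *\<^sub>R E 1 x - (n a x \<bullet> h i 2 x) *\<^sub>R E 2 x
    - (n a x \<bullet> h i 3 x) *\<^sub>R E 3 x - (n a x \<bullet> h i 4 x) *\<^sub>R E 4 x"
  using D_normal[OF x smooth_h h_E, of i 1 a] by (simp add: sum4 diff_diff_eq)

lemma n_E: "n a x \<bullet> E k x = 0" "E k x \<bullet> n a x = 0"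
  using h_E[OF x] by (simp_all add: inner_commute)

text \<open>\<open>Y c a\<close> vanishes on \<open>W\<close> for \<open>c \<noteq> 1\<close>, so of
  the two derivatives in the Gauss equation only this one survives.\<close>

lemma D_c_Y:
  assumes "a \<noteq> 1" "c \<noteq> 1"
  shows "D c (Y 1 a) x = Y 1 c x * Y 1 a x - n a x \<bullet> n c x
    + G c a 2 x * Y 1 2 x + G c a 3 x * Y 1 3 x + G c a 4 x * Y 1 4 x"
proof -
  have "D 1 (Y c a) x = 0"
    by (rule D_eq_0[OF x]) (rule flat_frame.Y_0[OF flat_frame_axioms _ assms(2)])
  then show ?thesis
    using gauss[OF x, of c 1 1 a]
    by (simp add: sum4 Y_0 assms h_0 h_1 G_diag[OF x] h_diag[OF x] G_anti(7) algebra_simps inner_commute)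
qed

lemma D_Wv: "D i (Wv a) x = D i (n a) x - Y 1 a x *\<^sub>R D i (E 1) x - D i (Y 1 a) x *\<^sub>R E 1 x"
proof -
  have "D i (Wv a) x = D i (\<lambda>x. n a x - Y 1 a x *\<^sub>R E 1 x) x"
    by (rule dird_cong[OF open_W x]) (rule Wv_def)
  then show ?thesis
    by (simp add: dird_diff[OF open_W x] dird_scaleR[OF open_W x] smooth_h smooth_G smooth_E
        smooth_on_scaleR[OF open_W])
qed

text \<open>Along \<open>E c\<close> the \<open>Wv a\<close> turn with the same coefficients as the
  \<open>E a\<close>, apart from a common growth rate \<open>Y 1 c\<close>; therefore
  \<open>Kf\<close> only gets rescaled along the leaves.\<close>

lemma D_c_Wv:
  assumes "a \<noteq> 1" "c \<noteq> 1"
  shows "D c (Wv a) x = Y 1 c x *\<^sub>R Wv a x + G c a 2 x *\<^sub>R Wv 2 x + G c a 3 x *\<^sub>R Wv 3 x + G c a 4 x *\<^sub>R Wv 4 x"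
  unfolding D_Wv D_n nab_c[OF assms] D_c_E1[OF assms(2)] D_c_Y[OF assms]
  by (simp add: Wv_def h_1 h_0 assms algebra_simps)

lemma D_1_Wv:
  assumes "a \<noteq> 1"
  shows "D 1 (Wv a) x = G 1 a 2 x *\<^sub>R Wv 2 x + G 1 a 3 x *\<^sub>R Wv 3 x + G 1 a 4 x *\<^sub>R Wv 4 x
    + rho a x *\<^sub>R E 1 x - (Wv a x \<bullet> Wv 2 x) *\<^sub>R E 2 x - (Wv a x \<bullet> Wv 3 x) *\<^sub>R E 3 x
    - (Wv a x \<bullet> Wv 4 x) *\<^sub>R E 4 x"
  unfolding D_Wv D_n nab_1[OF assms] D_1_E1
  by (simp add: Wv_def rho_def h_diag[OF x] inner_diff_left inner_diff_right n_E E_E[OF x] algebra_simps)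

lemma D_Kf: "D i (Kf y) x =
      ((E 2 x \<bullet> y) *\<^sub>R D i (Wv 2) x + (D i (E 2) x \<bullet> y) *\<^sub>R Wv 2 x
        - (Wv 2 x \<bullet> y) *\<^sub>R D i (E 2) x - (D i (Wv 2) x \<bullet> y) *\<^sub>R E 2 x)
    + ((E 3 x \<bullet> y) *\<^sub>R D i (Wv 3) x + (D i (E 3) x \<bullet> y) *\<^sub>R Wv 3 x
        - (Wv 3 x \<bullet> y) *\<^sub>R D i (E 3) x - (D i (Wv 3) x \<bullet> y) *\<^sub>R E 3 x)
    + ((E 4 x \<bullet> y) *\<^sub>R D i (Wv 4) x + (D i (E 4) x \<bullet> y) *\<^sub>R Wv 4 x
        - (Wv 4 x \<bullet> y) *\<^sub>R D i (E 4) x - (D i (Wv 4) x \<bullet> y) *\<^sub>R E 4 x)"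
proof -
  have 1: "smooth_on (\<lambda>x. (E a x \<bullet> y) *\<^sub>R Wv a x) W" "smooth_on (\<lambda>x. (Wv a x \<bullet> y) *\<^sub>R E a x) W"
    "smooth_on (\<lambda>x. E a x \<bullet> y) W" "smooth_on (\<lambda>x. Wv a x \<bullet> y) W" for a
    by (auto intro!: smooth_on_scaleR smooth_on_inner smooth_on_const open_W smooth_Wv smooth_E)
  have "D i (Kf y) x = D i (\<lambda>x. ((E 2 x \<bullet> y) *\<^sub>R Wv 2 x - (Wv 2 x \<bullet> y) *\<^sub>R E 2 x)
    + ((E 3 x \<bullet> y) *\<^sub>R Wv 3 x - (Wv 3 x \<bullet> y) *\<^sub>R E 3 x)
    + ((E 4 x \<bullet> y) *\<^sub>R Wv 4 x - (Wv 4 x \<bullet> y) *\<^sub>R E 4 x)) x"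
    by (rule dird_cong[OF open_W x]) (rule Kf_def)
  then show ?thesis
    by (simp add: dird_diff[OF open_W x] dird_add[OF open_W x] dird_scaleR[OF open_W x] 1 smooth_E smooth_Wv
        smooth_on_diff[OF open_W] smooth_on_add[OF open_W]
        dird_bounded_linear[OF open_W x bounded_linear_inner_left] algebra_simps)
qed

lemma D_c_Kf: "c \<noteq> 1 \<Longrightarrow> D c (Kf y) x = Y 1 c x *\<^sub>R Kf y x"
  unfolding D_Kf by (simp add: D_c_Wv D_c_E Kf_def G_anti inner_add_left algebra_simps)

lemma D_1_Kf: "D 1 (Kf y) x =
    (rho 2 x * (E 2 x \<bullet> y) + rho 3 x * (E 3 x \<bullet> y) + rho 4 x * (E 4 x \<bullet> y)) *\<^sub>R E 1 x
    - (E 1 x \<bullet> y) *\<^sub>R (rho 2 x *\<^sub>R E 2 x + rho 3 x *\<^sub>R E 3 x + rho 4 x *\<^sub>R E 4 x)"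
  unfolding D_Kf
  by (simp add: D_1_Wv D_1_E G_anti inner_add_left inner_diff_left algebra_simps inner_commute)

end

lemma smooth_rho: "smooth_on (rho a) W"
proof -
  have "rho a = (\<lambda>x. G 1 a 2 x * Y 1 2 x + G 1 a 3 x * Y 1 3 x + G 1 a 4 x * Y 1 4 x - D 1 (Y 1 a) x)"
    by (simp add: fun_eq_iff rho_def)
  then show ?thesis
    by (auto intro!: smooth_on_diff smooth_on_add smooth_on_mult open_W smooth_G smooth_D)
qed

text \<open>\<open>D c (D 1 (Kf y))\<close> is computed twice, from the formula for
  \<open>D 1 (Kf y)\<close> and through the commutator. Paired with \<open>n c\<close> the results
  are \<open>rho c\<close> and \<open>- rho c\<close> times the squared norm of \<open>n c\<close>.
  The vector \<open>y\<close> is frozen at \<open>E c x\<close>, so that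
  \<open>E 1 \<bullet> y\<close> vanishes at \<open>x\<close> and \<open>Kf y x\<close> is
  \<open>Wv c x\<close>.\<close>

lemma rho_0:
  assumes x: "x \<in> W" and c: "c \<noteq> 1"
  shows "rho c x = 0"
proof -
  define y where "y = E c x"
  define r where "r = (\<lambda>z. rho 2 z * (E 2 z \<bullet> y) + rho 3 z * (E 3 z \<bullet> y) + rho 4 z * (E 4 z \<bullet> y))"
  define v where "v = (\<lambda>z. rho 2 z *\<^sub>R E 2 z + rho 3 z *\<^sub>R E 3 z + rho 4 z *\<^sub>R E 4 z)"
  have sr: "smooth_on r W" and sv: "smooth_on v W"
    unfolding r_def v_def
    by (intro smooth_on_add smooth_on_mult smooth_on_scaleR smooth_on_inner smooth_on_const open_W
        smooth_rho smooth_E)+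
  have sy: "smooth_on (\<lambda>z. E 1 z \<bullet> y) W"
    by (intro smooth_on_inner smooth_on_const open_W smooth_E)
  have rx: "r x = rho c x"
    using exhaust_4[of c] c by (auto simp: r_def y_def E_E[OF x])
  have y1: "E 1 x \<bullet> y = 0"
    using c by (simp add: y_def E_E[OF x])
  have D1: "D 1 (Kf y) z = r z *\<^sub>R E 1 z - (E 1 z \<bullet> y) *\<^sub>R v z" if "z \<in> W" for z
    by (simp add: D_1_Kf[OF that] r_def v_def)
  have "D c (D 1 (Kf y)) x = D c (\<lambda>z. r z *\<^sub>R E 1 z - (E 1 z \<bullet> y) *\<^sub>R v z) x"
    by (rule dird_cong[OF open_W x D1])
  also have "\<dots> = r x *\<^sub>R D c (E 1) x + D c r x *\<^sub>R E 1 x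
      - ((E 1 x \<bullet> y) *\<^sub>R D c v x + D c (\<lambda>z. E 1 z \<bullet> y) x *\<^sub>R v x)"
    by (simp add: dird_diff[OF open_W x] dird_scaleR[OF open_W x] smooth_on_scaleR[OF open_W] sr sv sy smooth_E)
  finally have 1: "D c (D 1 (Kf y)) x \<bullet> n c x = rho c x * (n c x \<bullet> n c x)"
    by (simp add: y1 rx D_c_E1[OF x c] v_def inner_diff_left inner_add_left n_E[OF x])
  have 2: "D 1 (D c (Kf y)) x = Y 1 c x *\<^sub>R D 1 (Kf y) x + D 1 (Y 1 c) x *\<^sub>R Kf y x"
  proof -
    have "D 1 (D c (Kf y)) x = D 1 (\<lambda>z. Y 1 c z *\<^sub>R Kf y z) x"
      by (rule dird_cong[OF open_W x]) (rule D_c_Kf[OF _ c])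
    then show ?thesis
      by (simp add: dird_scaleR[OF open_W x] smooth_G smooth_Kf)
  qed
  have "D c (D 1 (Kf y)) x - D 1 (D c (Kf y)) x = Y 1 c x *\<^sub>R D 1 (Kf y) x
      - (G 1 c 2 x * Y 1 2 x + G 1 c 3 x * Y 1 3 x + G 1 c 4 x * Y 1 4 x) *\<^sub>R Kf y x"
    unfolding commutator[OF x smooth_Kf]
    by (simp add: sum4 D_c_Kf[OF x] Y_0[OF x c] G_1[OF x c] G_anti(7)[OF x c] algebra_simps)
  then have "D c (D 1 (Kf y)) x = (2 * Y 1 c x) *\<^sub>R D 1 (Kf y) x - rho c x *\<^sub>R Kf y x"
    unfolding 2 by (simp add: rho_def algebra_simps scaleR_double)
  moreover have "D 1 (Kf y) x \<bullet> n c x = 0"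
    using D1[OF x] by (simp add: y1 n_E[OF x] inner_diff_left)
  moreover have "Kf y x \<bullet> n c x = n c x \<bullet> n c x"
    using exhaust_4[of c] c
    by (auto simp: Kf_def y_def E_E[OF x] inner_add_left inner_diff_left n_E[OF x] Wv_def)
  ultimately have "2 * (rho c x * (n c x \<bullet> n c x)) = 0"
    using 1 by (simp add: inner_diff_left)
  then show ?thesis
    using n_nonzero[OF x c] by simp
qed

lemma D_1_Kf_0: "x \<in> W \<Longrightarrow> D 1 (Kf y) x = 0"
  by (simp add: D_1_Kf rho_0)

end

section \<open>Smoothness of sine, cosine and reciprocal\<close>

lemma C_k_on_sin_cos:
  fixes f :: "'a::real_normed_vector \<Rightarrow> real"
  assumes "open S"
  shows "C_k_on k f S \<Longrightarrow> C_k_on k (\<lambda>x. sin (f x)) S \<and> C_k_on k (\<lambda>x. cos (f x)) S"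
proof (induction k)
  case 0
  then show ?case
    by (simp add: continuous_on_sin continuous_on_cos)
next
  case (Suc k)
  note f' = C_k_on_Suc_has_derivative[OF Suc.prems assms]
  have ders: "((\<lambda>x. sin (f x)) has_derivative (\<lambda>v. cos (f x) * frechet_derivative f (at x) v)) (at x)"
    and derc: "((\<lambda>x. cos (f x)) has_derivative (\<lambda>v. (- sin (f x)) * frechet_derivative f (at x) v)) (at x)"
    if "x \<in> S" for x
    using has_derivative_sin[OF f'[OF that]] has_derivative_cos[OF f'[OF that]]
    by (simp_all add: mult.commute)
  note IH = Suc.IH[OF C_k_on_Suc_D[OF Suc.prems]] and fv = C_k_on_Suc_frechet_derivative[OF Suc.prems]
  have c: "C_k_on k (\<lambda>x. - sin (f x)) S"
    using C_k_on_bounded_linear[OF bounded_linear_minus[OF bounded_linear_ident] assms] IH by blast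
  have "C_k_on k (\<lambda>x. frechet_derivative (\<lambda>x. sin (f x)) (at x) v) S" for v
    by (rule C_k_on_cong[OF assms _ bounded_bilinear.C_k_on[OF bounded_bilinear_mult assms
            IH[THEN conjunct2] fv[where v = v]]])
       (simp add: frechet_derivative_at[OF ders, symmetric])
  moreover have "C_k_on k (\<lambda>x. frechet_derivative (\<lambda>x. cos (f x)) (at x) v) S" for v
    by (rule C_k_on_cong[OF assms _ bounded_bilinear.C_k_on[OF bounded_bilinear_mult assms c fv[where v = v]]])
       (simp add: frechet_derivative_at[OF derc, symmetric])
  moreover have "(\<lambda>x. sin (f x)) differentiable_on S" "(\<lambda>x. cos (f x)) differentiable_on S"
    using ders derc differentiable_at_imp_differentiable_on differentiable_def by blast+
  ultimately show ?case
    by simp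
qed

lemma C_k_on_inverse:
  fixes f :: "'a::real_normed_vector \<Rightarrow> real"
  assumes "open S" "\<And>x. x \<in> S \<Longrightarrow> f x \<noteq> 0"
  shows "C_k_on k f S \<Longrightarrow> C_k_on k (\<lambda>x. inverse (f x)) S"
proof (induction k)
  case 0
  then show ?case
    using assms(2) by (simp add: continuous_on_inverse)
next
  case (Suc k)
  note f' = C_k_on_Suc_has_derivative[OF Suc.prems assms(1)]
  have der: "((\<lambda>x. inverse (f x)) has_derivative
      (\<lambda>v. (- (inverse (f x) * inverse (f x))) * frechet_derivative f (at x) v)) (at x)" if "x \<in> S" for x
    using Deriv.has_derivative_inverse[OF assms(2)[OF that] f'[OF that]] by (simp add: mult.commute mult.left_commute)
  note IH = Suc.IH[OF C_k_on_Suc_D[OF Suc.prems]] and fv = C_k_on_Suc_frechet_derivative[OF Suc.prems]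
  have c: "C_k_on k (\<lambda>x. - (inverse (f x) * inverse (f x))) S"
    by (rule C_k_on_bounded_linear[OF bounded_linear_minus[OF bounded_linear_ident] assms(1)])
       (rule bounded_bilinear.C_k_on[OF bounded_bilinear_mult assms(1) IH IH])
  have "C_k_on k (\<lambda>x. frechet_derivative (\<lambda>x. inverse (f x)) (at x) v) S" for v
    by (rule C_k_on_cong[OF assms(1) _ bounded_bilinear.C_k_on[OF bounded_bilinear_mult assms(1) c fv[where v = v]]])
       (simp add: frechet_derivative_at[OF der, symmetric])
  moreover have "(\<lambda>x. inverse (f x)) differentiable_on S"
    using der differentiable_at_imp_differentiable_on differentiable_def by blast
  ultimately show ?case
    by simp
qed

lemma
  fixes f :: "'a::real_normed_vector \<Rightarrow> real"
  assumes "open S" "smooth_on f S"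
  shows smooth_on_sin: "smooth_on (\<lambda>x. sin (f x)) S" and smooth_on_cos: "smooth_on (\<lambda>x. cos (f x)) S"
    and dird_sin: "x \<in> S \<Longrightarrow> dird X (\<lambda>x. sin (f x)) x = cos (f x) * dird X f x"
    and dird_cos: "x \<in> S \<Longrightarrow> dird X (\<lambda>x. cos (f x)) x = - sin (f x) * dird X f x"
proof -
  show "smooth_on (\<lambda>x. sin (f x)) S" "smooth_on (\<lambda>x. cos (f x)) S"
    using assms C_k_on_sin_cos unfolding smooth_on_def by blast+
  assume x: "x \<in> S"
  have f: "(f has_derivative frechet_derivative f (at x)) (at x)"
    by (rule smooth_on_has_derivative[OF assms(2,1) x])
  show "dird X (\<lambda>x. sin (f x)) x = cos (f x) * dird X f x"
    unfolding dird_def[of X f]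
    by (rule dird_eqI[THEN trans, OF has_derivative_sin[OF f]]) simp
  show "dird X (\<lambda>x. cos (f x)) x = - sin (f x) * dird X f x"
    unfolding dird_def[of X f]
    by (rule dird_eqI[THEN trans, OF has_derivative_cos[OF f]]) simp
qed

lemma
  fixes f :: "'a::real_normed_vector \<Rightarrow> real"
  assumes "open S" "smooth_on f S" "\<And>x. x \<in> S \<Longrightarrow> f x \<noteq> 0"
  shows smooth_on_inverse: "smooth_on (\<lambda>x. inverse (f x)) S"
    and dird_inverse: "x \<in> S \<Longrightarrow> dird X (\<lambda>x. inverse (f x)) x = - (inverse (f x) * dird X f x * inverse (f x))"
proof -
  show "smooth_on (\<lambda>x. inverse (f x)) S"
    using assms C_k_on_inverse unfolding smooth_on_def by blast
  assume x: "x \<in> S"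
  show "dird X (\<lambda>x. inverse (f x)) x = - (inverse (f x) * dird X f x * inverse (f x))"
    unfolding dird_def[of X f]
    by (rule dird_eqI[THEN trans, OF Deriv.has_derivative_inverse[OF assms(3)[OF x]
            smooth_on_has_derivative[OF assms(2,1) x]]]) simp
qed

section \<open>Normal form of a Killing field\<close>

text \<open>The first-order condition at a maximum: for small \<open>t\<close> of the sign of
  \<open>c\<close> the linear term would win over the quadratic one.\<close>

lemma linear_minimum_le_imp_eq_0:
  fixes c d :: real
  assumes "\<And>t. 2 * t * c \<le> t\<^sup>2 * d"
  shows "c = 0"
proof (rule ccontr)
  assume "c \<noteq> 0"
  define t where "t = c / (\<bar>d\<bar> + 1)"
  have pos: "\<bar>d\<bar> + 1 > 0"
    by simp
  have "2 * t * c * (\<bar>d\<bar> + 1)\<^sup>2 \<le> t\<^sup>2 * d * (\<bar>d\<bar> + 1)\<^sup>2"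
    by (intro mult_right_mono assms) simp
  moreover have "2 * t * c * (\<bar>d\<bar> + 1)\<^sup>2 = 2 * c\<^sup>2 * (\<bar>d\<bar> + 1)" "t\<^sup>2 * d * (\<bar>d\<bar> + 1)\<^sup>2 = c\<^sup>2 * d"
    using pos by (simp_all add: t_def power2_eq_square)
  moreover have "c\<^sup>2 * d \<le> c\<^sup>2 * \<bar>d\<bar>" "0 \<le> c\<^sup>2 * \<bar>d\<bar>" "0 < c\<^sup>2"
    using \<open>c \<noteq> 0\<close> by (auto intro!: mult_left_mono)
  ultimately have "2 * c\<^sup>2 * (\<bar>d\<bar> + 1) \<le> c\<^sup>2 * \<bar>d\<bar>" "0 \<le> c\<^sup>2 * \<bar>d\<bar>" "0 < c\<^sup>2"
    by linarith+
  moreover have "2 * c\<^sup>2 * (\<bar>d\<bar> + 1) = 2 * (c\<^sup>2 * \<bar>d\<bar>) + 2 * c\<^sup>2"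
    by (simp add: algebra_simps)
  ultimately show False
    by linarith
qed

text \<open>Singular vectors of \<open>J\<close> on \<open>S\<close>: at a maximum \<open>p\<close>
  of the norm of \<open>J x\<close> on the unit sphere of \<open>S\<close>, the first variation
  makes \<open>J p\<close> orthogonal to \<open>J w\<close> for every \<open>w\<close> orthogonal to
  \<open>p\<close>, and the construction continues in the orthogonal complement. When
  \<open>J\<close> is skew and its square preserves \<open>S\<close>, these are eigenvectors of the
  square.\<close>

lemma orthonormal_with_orthogonal_image:
  fixes J :: "'b::euclidean_space \<Rightarrow> 'b"
  assumes J: "linear J"
  shows "subspace S \<Longrightarrow> dim S = n \<Longrightarrow> \<exists>p :: nat \<Rightarrow> 'b. (\<forall>i<n. p i \<in> S) \<and>
    (\<forall>i<n. \<forall>j<n. p i \<bullet> p j = (if i = j then 1 else 0)) \<and> (\<forall>i<n. \<forall>j<n. i \<noteq> j \<longrightarrow> J (p i) \<bullet> J (p j) = 0)"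
proof (induction n arbitrary: S)
  case 0
  then show ?case by simp
next
  case (Suc n)
  have "S \<noteq> {0}"
    using Suc.prems(2) by auto
  then obtain v where v: "v \<in> S" "v \<noteq> 0"
    using subspace_0[OF Suc.prems(1)] by blast
  define C where "C = S \<inter> sphere 0 1"
  have "(1 / norm v) *\<^sub>R v \<in> C"
    using v Suc.prems(1) by (simp add: C_def subspace_scale)
  then have "C \<noteq> {}"
    by blast
  moreover have "compact C"
    unfolding C_def by (rule closed_Int_compact[OF closed_subspace[OF Suc.prems(1)] compact_sphere])
  moreover have "continuous_on C (\<lambda>x. J x \<bullet> J x)"
    by (intro continuous_on_inner linear_continuous_on linear_conv_bounded_linear[THEN iffD1] J)
  ultimately obtain p where p: "p \<in> C" "\<And>x. x \<in> C \<Longrightarrow> J x \<bullet> J x \<le> J p \<bullet> J p"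
    using continuous_attains_sup[of C "\<lambda>x. J x \<bullet> J x"] by blast
  have pS: "p \<in> S" "p \<bullet> p = 1"
    using p(1) by (auto simp: C_def dot_square_norm)
  have max: "J x \<bullet> J x \<le> (J p \<bullet> J p) * (x \<bullet> x)" if "x \<in> S" for x
  proof (cases "x = 0")
    case True
    then show ?thesis by (simp add: linear_0[OF J])
  next
    case False
    have "(1 / norm x) *\<^sub>R x \<in> C"
      using that False Suc.prems(1) by (simp add: C_def subspace_scale)
    from p(2)[OF this] have "(J x \<bullet> J x) / (norm x)\<^sup>2 \<le> J p \<bullet> J p"
      by (simp add: linear_scale[OF J] power2_eq_square)
    then show ?thesis
      using False by (simp add: divide_le_eq dot_square_norm)
  qed
  have orth: "J p \<bullet> J w = 0" if w: "w \<in> S" "p \<bullet> w = 0" for w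
  proof (rule linear_minimum_le_imp_eq_0)
    fix t
    have "p + t *\<^sub>R w \<in> S"
      using w pS Suc.prems(1) by (simp add: subspace_add subspace_scale)
    from max[OF this] have "J p \<bullet> J p + 2 * t * (J p \<bullet> J w) + t\<^sup>2 * (J w \<bullet> J w)
        \<le> (J p \<bullet> J p) * (1 + t\<^sup>2 * (w \<bullet> w))"
      using w pS by (simp add: linear_add[OF J] linear_scale[OF J] inner_add_left inner_add_right
          inner_commute power2_eq_square algebra_simps)
    then show "2 * t * (J p \<bullet> J w) \<le> t\<^sup>2 * ((J p \<bullet> J p) * (w \<bullet> w) - J w \<bullet> J w)"
      by (simp add: algebra_simps)
  qed
  define S' where "S' = {y \<in> S. \<forall>x\<in>span {p}. orthogonal x y}"
  have S'p: "p \<bullet> y = 0" if "y \<in> S'" for y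
    using that by (auto simp: S'_def orthogonal_def span_base)
  have "dim S' + dim (span {p}) = dim S"
    unfolding S'_def using pS Suc.prems(1)
    by (intro dim_subspace_orthogonal_to_vectors) (auto intro: span_minimal[THEN subsetD])
  moreover have "p \<noteq> 0"
    using pS by auto
  ultimately have "dim S' = n"
    using Suc.prems(2) by simp
  moreover have "subspace S'"
    unfolding S'_def using Suc.prems(1)
    by (auto simp: subspace_def orthogonal_def inner_add_right)
  ultimately obtain q where q: "\<forall>i<n. q i \<in> S'" "\<forall>i<n. \<forall>j<n. q i \<bullet> q j = (if i = j then 1 else 0)"
    "\<forall>i<n. \<forall>j<n. i \<noteq> j \<longrightarrow> J (q i) \<bullet> J (q j) = 0"
    using Suc.IH by blast
  define r where "r i = (if i = n then p else q i)" for i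
  have qS: "q i \<in> S" if "i < n" for i
    using q(1) that by (auto simp: S'_def)
  have pq: "p \<bullet> q i = 0" "q i \<bullet> p = 0" "J p \<bullet> J (q i) = 0" "J (q i) \<bullet> J p = 0" if "i < n" for i
    using S'p[of "q i"] q(1) orth[OF qS[OF that]] that
    by (simp_all add: inner_commute[of "q i" p] inner_commute[of "J (q i)" "J p"])
  show ?case
  proof (intro exI[of _ r] conjI allI impI)
    fix i j assume ij: "i < Suc n" "j < Suc n"
    show "r i \<in> S"
      using ij qS pS by (auto simp: r_def)
    show "r i \<bullet> r j = (if i = j then 1 else 0)"
      using ij q(2) pS pq by (auto simp: r_def less_Suc_eq)
    show "J (r i) \<bullet> J (r j) = 0" if "i \<noteq> j"
      using ij that q(3) pq by (auto simp: r_def less_Suc_eq)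
  qed
qed

lemma orthonormal_basis_expand:
  fixes p :: "nat \<Rightarrow> 'b::euclidean_space"
  assumes S: "subspace S" "dim S = n" and p: "\<And>i. i < n \<Longrightarrow> p i \<in> S"
    "\<And>i j. i < n \<Longrightarrow> j < n \<Longrightarrow> p i \<bullet> p j = (if i = j then 1 else 0)" and v: "v \<in> S"
  shows "v = (\<Sum>i<n. (v \<bullet> p i) *\<^sub>R p i)"
proof -
  have inj: "inj_on p {..<n}"
    using p(2) by (intro inj_onI) (metis lessThan_iff zero_neq_one)
  have "pairwise orthogonal (p ` {..<n})"
    using p(2) by (auto simp: pairwise_def orthogonal_def)
  moreover have "0 \<notin> p ` {..<n}"
    using p(2) by (metis imageE inner_zero_left lessThan_iff zero_neq_one)
  ultimately have "independent (p ` {..<n})"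
    by (rule pairwise_orthogonal_independent)
  moreover have "p ` {..<n} \<subseteq> S" "dim S \<le> card (p ` {..<n})"
    using p(1) S(2) by (auto simp: card_image[OF inj])
  ultimately have "S \<subseteq> span (p ` {..<n})"
    by (intro card_ge_dim_independent)
  then obtain u where "v = (\<Sum>w\<in>p ` {..<n}. u w *\<^sub>R w)"
    using v span_finite[of "p ` {..<n}"] by auto
  then have u: "v = (\<Sum>i<n. u (p i) *\<^sub>R p i)"
    by (simp add: sum.reindex[OF inj])
  have c: "v \<bullet> p k = u (p k)" if "k < n" for k
  proof -
    have "v \<bullet> p k = (\<Sum>i<n. u (p i) * (p i \<bullet> p k))"
      by (subst u) (simp add: inner_sum_left)
    also have "\<dots> = (\<Sum>i<n. if i = k then u (p i) else 0)"
      by (rule sum.cong) (use p(2) that in auto)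
    finally show ?thesis
      using that by simp
  qed
  have "(\<Sum>i<n. (v \<bullet> p i) *\<^sub>R p i) = (\<Sum>i<n. u (p i) *\<^sub>R p i)"
    by (rule sum.cong) (simp_all add: c)
  then show ?thesis
    by (rule trans[OF u sym])
qed

text \<open>\<open>b\<close> is the direction of the axis; the ruling direction number
  \<open>j\<close> rotates in the plane of \<open>p j\<close> and \<open>q j\<close> with angular
  speed \<open>m j\<close> per unit of height.\<close>

locale helicoid_frame =
  fixes b :: "'b::euclidean_space" and p q :: "nat \<Rightarrow> 'b" and m :: "nat \<Rightarrow> real"
  assumes b_b: "b \<bullet> b = 1" and b_p: "j < 3 \<Longrightarrow> b \<bullet> p j = 0" and b_q: "j < 3 \<Longrightarrow> b \<bullet> q j = 0"
    and p_p: "i < 3 \<Longrightarrow> j < 3 \<Longrightarrow> p i \<bullet> p j = (if i = j then 1 else 0)"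
    and q_q: "i < 3 \<Longrightarrow> j < 3 \<Longrightarrow> q i \<bullet> q j = (if i = j then 1 else 0)"
    and p_q: "i < 3 \<Longrightarrow> j < 3 \<Longrightarrow> p i \<bullet> q j = 0"
    and m_pos: "j < 3 \<Longrightarrow> 0 < m j"

text \<open>\<open>T\<close> is the value of the Killing field at \<open>g0\<close>, and
  \<open>S\<close> is the direction of the ruling through that point. The singular vectors of
  \<open>J\<close> on \<open>S\<close> and their normalized images give the planes of rotation. The
  part of \<open>T\<close> in the image of \<open>S\<close> is absorbed by moving the base point
  within the ruling, from \<open>g0\<close> to \<open>a\<close>; what is left of \<open>T\<close>
  points along the axis.\<close>

lemma killing_normal_form:
  fixes J :: "'b::euclidean_space \<Rightarrow> 'b"
  assumes J: "linear J" and skew: "\<And>y z. J y \<bullet> z = - (y \<bullet> J z)"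
    and S: "subspace S" "dim S = 3"
    and JS: "\<And>y z. y \<in> S \<Longrightarrow> z \<in> S \<Longrightarrow> J y \<bullet> z = 0" "\<And>y. y \<in> S \<Longrightarrow> J (J y) \<in> S"
      "\<And>y. y \<in> S \<Longrightarrow> J y = 0 \<Longrightarrow> y = 0"
    and ker: "\<And>y. (\<And>z. z \<in> S \<Longrightarrow> y \<bullet> z = 0) \<Longrightarrow> (\<And>z. z \<in> S \<Longrightarrow> y \<bullet> J z = 0) \<Longrightarrow> J y = 0"
    and T: "\<And>z. z \<in> S \<Longrightarrow> T \<bullet> z = 0" "T \<notin> J ` S"
  obtains b p q m \<nu> a c where "helicoid_frame b p q m" "0 < \<nu>"
    "\<And>j. j < 3 \<Longrightarrow> J (p j) = (\<nu> * m j) *\<^sub>R q j" "\<And>j. j < 3 \<Longrightarrow> J (q j) = - (\<nu> * m j) *\<^sub>R p j"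
    "J b = 0" "\<And>y. J (y - a) + \<nu> *\<^sub>R b = J (y - g0) + T" "g0 - a = (\<Sum>j<3. c j *\<^sub>R p j)"
    "\<And>z. z \<in> S \<Longrightarrow> b \<bullet> z = 0" "\<And>j z. j < 3 \<Longrightarrow> z \<in> S \<Longrightarrow> q j \<bullet> z = 0" "\<And>z. z \<in> S \<Longrightarrow> z = (\<Sum>j<3. (z \<bullet> p j) *\<^sub>R p j)"
    "\<And>y. (\<And>j. j < 3 \<Longrightarrow> y \<bullet> p j = 0) \<Longrightarrow> (\<And>j. j < 3 \<Longrightarrow> y \<bullet> q j = 0) \<Longrightarrow> J y = 0"
proof -
  from orthonormal_with_orthogonal_image[OF J S] obtain p :: "nat \<Rightarrow> 'b" where
    P: "(\<forall>i<3. p i \<in> S) \<and> (\<forall>i<3. \<forall>j<3. p i \<bullet> p j = (if i = j then 1 else 0)) \<and>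
      (\<forall>i<3. \<forall>j<3. i \<noteq> j \<longrightarrow> J (p i) \<bullet> J (p j) = 0)" ..
  have pS: "p i \<in> S" if "i < 3" for i
    using P that by blast
  have pp: "p i \<bullet> p j = (if i = j then 1 else 0)" if "i < 3" "j < 3" for i j
    using P that by blast
  have Jpp: "J (p i) \<bullet> J (p j) = 0" if "i < 3" "j < 3" "i \<noteq> j" for i j
    using P that by blast
  have expand: "v = (\<Sum>i<3. (v \<bullet> p i) *\<^sub>R p i)" if "v \<in> S" for v
    by (rule orthonormal_basis_expand[OF S pS pp that])
  define \<mu> where "\<mu> j = norm (J (p j))" for j
  have mu: "0 < \<mu> j" if "j < 3" for j
    using JS(3)[OF pS[OF that]] pp[OF that that] by (auto simp: \<mu>_def)
  define q where "q j = (1 / \<mu> j) *\<^sub>R J (p j)" for j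
  have Jp: "J (p j) = \<mu> j *\<^sub>R q j" if "j < 3" for j
    using mu[OF that] by (simp add: q_def)
  have qq: "q i \<bullet> q j = (if i = j then 1 else 0)" if "i < 3" "j < 3" for i j
    using Jpp[OF that] mu[OF that(1)] by (auto simp: q_def \<mu>_def dot_square_norm power2_eq_square)
  have Jq: "J (q j) = - \<mu> j *\<^sub>R p j" if j: "j < 3" for j
  proof -
    have "J (J (p j)) = (\<Sum>i<3. (J (J (p j)) \<bullet> p i) *\<^sub>R p i)"
      by (rule expand[OF JS(2)[OF pS[OF j]]])
    also have "\<dots> = (\<Sum>i<3. if i = j then - (\<mu> j)\<^sup>2 *\<^sub>R p j else 0)"
      using Jpp[OF j] by (intro sum.cong) (auto simp: skew[of "J (p j)"] \<mu>_def dot_square_norm)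
    finally have "J (J (p j)) = - (\<mu> j)\<^sup>2 *\<^sub>R p j"
      using j by simp
    then show ?thesis
      using mu[OF j] by (simp add: q_def linear_scale[OF J] power2_eq_square)
  qed
  have qS: "q j \<bullet> z = 0" if "j < 3" "z \<in> S" for j z
    using JS(1)[OF pS that(2)] that by (simp add: q_def)
  define v where "v = T - (\<Sum>j<3. (T \<bullet> q j) *\<^sub>R q j)"
  have vS: "v \<bullet> z = 0" if "z \<in> S" for z
    using T(1)[OF that] qS that by (simp add: v_def inner_diff_left inner_sum_left)
  have vq: "v \<bullet> q i = 0" if "i < 3" for i
  proof -
    have "(\<Sum>j<3. (T \<bullet> q j) * (q j \<bullet> q i)) = (\<Sum>j<3. if j = i then T \<bullet> q j else 0)"
      using qq that by (intro sum.cong) auto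
    then show ?thesis
      using that by (simp add: v_def inner_diff_left inner_sum_left)
  qed
  \<comment> \<open>Chosen so that \<open>J w\<close> is the part of \<open>T\<close> in the span of
    the \<open>q j\<close>; the axis then passes through \<open>g0 - w\<close>.\<close>
  define w where "w = (\<Sum>j<3. (T \<bullet> q j / \<mu> j) *\<^sub>R p j)"
  have wS: "w \<in> S"
    unfolding w_def using pS by (intro subspace_sum subspace_scale S(1)) auto
  have Jw: "J w = T - v"
  proof -
    have "J w = (\<Sum>j<3. (T \<bullet> q j / \<mu> j) *\<^sub>R J (p j))"
      by (simp add: w_def linear_sum[OF J] linear_scale[OF J])
    also have "\<dots> = (\<Sum>j<3. (T \<bullet> q j) *\<^sub>R q j)"
      by (intro sum.cong) (auto simp: q_def)
    finally show ?thesis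
      by (simp add: v_def)
  qed
  have "v \<noteq> 0"
    using T(2) Jw wS by (metis diff_zero imageI)
  \<comment> \<open>Division by \<nu> makes the axis vector a unit vector and turns the speeds
    \<open>\<mu> j\<close> of the flow into speeds per unit of height.\<close>
  define \<nu> b where "\<nu> = norm v" and "b = (1 / \<nu>) *\<^sub>R v"
  have nu: "0 < \<nu>"
    using \<open>v \<noteq> 0\<close> by (simp add: \<nu>_def)
  have ker': "J y = 0" if "\<And>j. j < 3 \<Longrightarrow> y \<bullet> p j = 0" "\<And>j. j < 3 \<Longrightarrow> y \<bullet> q j = 0" for y
  proof (rule ker)
    fix z assume z: "z \<in> S"
    show "y \<bullet> z = 0"
      by (subst expand[OF z]) (simp_all add: inner_sum_right that)
    have "J z = (\<Sum>j<3. (z \<bullet> p j) *\<^sub>R J (p j))"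
      by (subst expand[OF z]) (simp_all add: linear_sum[OF J] linear_scale[OF J])
    then show "y \<bullet> J z = 0"
      by (simp add: inner_sum_right Jp that)
  qed
  show ?thesis
  proof (rule that[of b p q "\<lambda>j. \<mu> j / \<nu>" \<nu> "g0 - w" "\<lambda>j. T \<bullet> q j / \<mu> j"])
    show "helicoid_frame b p q (\<lambda>j. \<mu> j / \<nu>)"
    proof
      show "b \<bullet> b = 1"
        using nu by (simp add: b_def \<nu>_def dot_square_norm power2_eq_square)
      show "b \<bullet> p j = 0" "b \<bullet> q j = 0" "0 < \<mu> j / \<nu>" if "j < 3" for j
        using vS[OF pS[OF that]] vq[OF that] mu[OF that] nu by (simp_all add: b_def)
      show "p i \<bullet> p j = (if i = j then 1 else 0)" "q i \<bullet> q j = (if i = j then 1 else 0)" "p i \<bullet> q j = 0"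
        if "i < 3" "j < 3" for i j
        using pp[OF that] qq[OF that] qS[OF that(2) pS[OF that(1)]] by (simp_all add: inner_commute)
    qed
    show "0 < \<nu>"
      by (rule nu)
    show "J (p j) = (\<nu> * (\<mu> j / \<nu>)) *\<^sub>R q j" "J (q j) = - (\<nu> * (\<mu> j / \<nu>)) *\<^sub>R p j" if "j < 3" for j
      using Jp[OF that] Jq[OF that] nu by simp_all
    show "J b = 0"
      by (rule ker') (simp_all add: b_def vS pS vq)
    show "J (y - (g0 - w)) + \<nu> *\<^sub>R b = J (y - g0) + T" for y
    proof -
      have "J (y - (g0 - w)) = J (y - g0) + J w"
        unfolding linear_add[OF J, symmetric] by (simp add: algebra_simps)
      then show ?thesis
        using nu by (simp add: Jw b_def)
    qed
    show "g0 - (g0 - w) = (\<Sum>j<3. (T \<bullet> q j / \<mu> j) *\<^sub>R p j)"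
      by (simp add: w_def)
    show "b \<bullet> z = 0" if "z \<in> S" for z
      by (simp add: b_def vS[OF that])
    show "q j \<bullet> z = 0" if "j < 3" "z \<in> S" for j z
      using qS that .
    show "z = (\<Sum>j<3. (z \<bullet> p j) *\<^sub>R p j)" if "z \<in> S" for z
      by (rule expand[OF that])
    show "J y = 0" if "\<And>j. j < 3 \<Longrightarrow> y \<bullet> p j = 0" "\<And>j. j < 3 \<Longrightarrow> y \<bullet> q j = 0" for y
      by (rule ker') (use that in auto)
  qed
qed

context flat_frame
begin

text \<open>The frame spans, so vanishing frame derivatives make the whole derivative vanish, and
  convexity gives constancy.\<close>

lemma D_zero_imp_constant:
  fixes F :: "real ^ 4 \<Rightarrow> 'c::euclidean_space"
  assumes B: "open B" "convex B" "B \<subseteq> W" and F: "smooth_on F B"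
    and D: "\<And>x i. x \<in> B \<Longrightarrow> D i F x = 0" and xy: "x \<in> B" "y \<in> B"
  shows "F x = F y"
proof -
  have "(F has_derivative (\<lambda>v. 0)) (at x within B)" if x: "x \<in> B" for x
  proof -
    have F': "(F has_derivative frechet_derivative F (at x)) (at x)"
      by (rule smooth_on_has_derivative[OF F B(1) x])
    note lin = has_derivative_linear[OF F']
    have "frechet_derivative F (at x) v = 0" for v
    proof -
      define c where "c l = frechet_derivative g (at x) v \<bullet> E l x" for l
      have "v = (\<Sum>l\<in>UNIV. c l *\<^sub>R e l x)"
        unfolding c_def using frame_expand B(3) x by blast
      then have "frechet_derivative F (at x) v = (\<Sum>l\<in>UNIV. c l *\<^sub>R D l F x)"
        by (simp add: linear_sum[OF lin] linear_scale[OF lin] dird_def)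
      then show ?thesis
        by (simp add: D[OF x])
    qed
    then have "frechet_derivative F (at x) = (\<lambda>v. 0)"
      by auto
    then show ?thesis
      using F' by (simp add: has_derivative_at_withinI)
  qed
  from has_derivative_zero_constant[OF B(2) this] show ?thesis
    using xy by metis
qed

text \<open>Read together with \<open>D_c_E1\<close> and \<open>D_1_E1\<close>: the derivative of
  \<open>E 1\<close> along \<open>E i\<close> is \<open>Kf (E i x) x\<close> up to a multiple of
  \<open>E 1\<close>, which lets \<open>E 1\<close> be integrated to an affine field with linear
  part proportional to \<open>Kf\<close>.\<close>

lemma Kf_E:
  assumes x: "x \<in> W"
  shows "c \<noteq> 1 \<Longrightarrow> Kf (E c x) x = Wv c x"
    and "Kf (E 1 x) x = Y 1 2 x *\<^sub>R E 2 x + Y 1 3 x *\<^sub>R E 3 x + Y 1 4 x *\<^sub>R E 4 x"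
proof -
  show "Kf (E c x) x = Wv c x" if "c \<noteq> 1"
    using exhaust_4[of c] that
    by (auto simp: Kf_def E_E[OF x] inner_diff_left n_E[OF x] Wv_def)
  show "Kf (E 1 x) x = Y 1 2 x *\<^sub>R E 2 x + Y 1 3 x *\<^sub>R E 3 x + Y 1 4 x *\<^sub>R E 4 x"
    by (simp add: Kf_def E_E[OF x] inner_diff_left n_E[OF x] Wv_def)
qed

lemma linear_Kf: "linear (\<lambda>y. Kf y x)"
  by (rule linearI) (simp_all add: Kf_def inner_add_right algebra_simps)

text \<open>Every \<open>Kf y\<close> satisfies the same linear equations, with factors
  \<open>s i\<close>, by \<open>D_c_Kf\<close> and \<open>D_1_Kf_0\<close>, and so does \<kappa>,
  being a component of such a field. Quotients by \<kappa> are therefore constant; this yields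
  \<open>J\<close>, and then \<open>u\<close> as the constant value of
  \<open>inverse (\<kappa> x) *\<^sub>R E 1 x - J (g x)\<close>.\<close>

lemma killing:
  assumes x0: "x0 \<in> W"
  obtains B J \<kappa> u where "open B" "convex B" "x0 \<in> B" "B \<subseteq> W" "linear J"
    "\<And>x. x \<in> B \<Longrightarrow> 0 < \<kappa> x" "\<And>x y. x \<in> B \<Longrightarrow> Kf y x = \<kappa> x *\<^sub>R J y"
    "\<And>x. x \<in> B \<Longrightarrow> E 1 x = \<kappa> x *\<^sub>R (J (g x) + u)"
proof -
  define \<kappa> where "\<kappa> x = Kf (E 2 x0) x \<bullet> n 2 x0" for x
  have smk: "smooth_on \<kappa> W"
    unfolding \<kappa>_def by (intro smooth_on_inner smooth_on_const open_W smooth_Kf)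
  have "\<kappa> x0 = n 2 x0 \<bullet> n 2 x0"
    by (simp add: \<kappa>_def Kf_E[OF x0] Wv_def inner_diff_left n_E[OF x0])
  then have k0: "0 < \<kappa> x0"
    using n_nonzero[OF x0, of 2] by simp
  have "open (\<kappa> -` {0<..} \<inter> W)"
    using continuous_on_open_vimage[OF open_W] smooth_on_imp_continuous_on[OF smk] open_greaterThan by blast
  then obtain r where r: "r > 0" "ball x0 r \<subseteq> \<kappa> -` {0<..} \<inter> W"
    using k0 x0 by (metis IntI greaterThan_iff openE vimageI)
  define B where "B = ball x0 r"
  have B: "open B" "convex B" "x0 \<in> B" "B \<subseteq> W" and pos: "\<And>x. x \<in> B \<Longrightarrow> 0 < \<kappa> x"
    using r by (auto simp: B_def)
  have inv: "smooth_on (\<lambda>x. inverse (\<kappa> x)) B"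
    "\<And>i x. x \<in> B \<Longrightarrow> D i (\<lambda>x. inverse (\<kappa> x)) x = - (inverse (\<kappa> x) * D i \<kappa> x * inverse (\<kappa> x))"
    using smooth_on_inverse[OF B(1) smooth_on_subset[OF smk B(4)]]
      dird_inverse[OF B(1) smooth_on_subset[OF smk B(4)]] pos by force+
  define s where "s i x = (if i = 1 then 0 else Y 1 i x)" for i x
  have DK: "D i (Kf y) x = s i x *\<^sub>R Kf y x" if "x \<in> W" for i y x
    using D_c_Kf[OF that] D_1_Kf_0[OF that] by (simp add: s_def)
  have Dk: "D i \<kappa> x = s i x * \<kappa> x" if "x \<in> W" for i x
    unfolding \<kappa>_def using dird_bounded_linear[OF open_W that bounded_linear_inner_left smooth_Kf]
    by (simp add: DK[OF that])
  have Dinv: "D i (\<lambda>z. inverse (\<kappa> z) *\<^sub>R F z) x = inverse (\<kappa> x) *\<^sub>R (D i F x - s i x *\<^sub>R F x)"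
    if x: "x \<in> B" and F: "smooth_on F W" for i x and F :: "real ^ 4 \<Rightarrow> 'b"
    using x B(4) pos[OF x] by (auto simp: dird_scaleR[OF B(1) x inv(1) smooth_on_subset[OF F B(4)]] inv(2) Dk
        algebra_simps)
  define J where "J y = inverse (\<kappa> x0) *\<^sub>R Kf y x0" for y
  have linJ: "linear J"
    unfolding J_def by (rule linear_compose_scale_right[OF linear_Kf])
  have KJ: "Kf y x = \<kappa> x *\<^sub>R J y" if x: "x \<in> B" for x y
  proof -
    have "inverse (\<kappa> x) *\<^sub>R Kf y x = inverse (\<kappa> x0) *\<^sub>R Kf y x0"
    proof (rule D_zero_imp_constant[OF B(1,2,4) _ _ x B(3)])
      show "smooth_on (\<lambda>x. inverse (\<kappa> x) *\<^sub>R Kf y x) B"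
        by (intro smooth_on_scaleR B inv smooth_on_subset[OF smooth_Kf])
      show "D i (\<lambda>x. inverse (\<kappa> x) *\<^sub>R Kf y x) z = 0" if "z \<in> B" for z i
        using that B(4) by (auto simp: Dinv[OF that smooth_Kf] DK)
    qed
    then show ?thesis
      using pos[OF x] by (simp add: J_def[symmetric]) (metis less_irrefl right_inverse scaleR_one scaleR_scaleR)
  qed
  have blJ: "bounded_linear J"
    using linJ by (simp add: linear_conv_bounded_linear)
  define U where "U x = inverse (\<kappa> x) *\<^sub>R E 1 x - J (g x)" for x
  have U: "U x = U x0" if x: "x \<in> B" for x
  proof (rule D_zero_imp_constant[OF B(1,2,4) _ _ x B(3)])
    have sm1: "smooth_on (\<lambda>x. inverse (\<kappa> x) *\<^sub>R E 1 x) B"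
      by (intro smooth_on_scaleR B inv smooth_on_subset[OF smooth_E])
    have sm2: "smooth_on (\<lambda>x. J (g x)) B"
      by (intro smooth_on_bounded_linear[OF blJ] B smooth_on_subset[OF smooth_g])
    show "smooth_on U B"
      unfolding U_def by (intro smooth_on_diff B sm1 sm2)
    fix z i assume z: "z \<in> B"
    then have zW: "z \<in> W"
      using B(4) by auto
    have "D i U z = D i (\<lambda>x. inverse (\<kappa> x) *\<^sub>R E 1 x) z - D i (\<lambda>x. J (g x)) z"
      unfolding U_def by (rule dird_diff[OF B(1) z sm1 sm2])
    also have "\<dots> = inverse (\<kappa> z) *\<^sub>R (D i (E 1) z - s i z *\<^sub>R E 1 z) - J (E i z)"
      by (simp add: Dinv[OF z smooth_E] dird_bounded_linear[OF open_W zW blJ smooth_g])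
    also have "J (E i z) = inverse (\<kappa> z) *\<^sub>R Kf (E i z) z"
      using pos[OF z] by (simp add: KJ[OF z])
    also have "Kf (E i z) z = D i (E 1) z - s i z *\<^sub>R E 1 z"
      using Kf_E[OF zW] D_c_E1[OF zW] D_1_E1[OF zW] by (cases "i = 1") (auto simp: s_def Wv_def)
    finally show "D i U z = 0"
      by simp
  qed
  show ?thesis
  proof (rule that[OF B linJ pos KJ])
    fix x assume x: "x \<in> B"
    have "inverse (\<kappa> x) *\<^sub>R E 1 x = J (g x) + U x0"
      using U[OF x] by (simp add: U_def algebra_simps)
    then have "\<kappa> x *\<^sub>R (inverse (\<kappa> x) *\<^sub>R E 1 x) = \<kappa> x *\<^sub>R (J (g x) + U x0)"
      by simp
    then show "E 1 x = \<kappa> x *\<^sub>R (J (g x) + U x0)"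
      using pos[OF x] by simp
  qed
qed

text \<open>The orthogonal projection onto the direction space of the leaf through
  \<open>x\<close>.\<close>

definition tproj :: "'b \<Rightarrow> real ^ 4 \<Rightarrow> 'b" where
  "tproj y x = (E 2 x \<bullet> y) *\<^sub>R E 2 x + (E 3 x \<bullet> y) *\<^sub>R E 3 x + (E 4 x \<bullet> y) *\<^sub>R E 4 x"

lemma smooth_tproj: "smooth_on (tproj y) W"
proof -
  have "tproj y = (\<lambda>x. (E 2 x \<bullet> y) *\<^sub>R E 2 x + (E 3 x \<bullet> y) *\<^sub>R E 3 x + (E 4 x \<bullet> y) *\<^sub>R E 4 x)"
    by (simp add: fun_eq_iff tproj_def)
  then show ?thesis
    by (auto intro!: smooth_on_add smooth_on_scaleR smooth_on_inner smooth_on_const open_W smooth_E)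
qed

context
  fixes x assumes x: "x \<in> W"
begin

lemma D_tproj: "D i (tproj y) x =
    (E 2 x \<bullet> y) *\<^sub>R D i (E 2) x + (D i (E 2) x \<bullet> y) *\<^sub>R E 2 x
    + ((E 3 x \<bullet> y) *\<^sub>R D i (E 3) x + (D i (E 3) x \<bullet> y) *\<^sub>R E 3 x)
    + ((E 4 x \<bullet> y) *\<^sub>R D i (E 4) x + (D i (E 4) x \<bullet> y) *\<^sub>R E 4 x)"
proof -
  have 1: "smooth_on (\<lambda>x. (E a x \<bullet> y) *\<^sub>R E a x) W" "smooth_on (\<lambda>x. E a x \<bullet> y) W" for a
    by (auto intro!: smooth_on_scaleR smooth_on_inner smooth_on_const open_W smooth_E)
  have "D i (tproj y) x = D i (\<lambda>x. (E 2 x \<bullet> y) *\<^sub>R E 2 x + (E 3 x \<bullet> y) *\<^sub>R E 3 x + (E 4 x \<bullet> y) *\<^sub>R E 4 x) x"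
    by (rule dird_cong[OF open_W x]) (rule tproj_def)
  then show ?thesis
    by (simp add: dird_add[OF open_W x] dird_scaleR[OF open_W x] 1 smooth_E
        smooth_on_add[OF open_W] dird_bounded_linear[OF open_W x bounded_linear_inner_left])
qed

lemma D_c_tproj: "c \<noteq> 1 \<Longrightarrow> D c (tproj y) x = 0"
  unfolding D_tproj by (simp add: D_c_E[OF x] G_anti[OF x] inner_add_left algebra_simps)

text \<open>Along \<open>E 1\<close> the leaves are rotated by the Killing field, so the projection
  onto them evolves by its commutator with \<open>Kf\<close>.\<close>

lemma D_1_tproj: "D 1 (tproj y) x = Kf (tproj y x) x - tproj (Kf y x) x"
proof -
  have "E a x \<bullet> Wv b x = 0" if "a \<noteq> 1" for a b
    using that by (simp add: Wv_def inner_diff_right n_E[OF x] E_E[OF x])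
  then show ?thesis
    unfolding D_tproj
    by (simp add: D_1_E[OF x] G_anti[OF x] tproj_def Kf_def inner_add_left inner_add_right inner_diff_right
        E_E[OF x] inner_commute[of "Wv _ x" "E _ x"] algebra_simps)
qed

lemma tproj_inner: "a \<noteq> 1 \<Longrightarrow> tproj y x \<bullet> E a x = y \<bullet> E a x"
  using exhaust_4[of a] by (auto simp: tproj_def inner_add_left inner_add_right E_E[OF x] inner_commute)

end

end

section \<open>Helicoids\<close>

context helicoid_frame
begin

text \<open>\<open>P j t\<close> is the ruling direction number \<open>j\<close> at height
  \<open>t\<close>, and \<open>Q j t\<close> the direction into which it turns.\<close>

definition P :: "nat \<Rightarrow> real \<Rightarrow> 'b" where
  "P j t = cos (m j * t) *\<^sub>R p j + sin (m j * t) *\<^sub>R q j"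

definition Q :: "nat \<Rightarrow> real \<Rightarrow> 'b" where
  "Q j t = (- sin (m j * t)) *\<^sub>R p j + cos (m j * t) *\<^sub>R q j"

definition helicoid :: "'b \<Rightarrow> 'b set" where
  "helicoid a = {a + t *\<^sub>R b + (\<Sum>j<3. s j *\<^sub>R P j t) | t s. True}"

text \<open>
  A real analytic retraction of the whole space onto the helicoid: project \<open>y\<close> to the ruling through the
  point of the axis at the height of \<open>y\<close>.
\<close>

definition retr :: "'b \<Rightarrow> 'b \<Rightarrow> 'b" where
  "retr a y = a + (b \<bullet> (y - a)) *\<^sub>R b
    + (\<Sum>j<3. (P j (b \<bullet> (y - a)) \<bullet> (y - a)) *\<^sub>R P j (b \<bullet> (y - a)))"

lemma q_p: "i < 3 \<Longrightarrow> j < 3 \<Longrightarrow> q i \<bullet> p j = 0"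
  using p_q by (simp add: inner_commute)

lemma b_P: "j < 3 \<Longrightarrow> b \<bullet> P j t = 0" and b_Q: "j < 3 \<Longrightarrow> b \<bullet> Q j t = 0"
  by (simp_all add: P_def Q_def inner_add_right inner_diff_right b_p b_q)

lemma P_P: "i < 3 \<Longrightarrow> j < 3 \<Longrightarrow> P i t \<bullet> P j t = (if i = j then 1 else 0)"
  and P_Q: "i < 3 \<Longrightarrow> j < 3 \<Longrightarrow> P i t \<bullet> Q j t = 0"
  using sin_cos_squared_add3[of "m j * t"] sin_cos_squared_add2[of "m j * t"]
  by (auto simp: P_def Q_def inner_add_left inner_add_right inner_diff_left inner_diff_right p_p q_q p_q q_p
      power2_eq_square)

lemma coords:
  fixes a s t
  defines "y \<equiv> a + t *\<^sub>R b + (\<Sum>j<3. s j *\<^sub>R P j t)"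
  shows "b \<bullet> (y - a) = t" and "j < 3 \<Longrightarrow> P j t \<bullet> (y - a) = s j"
proof -
  have e: "y - a = t *\<^sub>R b + (\<Sum>j<3. s j *\<^sub>R P j t)"
    by (simp add: y_def)
  show "b \<bullet> (y - a) = t"
    unfolding e by (simp add: inner_add_right inner_sum_right b_b b_P)
  show "P j t \<bullet> (y - a) = s j" if j: "j < 3"
  proof -
    have "P j t \<bullet> (\<Sum>i<3. s i *\<^sub>R P i t) = (\<Sum>i<3. if i = j then s i else 0)"
      unfolding inner_sum_right by (rule sum.cong) (use j P_P in auto)
    then show ?thesis
      unfolding e using j by (simp add: inner_add_right inner_commute[of "P j t" b] b_P)
  qed
qed

lemma mem_helicoid_iff: "y \<in> helicoid a \<longleftrightarrow> retr a y = y"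
proof
  assume "y \<in> helicoid a"
  then obtain t s where y: "y = a + t *\<^sub>R b + (\<Sum>j<3. s j *\<^sub>R P j t)"
    by (auto simp: helicoid_def)
  have "retr a y = a + t *\<^sub>R b + (\<Sum>j<3. (P j t \<bullet> (y - a)) *\<^sub>R P j t)"
    using coords(1)[of a t s] by (simp add: retr_def y)
  also have "(\<Sum>j<3. (P j t \<bullet> (y - a)) *\<^sub>R P j t) = (\<Sum>j<3. s j *\<^sub>R P j t)"
    unfolding y by (rule sum.cong) (simp_all only: coords(2) lessThan_iff)
  finally show "retr a y = y"
    using y by simp
next
  assume "retr a y = y"
  then have e: "y = a + (b \<bullet> (y - a)) *\<^sub>R b
    + (\<Sum>j<3. (P j (b \<bullet> (y - a)) \<bullet> (y - a)) *\<^sub>R P j (b \<bullet> (y - a)))"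
    unfolding retr_def by (rule sym)
  show "y \<in> helicoid a"
    unfolding helicoid_def mem_Collect_eq
    by (rule exI[of _ "b \<bullet> (y - a)"], rule exI[of _ "\<lambda>j. P j (b \<bullet> (y - a)) \<bullet> (y - a)"])
       (rule conjI[OF e TrueI])
qed

text \<open>The remainder \<open>y - retr a y\<close> is orthogonal to \<open>b\<close> and all
  \<open>P j\<close>; the first hypothesis adds the \<open>Q j\<close>, hence all \<open>p j\<close>
  and \<open>q j\<close>. By the second hypothesis it is then orthogonal to \<open>y - a\<close>,
  and so to itself.\<close>

lemma helicoidI:
  assumes "\<And>j. j < 3 \<Longrightarrow> Q j (b \<bullet> (y - a)) \<bullet> (y - a) = 0"
    and "\<And>r. r \<bullet> b = 0 \<Longrightarrow> (\<And>j. j < 3 \<Longrightarrow> r \<bullet> p j = 0) \<Longrightarrow> (\<And>j. j < 3 \<Longrightarrow> r \<bullet> q j = 0) \<Longrightarrow> r \<bullet> (y - a) = 0"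
  shows "y \<in> helicoid a"
proof -
  define w where "w = y - a"
  define t where "t = b \<bullet> w"
  define v where "v = y - retr a y"
  have v: "v = w - t *\<^sub>R b - (\<Sum>j<3. (P j t \<bullet> w) *\<^sub>R P j t)"
    by (simp add: v_def retr_def t_def w_def)
  have P_b: "P j t \<bullet> b = 0" if "j < 3" for j
    using b_P[OF that] by (simp add: inner_commute)
  have vb: "v \<bullet> b = 0"
  proof -
    have "w \<bullet> b = t"
      by (simp add: t_def inner_commute)
    moreover have "(\<Sum>j<3. (P j t \<bullet> w) * (P j t \<bullet> b)) = 0"
      by (rule sum.neutral) (use P_b in auto)
    ultimately show ?thesis
      unfolding v by (simp add: inner_diff_left inner_sum_left b_b)
  qed
  have sumP: "(\<Sum>j<3. (P j t \<bullet> w) *\<^sub>R P j t) \<bullet> P i t = P i t \<bullet> w" if "i < 3" for i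
  proof -
    have "(\<Sum>j<3. (P j t \<bullet> w) *\<^sub>R P j t) \<bullet> P i t = (\<Sum>j<3. if j = i then P j t \<bullet> w else 0)"
      unfolding inner_sum_left by (rule sum.cong) (use that P_P in auto)
    then show ?thesis
      using that by simp
  qed
  have vP: "v \<bullet> P i t = 0" if "i < 3" for i
    unfolding v inner_diff_left sumP[OF that] using inner_commute[of w "P i t"] by (simp add: b_P that)
  have vQ: "v \<bullet> Q i t = 0" if "i < 3" for i
  proof -
    have "w \<bullet> Q i t = 0"
      using assms(1)[OF that] by (simp add: t_def w_def inner_commute)
    moreover have "(\<Sum>j<3. (P j t \<bullet> w) * (P j t \<bullet> Q i t)) = 0"
      by (rule sum.neutral) (use P_Q that in auto)
    ultimately show ?thesis
      unfolding v by (simp add: inner_diff_left inner_sum_left b_Q that)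
  qed
  have "p i = cos (m i * t) *\<^sub>R P i t - sin (m i * t) *\<^sub>R Q i t"
    "q i = sin (m i * t) *\<^sub>R P i t + cos (m i * t) *\<^sub>R Q i t" for i
  proof -
    have cs: "cos (m i * t) * cos (m i * t) + sin (m i * t) * sin (m i * t) = 1"
      by (simp flip: power2_eq_square)
    have "cos (m i * t) *\<^sub>R P i t - sin (m i * t) *\<^sub>R Q i t
        = (cos (m i * t) * cos (m i * t) + sin (m i * t) * sin (m i * t)) *\<^sub>R p i"
      "sin (m i * t) *\<^sub>R P i t + cos (m i * t) *\<^sub>R Q i t
        = (cos (m i * t) * cos (m i * t) + sin (m i * t) * sin (m i * t)) *\<^sub>R q i"
      by (simp_all add: P_def Q_def algebra_simps del: sin_cos_squared_add3)
    then show "p i = cos (m i * t) *\<^sub>R P i t - sin (m i * t) *\<^sub>R Q i t"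
      "q i = sin (m i * t) *\<^sub>R P i t + cos (m i * t) *\<^sub>R Q i t"
      unfolding cs by simp_all
  qed
  then have "v \<bullet> p i = 0" "v \<bullet> q i = 0" if "i < 3" for i
    using vP[OF that] vQ[OF that] by (simp_all add: inner_diff_right inner_add_right)
  then have vv: "v \<bullet> w = 0"
    unfolding w_def using assms(2) vb by blast
  have "v \<bullet> v = v \<bullet> w - t * (v \<bullet> b) - (\<Sum>j<3. (P j t \<bullet> w) * (v \<bullet> P j t))"
    by (subst (2) v) (simp add: inner_diff_right inner_sum_right)
  then have "v \<bullet> v = 0"
    using vv vb vP by simp
  then show ?thesis
    by (simp add: mem_helicoid_iff v_def)
qed

end

section \<open>The immersion runs locally in a helicoid\<close>

context flat_frame
begin

text \<open>The criterion \<open>helicoidI\<close> is checked along \<open>g\<close>: each scalar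
  function in it vanishes at \<open>x0\<close> and has zero derivative in all frame directions. In
  leaf directions this requires that \<open>Q j\<close> at the height of \<open>g x\<close>, and all
  vectors orthogonal to \<open>b\<close>, \<open>p j\<close> and \<open>q j\<close>, stay orthogonal
  to the leaves, as \<open>F0\<close> and \<open>perp_E\<close> provide.\<close>

lemma local_helicoid:
  assumes x0: "x0 \<in> W"
  obtains B a b p q m where "open B" "x0 \<in> B" "B \<subseteq> W" "helicoid_frame b p q m"
    "g ` B \<subseteq> helicoid_frame.helicoid b p q m a"
proof -
  obtain B J \<kappa> u where B: "open B" "convex B" "x0 \<in> B" "B \<subseteq> W" and J: "linear J"
    and pos: "\<And>x. x \<in> B \<Longrightarrow> 0 < \<kappa> x" and KJ: "\<And>x y. x \<in> B \<Longrightarrow> Kf y x = \<kappa> x *\<^sub>R J y"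
    and E1: "\<And>x. x \<in> B \<Longrightarrow> E 1 x = \<kappa> x *\<^sub>R (J (g x) + u)"
  proof (rule killing[OF x0])
    fix B J \<kappa> u
    assume "open B" "convex B" "x0 \<in> B" "B \<subseteq> W" "linear J"
      "\<And>x. x \<in> B \<Longrightarrow> 0 < \<kappa> x" "\<And>x y. x \<in> B \<Longrightarrow> Kf y x = \<kappa> x *\<^sub>R J y"
      "\<And>x. x \<in> B \<Longrightarrow> E 1 x = \<kappa> x *\<^sub>R (J (g x) + u)"
    then show thesis
      by (rule that)
  qed
  define S where "S = span {E 2 x0, E 3 x0, E 4 x0}"
  define T where "T = J (g x0) + u"
  have J_def: "J y = (1 / \<kappa> x0) *\<^sub>R Kf y x0" for y
    using KJ[OF B(3)] pos[OF B(3)] by simp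
  have k0: "\<kappa> x0 \<noteq> 0"
    using pos[OF B(3)] by simp
  have ES: "E a x0 \<in> S" if "a \<noteq> 1" for a
    using exhaust_4[of a] that by (auto simp: S_def span_base)
  have perpS: "w \<bullet> z = 0" if z: "z \<in> S" and "w \<bullet> E 2 x0 = 0" "w \<bullet> E 3 x0 = 0" "w \<bullet> E 4 x0 = 0" for w z
    using z unfolding S_def
    by (induction rule: span_induct_alt) (use that in \<open>auto simp: inner_add_right\<close>)
  have WS: "Wv a x0 \<bullet> z = 0" if "z \<in> S" for a z
    by (rule perpS[OF that]) (simp_all add: Wv_def inner_diff_left n_E[OF x0] E_E[OF x0])
  have Kf_S: "Kf y x0 = (E 2 x0 \<bullet> y) *\<^sub>R Wv 2 x0 + (E 3 x0 \<bullet> y) *\<^sub>R Wv 3 x0 + (E 4 x0 \<bullet> y) *\<^sub>R Wv 4 x0"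
    if "y \<in> S" for y
    by (simp add: Kf_def WS[OF that])
  have tproj_S: "y = tproj y x0" if y: "y \<in> S" for y
  proof -
    have "y - tproj y x0 \<in> S"
      using y ES unfolding S_def tproj_def by (intro span_diff span_add span_scale) (auto simp: span_base)
    then have "(y - tproj y x0) \<bullet> (y - tproj y x0) = 0"
      by (rule perpS) (simp_all add: inner_diff_left tproj_inner[OF x0])
    then show ?thesis
      by simp
  qed
  \<comment> \<open>Pairing with \<open>E 1\<close> isolates the tangential part; the rest is
    independence of the \<open>n a\<close>.\<close>
  have W_indep: "c2 = 0 \<and> c3 = 0 \<and> c4 = 0 \<and> d = 0"
    if "c2 *\<^sub>R Wv 2 x0 + c3 *\<^sub>R Wv 3 x0 + c4 *\<^sub>R Wv 4 x0 = d *\<^sub>R E 1 x0" for c2 c3 c4 d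
  proof -
    have n0: "c2 *\<^sub>R n 2 x0 + c3 *\<^sub>R n 3 x0 + c4 *\<^sub>R n 4 x0
        = (d + c2 * Y 1 2 x0 + c3 * Y 1 3 x0 + c4 * Y 1 4 x0) *\<^sub>R E 1 x0"
      using that by (simp add: Wv_def algebra_simps)
    from arg_cong[OF n0, of "\<lambda>v. v \<bullet> E 1 x0"]
    have "d + c2 * Y 1 2 x0 + c3 * Y 1 3 x0 + c4 * Y 1 4 x0 = 0"
      by (simp add: inner_add_left n_E[OF x0] E_E[OF x0])
    then show ?thesis
      using indep[OF x0, of c2 c3 c4] n0 by auto
  qed
  have skew: "J y \<bullet> z = - (y \<bullet> J z)" for y z
    unfolding J_def Kf_def
    using inner_commute[of y] by (simp add: inner_add_left inner_add_right algebra_simps)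
  have dimS: "dim S = 3"
  proof -
    have ne: "E 2 x0 \<noteq> E 3 x0" "E 2 x0 \<noteq> E 4 x0" "E 3 x0 \<noteq> E 4 x0" "E a x0 \<noteq> 0" for a
      using E_E[OF x0, of 2 3] E_E[OF x0, of 2 4] E_E[OF x0, of 3 4] E_E[OF x0, of 2 2] E_E[OF x0, of 3 3]
        E_E[OF x0, of a a] by auto
    have "independent {E 2 x0, E 3 x0, E 4 x0}"
      by (rule pairwise_orthogonal_independent) (use ne in \<open>auto simp: pairwise_def orthogonal_def E_E[OF x0]\<close>)
    then have "dim S = card {E 2 x0, E 3 x0, E 4 x0}"
      unfolding S_def dim_span by (rule dim_eq_card_independent)
    then show ?thesis
      using ne by simp
  qed
  have JS1: "J y \<bullet> z = 0" if "y \<in> S" "z \<in> S" for y z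
    by (simp add: J_def Kf_S[OF that(1)] inner_add_left WS[OF that(2)])
  have JS2: "J (J y) \<in> S" if y: "y \<in> S" for y
  proof -
    have "E a x0 \<bullet> J y = 0" if "a \<noteq> 1" for a
      using JS1[OF y ES[OF that]] by (simp add: inner_commute)
    then have "J (J y) = (1 / \<kappa> x0) *\<^sub>R - ((Wv 2 x0 \<bullet> J y) *\<^sub>R E 2 x0 + (Wv 3 x0 \<bullet> J y) *\<^sub>R E 3 x0
        + (Wv 4 x0 \<bullet> J y) *\<^sub>R E 4 x0)"
      by (subst J_def) (simp add: Kf_def)
    also have "\<dots> \<in> S"
      unfolding S_def by (intro span_scale span_neg span_add span_base) auto
    finally show ?thesis .
  qed
  have JS3: "y = 0" if y: "y \<in> S" "J y = 0" for y
  proof -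
    have "Kf y x0 = 0 *\<^sub>R E 1 x0"
      using y(2) k0 by (simp add: J_def)
    then have "E 2 x0 \<bullet> y = 0 \<and> E 3 x0 \<bullet> y = 0 \<and> E 4 x0 \<bullet> y = 0 \<and> (0::real) = 0"
      unfolding Kf_S[OF y(1)] by (rule W_indep)
    then show ?thesis
      using tproj_S[OF y(1)] by (simp add: tproj_def)
  qed
  have WJ: "Wv a x0 = \<kappa> x0 *\<^sub>R J (E a x0)" if "a \<noteq> 1" for a
    using Kf_E(1)[OF x0 that] k0 by (simp add: J_def)
  have ker: "J y = 0" if "\<And>z. z \<in> S \<Longrightarrow> y \<bullet> z = 0" "\<And>z. z \<in> S \<Longrightarrow> y \<bullet> J z = 0" for y
  proof -
    have "E a x0 \<bullet> y = 0" "Wv a x0 \<bullet> y = 0" if "a \<noteq> 1" for a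
      using \<open>\<And>z. z \<in> S \<Longrightarrow> y \<bullet> z = 0\<close>[OF ES[OF that]] \<open>\<And>z. z \<in> S \<Longrightarrow> y \<bullet> J z = 0\<close>[OF ES[OF that]]
      by (simp_all add: WJ[OF that] inner_commute)
    then show ?thesis
      by (simp add: J_def Kf_def)
  qed
  have E1T: "E 1 x0 = \<kappa> x0 *\<^sub>R T"
    using E1[OF B(3)] by (simp add: T_def)
  have T1: "T \<bullet> z = 0" if "z \<in> S" for z
  proof -
    have "E 1 x0 \<bullet> z = 0"
      by (rule perpS[OF that]) (simp_all add: E_E[OF x0])
    then show ?thesis
      using k0 by (simp add: E1T)
  qed
  have T2: "T \<notin> J ` S"
  proof
    assume "T \<in> J ` S"
    then obtain z where z: "z \<in> S" "T = J z"
      by blast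
    then have "Kf z x0 = 1 *\<^sub>R E 1 x0"
      using k0 by (simp add: E1T J_def)
    then have "E 2 x0 \<bullet> z = 0 \<and> E 3 x0 \<bullet> z = 0 \<and> E 4 x0 \<bullet> z = 0 \<and> (1::real) = 0"
      unfolding Kf_S[OF z(1)] by (rule W_indep)
    then show False
      by simp
  qed
  have subS: "subspace S"
    unfolding S_def by (rule subspace_span)
  obtain a b p q m \<nu> c where hel: "helicoid_frame b p q m" and nu: "0 < \<nu>"
    and Jp: "\<And>j. j < 3 \<Longrightarrow> J (p j) = (\<nu> * m j) *\<^sub>R q j" and Jq: "\<And>j. j < 3 \<Longrightarrow> J (q j) = - (\<nu> * m j) *\<^sub>R p j"
    and Jb: "J b = 0" and Ja: "\<And>y. J (y - a) + \<nu> *\<^sub>R b = J (y - g x0) + T"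
    and g0: "g x0 - a = (\<Sum>j<3. c j *\<^sub>R p j)"
    and bS: "\<And>z. z \<in> S \<Longrightarrow> b \<bullet> z = 0" and qS: "\<And>j z. j < 3 \<Longrightarrow> z \<in> S \<Longrightarrow> q j \<bullet> z = 0"
    and pS: "\<And>z. z \<in> S \<Longrightarrow> z = (\<Sum>j<3. (z \<bullet> p j) *\<^sub>R p j)"
    and ker': "\<And>y. (\<And>j. j < 3 \<Longrightarrow> y \<bullet> p j = 0) \<Longrightarrow> (\<And>j. j < 3 \<Longrightarrow> y \<bullet> q j = 0) \<Longrightarrow> J y = 0"
  proof (rule killing_normal_form[OF J skew subS dimS JS1 JS2 JS3 ker T1 T2, where ?g0.0 = "g x0"])
    fix b p q m \<nu> a c
    assume "helicoid_frame b p q m"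
      "0 < \<nu>"
      "\<And>j. j < 3 \<Longrightarrow> J (p j) = (\<nu> * m j) *\<^sub>R q j"
      "\<And>j. j < 3 \<Longrightarrow> J (q j) = - (\<nu> * m j) *\<^sub>R p j"
      "J b = 0"
      "\<And>y. J (y - a) + \<nu> *\<^sub>R b = J (y - g x0) + T"
      "g x0 - a = (\<Sum>j<3. c j *\<^sub>R p j)"
      "\<And>z. z \<in> S \<Longrightarrow> b \<bullet> z = 0"
      "\<And>j z. j < 3 \<Longrightarrow> z \<in> S \<Longrightarrow> q j \<bullet> z = 0"
      "\<And>z. z \<in> S \<Longrightarrow> z = (\<Sum>j<3. (z \<bullet> p j) *\<^sub>R p j)"
      "\<And>y. (\<And>j. j < 3 \<Longrightarrow> y \<bullet> p j = 0) \<Longrightarrow> (\<And>j. j < 3 \<Longrightarrow> y \<bullet> q j = 0) \<Longrightarrow> J y = 0"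
    then show thesis
      by (rule that)
  qed
  interpret H: helicoid_frame b p q m
    by (rule hel)
  have E1a: "E 1 x = \<kappa> x *\<^sub>R (J (g x - a) + \<nu> *\<^sub>R b)" if "x \<in> B" for x
    using E1[OF that] unfolding Ja by (simp add: T_def linear_diff[OF J])
  have blJ: "bounded_linear J"
    using J by (simp add: linear_conv_bounded_linear)
  have BW: "x \<in> W" if "x \<in> B" for x
    using that B(4) by auto
  have smB: "smooth_on F B" if "smooth_on F W" for F :: "real ^ 4 \<Rightarrow> 'b"
    using smooth_on_subset[OF that B(4)] .
  have DT1: "D 1 (tproj y) x = \<kappa> x *\<^sub>R (J (tproj y x) - tproj (J y) x)" if "x \<in> B" for x y
    unfolding D_1_tproj[OF BW[OF that]] KJ[OF that] by (simp add: tproj_def algebra_simps)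
  \<comment> \<open>Uniqueness for a linear equation with skew right-hand side: the squared norm of
    \<open>F\<close> is constant.\<close>
  have transport: "F x = 0" if x: "x \<in> B" and F: "smooth_on F B" "F x0 = 0"
    and D: "\<And>z i. z \<in> B \<Longrightarrow> i \<noteq> 1 \<Longrightarrow> D i F z = 0" "\<And>z. z \<in> B \<Longrightarrow> D 1 F z = \<kappa> z *\<^sub>R J (F z)"
    for F x
  proof -
    have JF: "y \<bullet> J y = 0" for y
      using skew[of y y] by (simp add: inner_commute)
    have "F x \<bullet> F x = F x0 \<bullet> F x0"
    proof (rule D_zero_imp_constant[OF B(1,2,4) _ _ x B(3)])
      show "smooth_on (\<lambda>x. F x \<bullet> F x) B"
        by (intro smooth_on_inner B F)
      show "D i (\<lambda>x. F x \<bullet> F x) z = 0" if "z \<in> B" for z i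
        by (cases "i = 1") (simp_all add: dird_inner[OF B(1) that F(1) F(1)] D that JF inner_commute[of "J _"])
    qed
    then show ?thesis
      using F(2) by simp
  qed
  have tproj_perp: "tproj y x = 0" if x: "x \<in> B" and y: "J y = 0" "\<And>z. z \<in> S \<Longrightarrow> y \<bullet> z = 0" for x y
  proof (rule transport[OF x smB[OF smooth_tproj]])
    show "tproj y x0 = 0"
      using y(2)[OF ES[of 2]] y(2)[OF ES[of 3]] y(2)[OF ES[of 4]] by (simp add: tproj_def inner_commute)
    have "tproj 0 z = 0" for z
      by (simp add: tproj_def)
    then show "D 1 (tproj y) z = \<kappa> z *\<^sub>R J (tproj y z)" if "z \<in> B" for z
      using DT1[OF that] y(1) by simp
  qed (use D_c_tproj BW in auto)
  have perp_E: "y \<bullet> E i x = 0" if "x \<in> B" "i \<noteq> 1" "J y = 0" "\<And>z. z \<in> S \<Longrightarrow> y \<bullet> z = 0" for x i y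
    using tproj_inner[OF BW[OF that(1)] that(2), of y] tproj_perp[OF that(1,3,4)] by simp
  \<comment> \<open>The height of \<open>g x\<close> over \<open>a\<close> along the axis; it is
    constant on leaves and grows at rate \<open>\<kappa> x * \<nu>\<close> along
    \<open>E 1\<close>.\<close>
  define \<tau> where "\<tau> x = b \<bullet> (g x - a)" for x
  have smga: "smooth_on (\<lambda>x. g x - a) B"
    by (intro smooth_on_diff B smB smooth_g smooth_on_const)
  have Dga: "D i (\<lambda>x. g x - a) x = E i x" if "x \<in> B" for i x
    by (simp add: dird_diff[OF B(1) that smB[OF smooth_g] smooth_on_const] dird_const)
  have smt: "smooth_on \<tau> B"
    unfolding \<tau>_def by (intro smooth_on_inner smooth_on_const B smga)
  have Dt: "D i \<tau> x = b \<bullet> E i x" if "x \<in> B" for i x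
    unfolding \<tau>_def by (simp add: dird_inner[OF B(1) that smooth_on_const smga] dird_const Dga[OF that])
  have Dtc: "D i \<tau> x = 0" if "x \<in> B" "i \<noteq> 1" for i x
    unfolding Dt[OF that(1)] by (rule perp_E[OF that Jb bS])
  have Dt1: "D 1 \<tau> x = \<kappa> x * \<nu>" if "x \<in> B" for x
    unfolding Dt[OF that] E1a[OF that] using skew[of b] Jb by (simp add: inner_add_right H.b_b)
  have t0: "\<tau> x0 = 0"
    by (simp add: \<tau>_def g0 inner_sum_right H.b_p)
  define co where "co j x = cos (m j * \<tau> x)" for j x
  define si where "si j x = sin (m j * \<tau> x)" for j x
  have smmt: "smooth_on (\<lambda>x. m j * \<tau> x) B" for j
    by (rule smooth_on_bounded_linear[OF bounded_linear_mult_right B(1) smt])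
  have Dmt: "D i (\<lambda>x. m j * \<tau> x) x = m j * D i \<tau> x" if "x \<in> B" for i j x
    by (rule dird_bounded_linear[OF B(1) that bounded_linear_mult_right smt])
  have smc: "smooth_on (co j) B" and sms: "smooth_on (si j) B" for j
    unfolding co_def si_def by (intro smooth_on_cos smooth_on_sin B smmt)+
  have Dc: "D i (co j) x = - si j x * (m j * D i \<tau> x)" and Ds: "D i (si j) x = co j x * (m j * D i \<tau> x)"
    if "x \<in> B" for i j x
    unfolding co_def si_def using dird_cos[OF B(1) smmt that] dird_sin[OF B(1) smmt that] Dmt[OF that] by auto
  have co0: "co j x0 = 1" and si0: "si j x0 = 0" for j
    by (simp_all add: co_def si_def t0)
  \<comment> \<open>The left-hand side is the projection to the leaf of \<open>Q j\<close> at height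
    \<open>\<tau> x\<close>; the rotation of the leaf and the growth of \<tau> combine to the
    equation of \<open>transport\<close>.\<close>
  have F0: "co j x *\<^sub>R tproj (q j) x - si j x *\<^sub>R tproj (p j) x = 0" if x: "x \<in> B" and j: "j < 3" for x j
  proof (rule transport[OF x])
    have sm: "smooth_on (\<lambda>x. co j x *\<^sub>R tproj (q j) x) B" "smooth_on (\<lambda>x. si j x *\<^sub>R tproj (p j) x) B"
      by (intro smooth_on_scaleR B smc sms smB smooth_tproj)+
    show "smooth_on (\<lambda>x. co j x *\<^sub>R tproj (q j) x - si j x *\<^sub>R tproj (p j) x) B"
      by (intro smooth_on_diff B sm)
    show "co j x0 *\<^sub>R tproj (q j) x0 - si j x0 *\<^sub>R tproj (p j) x0 = 0"
      using qS[OF j ES[of 2]] qS[OF j ES[of 3]] qS[OF j ES[of 4]] by (simp add: si0 tproj_def inner_commute)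
    have DF: "D i (\<lambda>x. co j x *\<^sub>R tproj (q j) x - si j x *\<^sub>R tproj (p j) x) z
      = co j z *\<^sub>R D i (tproj (q j)) z + D i (co j) z *\<^sub>R tproj (q j) z
        - (si j z *\<^sub>R D i (tproj (p j)) z + D i (si j) z *\<^sub>R tproj (p j) z)" if z: "z \<in> B" for z i
      by (simp add: dird_diff[OF B(1) z sm] dird_scaleR[OF B(1) z smc smB[OF smooth_tproj]]
          dird_scaleR[OF B(1) z sms smB[OF smooth_tproj]])
    show "D i (\<lambda>x. co j x *\<^sub>R tproj (q j) x - si j x *\<^sub>R tproj (p j) x) z = 0" if z: "z \<in> B" "i \<noteq> 1" for z i
      unfolding DF[OF z(1)] Dc[OF z(1)] Ds[OF z(1)] Dtc[OF z] by (simp add: D_c_tproj[OF BW[OF z(1)] z(2)])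
    show "D 1 (\<lambda>x. co j x *\<^sub>R tproj (q j) x - si j x *\<^sub>R tproj (p j) x) z
        = \<kappa> z *\<^sub>R J (co j z *\<^sub>R tproj (q j) z - si j z *\<^sub>R tproj (p j) z)" if z: "z \<in> B" for z
    proof -
      have ts: "tproj (r *\<^sub>R y) z = r *\<^sub>R tproj y z" for r y
        by (simp add: tproj_def algebra_simps)
      show ?thesis
        unfolding DF[OF z] Dc[OF z] Ds[OF z] Dt1[OF z] DT1[OF z] Jp[OF j] Jq[OF j] ts
        by (simp add: linear_diff[OF J] linear_scale[OF J] algebra_simps)
    qed
  qed
  have "g x \<in> H.helicoid a" if x: "x \<in> B" for x
  proof (rule H.helicoidI)
    fix j :: nat assume j: "j < 3"
    have "(co j x *\<^sub>R q j - si j x *\<^sub>R p j) \<bullet> (g x - a) = (co j x0 *\<^sub>R q j - si j x0 *\<^sub>R p j) \<bullet> (g x0 - a)"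
    proof (rule D_zero_imp_constant[OF B(1,2,4) _ _ x B(3)])
      have sm: "smooth_on (\<lambda>x. co j x *\<^sub>R q j) B" "smooth_on (\<lambda>x. si j x *\<^sub>R p j) B"
        "smooth_on (\<lambda>x. co j x *\<^sub>R q j - si j x *\<^sub>R p j) B"
        by (intro smooth_on_diff smooth_on_scaleR smooth_on_const B smc sms)+
      show "smooth_on (\<lambda>x. (co j x *\<^sub>R q j - si j x *\<^sub>R p j) \<bullet> (g x - a)) B"
        by (intro smooth_on_inner B sm smga)
      fix z i assume z: "z \<in> B"
      have D: "D i (\<lambda>x. (co j x *\<^sub>R q j - si j x *\<^sub>R p j) \<bullet> (g x - a)) z
          = (co j z *\<^sub>R q j - si j z *\<^sub>R p j) \<bullet> E i z
            + (D i (co j) z *\<^sub>R q j - D i (si j) z *\<^sub>R p j) \<bullet> (g z - a)"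
        by (simp add: dird_inner[OF B(1) z sm(3) smga] dird_diff[OF B(1) z sm(1,2)] Dga[OF z] dird_const
            dird_scaleR[OF B(1) z smc smooth_on_const] dird_scaleR[OF B(1) z sms smooth_on_const])
      show "D i (\<lambda>x. (co j x *\<^sub>R q j - si j x *\<^sub>R p j) \<bullet> (g x - a)) z = 0"
      proof (cases "i = 1")
        case False
        have "(co j z *\<^sub>R tproj (q j) z - si j z *\<^sub>R tproj (p j) z) \<bullet> E i z = 0"
          by (simp add: F0[OF z j])
        then have "(co j z *\<^sub>R q j - si j z *\<^sub>R p j) \<bullet> E i z = 0"
          by (simp add: inner_diff_left tproj_inner[OF BW[OF z] False])
        then show ?thesis
          unfolding D Dc[OF z] Ds[OF z] Dtc[OF z False] by simp
      next
        case True
        have "y \<bullet> J w = - (J y \<bullet> w)" for y w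
          using skew[of y w] by simp
        then have pq: "q j \<bullet> E 1 z = \<kappa> z * (\<nu> * m j * (p j \<bullet> (g z - a)))"
          "p j \<bullet> E 1 z = - (\<kappa> z * (\<nu> * m j * (q j \<bullet> (g z - a))))"
          unfolding E1a[OF z] using H.b_p[OF j] H.b_q[OF j]
          by (simp_all add: inner_add_right Jp[OF j] Jq[OF j] inner_commute[of _ b])
        show ?thesis
          unfolding True D[unfolded True] Dc[OF z] Ds[OF z] Dt1[OF z]
          unfolding inner_diff_left inner_scaleR_left pq
          by algebra
      qed
    qed
    also have "\<dots> = 0"
      using H.q_p[OF j] by (simp add: co0 si0 g0 inner_sum_right)
    finally show "H.Q j (b \<bullet> (g x - a)) \<bullet> (g x - a) = 0"
      by (simp add: H.Q_def co_def si_def \<tau>_def inner_diff_left inner_add_left)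
  next
    fix r assume r: "r \<bullet> b = 0" "\<And>j. j < 3 \<Longrightarrow> r \<bullet> p j = 0" "\<And>j. j < 3 \<Longrightarrow> r \<bullet> q j = 0"
    have Jr: "J r = 0"
      using ker' r(2,3) by blast
    have rS: "r \<bullet> z = 0" if "z \<in> S" for z
      by (subst pS[OF that]) (simp add: inner_sum_right r(2))
    have "r \<bullet> (g x - a) = r \<bullet> (g x0 - a)"
    proof (rule D_zero_imp_constant[OF B(1,2,4) _ _ x B(3)])
      show "smooth_on (\<lambda>x. r \<bullet> (g x - a)) B"
        by (intro smooth_on_inner B smooth_on_const smga)
      fix z i assume z: "z \<in> B"
      have "D i (\<lambda>x. r \<bullet> (g x - a)) z = r \<bullet> E i z"
        by (simp add: dird_inner[OF B(1) z smooth_on_const smga] dird_const Dga[OF z])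
      also have "\<dots> = 0"
      proof (cases "i = 1")
        case True
        then show ?thesis
          using E1a[OF z] skew[of r "g z - a"] Jr r(1) by (simp add: inner_add_right)
      next
        case False
        then show ?thesis
          by (rule perp_E[OF z _ Jr rS])
      qed
      finally show "D i (\<lambda>x. r \<bullet> (g x - a)) z = 0" .
    qed
    then show "r \<bullet> (g x - a) = 0"
      by (simp add: g0 inner_sum_right r(2))
  qed
  then show ?thesis
    using that[OF B(1,3,4) hel] by blast
qed

end

section \<open>Openness of the image in the helicoid\<close>

context helicoid_frame
begin

text \<open>Inverse to \<open>param a\<close> on the helicoid, but defined on the whole ambient
  space, so that ordinary differentiability applies.\<close>

definition coord :: "'b \<Rightarrow> 'b \<Rightarrow> real ^ 4" where
  "coord a y = (b \<bullet> (y - a)) *\<^sub>R axis 1 1 + (P 0 (b \<bullet> (y - a)) \<bullet> (y - a)) *\<^sub>R axis 2 1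
    + (P 1 (b \<bullet> (y - a)) \<bullet> (y - a)) *\<^sub>R axis 3 1 + (P 2 (b \<bullet> (y - a)) \<bullet> (y - a)) *\<^sub>R axis 4 1"

definition param :: "'b \<Rightarrow> real ^ 4 \<Rightarrow> 'b" where
  "param a z = a + (z $ 1) *\<^sub>R b + ((z $ 2) *\<^sub>R P 0 (z $ 1) + (z $ 3) *\<^sub>R P 1 (z $ 1) + (z $ 4) *\<^sub>R P 2 (z $ 1))"

lemma param_coord: "y \<in> helicoid a \<Longrightarrow> param a (coord a y) = y"
proof -
  assume y: "y \<in> helicoid a"
  have "{..<3::nat} = {0, 1, 2}"
    by auto
  then have "param a (coord a y) = retr a y"
    by (simp add: param_def coord_def retr_def axis_def algebra_simps)
  then show ?thesis
    using y mem_helicoid_iff by simp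
qed

lemma differentiable_P: "P j differentiable (at t)"
proof -
  have "(P j has_derivative (\<lambda>h. (h * m j) *\<^sub>R Q j t)) (at t)"
    unfolding P_def[abs_def] Q_def
    by (auto intro!: derivative_eq_intros simp: algebra_simps)
  then show ?thesis
    by (rule differentiableI)
qed

lemma differentiable_P_comp: "u differentiable (at x) \<Longrightarrow> (\<lambda>x. P j (u x)) differentiable (at x)"
  using differentiable_chain_at[OF _ differentiable_P, of u x j] by (simp add: o_def)

lemma differentiable_coord: "coord a differentiable (at y)"
proof -
  have "(\<lambda>y. b \<bullet> (y - a)) differentiable (at y)"
    by (intro differentiable_inner differentiable_const differentiable_diff differentiable_ident)
  then show ?thesis
    unfolding coord_def[abs_def]
    by (intro differentiable_add differentiable_scaleR differentiable_inner differentiable_const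
        differentiable_diff differentiable_ident differentiable_P_comp)
qed

lemma differentiable_param: "param a differentiable (at z)"
proof -
  have n: "(\<lambda>z. z $ i) differentiable (at z)" for i
    by (rule bounded_linear_imp_differentiable[OF bounded_linear_vec_nth])
  show ?thesis
    unfolding param_def[abs_def]
    by (intro differentiable_add differentiable_scaleR differentiable_const differentiable_P_comp n)
qed

text \<open>As \<open>g\<close> is \<open>param a \<circ> F\<close> on \<open>B\<close> with
  \<open>F = coord a \<circ> g\<close>, injectivity of the derivative of \<open>g\<close> passes to
  that of \<open>F\<close>, which is then invertible, both of its spaces having dimension 4. So
  \<open>F\<close> is open, and the image of \<open>g\<close> is the part of the helicoid that
  \<open>coord a\<close> maps into an open set.\<close>

lemma openin_image:
  fixes g :: "real ^ 4 \<Rightarrow> 'b"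
  assumes B: "open B" and sm: "smooth_on g B" and inj: "\<And>x. x \<in> B \<Longrightarrow> inj (frechet_derivative g (at x))"
    and sub: "g ` B \<subseteq> helicoid a"
  shows "openin (top_of_set (helicoid a)) (g ` B)"
proof -
  define F where "F = coord a \<circ> g"
  have diffg: "g differentiable (at x)" if "x \<in> B" for x
    using smooth_on_has_derivative[OF sm B that] by (rule differentiableI)
  have diffF: "F differentiable (at x)" if "x \<in> B" for x
    unfolding F_def by (rule differentiable_chain_at[OF diffg[OF that] differentiable_coord])
  then have contF: "continuous_on B F"
    by (intro continuous_at_imp_continuous_on ballI differentiable_imp_continuous_within)
  have g_eq: "param a (F x) = g x" if "x \<in> B" for x
    using param_coord sub that by (auto simp: F_def)
  have "F x \<in> interior (F ` B)" if x: "x \<in> B" for x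
  proof -
    obtain F' where F': "(F has_derivative F') (at x)"
      using diffF[OF x] unfolding differentiable_def by blast
    obtain R where R: "(param a has_derivative R) (at (F x))"
      using differentiable_param unfolding differentiable_def by blast
    have "(param a \<circ> F has_derivative R \<circ> F') (at x)"
      by (rule diff_chain_at[OF F' R])
    then have "(g has_derivative R \<circ> F') (at x)"
      by (rule has_derivative_transform_within_open[OF _ B x]) (simp add: g_eq)
    then have "frechet_derivative g (at x) = R \<circ> F'"
      by (rule frechet_derivative_at[symmetric])
    then have "inj (R \<circ> F')"
      using inj[OF x] by simp
    then have "inj F'"
      by (rule inj_on_imageI2)
    then obtain G' where G': "linear G'" "\<forall>x. F' (G' x) = x"
      using linear_injective_isomorphism[OF has_derivative_linear[OF F']] by blast
    show ?thesis
      by (rule sussmann_open_mapping[OF B contF x F', of G'])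
         (use G' x B in \<open>auto simp: linear_conv_bounded_linear o_def interior_open\<close>)
  qed
  then have "open (F ` B)"
    by (metis image_subsetI interior_subset open_subopen open_interior subset_antisym interior_eq)
  moreover have "continuous_on (helicoid a) (coord a)"
    by (intro continuous_at_imp_continuous_on ballI differentiable_imp_continuous_within differentiable_coord)
  ultimately have "openin (top_of_set (helicoid a)) (helicoid a \<inter> coord a -` (F ` B))"
    by (intro continuous_openin_preimage_gen)
  also have "helicoid a \<inter> coord a -` (F ` B) = g ` B"
  proof
    show "g ` B \<subseteq> helicoid a \<inter> coord a -` (F ` B)"
      using sub by (auto simp: F_def)
    show "helicoid a \<inter> coord a -` (F ` B) \<subseteq> g ` B"
    proof
      fix y assume "y \<in> helicoid a \<inter> coord a -` (F ` B)"
      then obtain x where x: "x \<in> B" "coord a y = F x" and y: "y \<in> helicoid a"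
        by auto
      then have "y = g x"
        using param_coord[OF y] g_eq[OF x(1)] by simp
      then show "y \<in> g ` B"
        using x(1) by simp
    qed
  qed
  finally show ?thesis .
qed

end

section \<open>Analytic continuation of helicoids\<close>

text \<open>Extension to an entire function makes the identity theorem of complex analysis available
  for functions of one real variable.\<close>

definition real_entire :: "(real \<Rightarrow> real) \<Rightarrow> bool" where
  "real_entire f \<longleftrightarrow> (\<exists>F. F holomorphic_on UNIV \<and> (\<forall>s. F (of_real s) = complex_of_real (f s)))"

lemma real_entire_const: "real_entire (\<lambda>s. c)"
  unfolding real_entire_def by (rule exI[of _ "\<lambda>_. of_real c"]) auto

lemma real_entire_id: "real_entire (\<lambda>s. s)"
  unfolding real_entire_def by (rule exI[of _ "\<lambda>z. z"]) auto

lemma real_entire_add: "real_entire f \<Longrightarrow> real_entire g \<Longrightarrow> real_entire (\<lambda>s. f s + g s)"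
proof -
  assume "real_entire f" "real_entire g"
  then obtain F G where "F holomorphic_on UNIV" "\<forall>s. F (of_real s) = complex_of_real (f s)"
    "G holomorphic_on UNIV" "\<forall>s. G (of_real s) = complex_of_real (g s)"
    unfolding real_entire_def by blast
  then show ?thesis
    unfolding real_entire_def by (intro exI[of _ "\<lambda>z. F z + G z"]) (auto intro: holomorphic_on_add)
qed

lemma real_entire_mult: "real_entire f \<Longrightarrow> real_entire g \<Longrightarrow> real_entire (\<lambda>s. f s * g s)"
proof -
  assume "real_entire f" "real_entire g"
  then obtain F G where "F holomorphic_on UNIV" "\<forall>s. F (of_real s) = complex_of_real (f s)"
    "G holomorphic_on UNIV" "\<forall>s. G (of_real s) = complex_of_real (g s)"
    unfolding real_entire_def by blast
  then show ?thesis
    unfolding real_entire_def by (intro exI[of _ "\<lambda>z. F z * G z"]) (auto intro: holomorphic_on_mult)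
qed

lemma real_entire_diff: "real_entire f \<Longrightarrow> real_entire g \<Longrightarrow> real_entire (\<lambda>s. f s - g s)"
  using real_entire_add[OF _ real_entire_mult[OF real_entire_const[of "-1"]], of f g] by simp

lemma real_entire_sum: "(\<And>i. i \<in> I \<Longrightarrow> real_entire (f i)) \<Longrightarrow> real_entire (\<lambda>s. \<Sum>i\<in>I. f i s)"
  by (induction I rule: infinite_finite_induct) (auto intro: real_entire_const real_entire_add)

lemma real_entire_sin: "real_entire (\<lambda>s. sin (f s))" and real_entire_cos: "real_entire (\<lambda>s. cos (f s))"
  if "real_entire f"
proof -
  obtain F where F: "F holomorphic_on UNIV" "\<forall>s. F (of_real s) = complex_of_real (f s)"
    using \<open>real_entire f\<close> unfolding real_entire_def by blast
  show "real_entire (\<lambda>s. sin (f s))"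
    unfolding real_entire_def using F
    by (intro exI[of _ "\<lambda>z. sin (F z)"]) (auto simp: sin_of_real intro!: holomorphic_intros)
  show "real_entire (\<lambda>s. cos (f s))"
    unfolding real_entire_def using F
    by (intro exI[of _ "\<lambda>z. cos (F z)"]) (auto simp: cos_of_real intro!: holomorphic_intros)
qed

lemma real_entire_eq_0:
  assumes "real_entire f" "0 < \<epsilon>" "\<And>s. \<bar>s\<bar> < \<epsilon> \<Longrightarrow> f s = 0"
  shows "f s = 0"
proof -
  obtain F where F: "F holomorphic_on UNIV" "\<forall>s. F (of_real s) = complex_of_real (f s)"
    using assms(1) unfolding real_entire_def by blast
  have lim: "(0::complex) islimpt (of_real ` {0<..<\<epsilon>})"
  proof (rule islimptI)
    fix T :: "complex set" assume "0 \<in> T" "open T"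
    then obtain r where r: "0 < r" "ball 0 r \<subseteq> T"
      by (auto elim: openE)
    define d where "d = min r \<epsilon> / 2"
    have "d \<in> {0<..<\<epsilon>}" "complex_of_real d \<in> T" "complex_of_real d \<noteq> 0"
      using r assms(2) by (auto simp: d_def)
    then show "\<exists>y\<in>of_real ` {0<..<\<epsilon>}. y \<in> T \<and> y \<noteq> 0"
      by blast
  qed
  have "F (of_real s) = 0"
    by (rule analytic_continuation[OF F(1) open_UNIV connected_UNIV subset_UNIV UNIV_I lim _ UNIV_I])
       (use F(2) assms(3) in auto)
  then show ?thesis
    using F(2) by simp
qed

context helicoid_frame
begin

lemma real_entire_retr:
  assumes \<gamma>: "\<And>v. real_entire (\<lambda>s. v \<bullet> \<gamma> s)"
  shows "real_entire (\<lambda>s. v \<bullet> retr a (\<gamma> s))"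
proof -
  have diff: "real_entire (\<lambda>s. v \<bullet> (\<gamma> s - a))" for v
    unfolding inner_diff_right by (intro real_entire_diff \<gamma> real_entire_const)
  have "real_entire (\<lambda>s. (cos (m j * (b \<bullet> (\<gamma> s - a))) * (p j \<bullet> (\<gamma> s - a))
        + sin (m j * (b \<bullet> (\<gamma> s - a))) * (q j \<bullet> (\<gamma> s - a)))
      * (cos (m j * (b \<bullet> (\<gamma> s - a))) * (v \<bullet> p j) + sin (m j * (b \<bullet> (\<gamma> s - a))) * (v \<bullet> q j)))" for j
    by (intro real_entire_mult real_entire_add real_entire_cos real_entire_sin real_entire_const diff)
  then have j: "real_entire (\<lambda>s. (P j (b \<bullet> (\<gamma> s - a)) \<bullet> (\<gamma> s - a)) * (v \<bullet> P j (b \<bullet> (\<gamma> s - a))))" for j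
    by (simp only: P_def inner_add_left inner_add_right inner_scaleR_left inner_scaleR_right)
  show ?thesis
    unfolding retr_def inner_add_right inner_scaleR_right inner_sum_right
    by (intro real_entire_add real_entire_sum real_entire_mult real_entire_const diff j)
qed

text \<open>Along \<gamma> each component of \<open>retr a (\<gamma> s) - \<gamma> s\<close> extends
  to an entire function and vanishes near 0.\<close>

lemma helicoid_continuation:
  assumes \<gamma>: "\<And>v. real_entire (\<lambda>s. v \<bullet> \<gamma> s)" and "0 < \<epsilon>" "\<And>s. \<bar>s\<bar> < \<epsilon> \<Longrightarrow> \<gamma> s \<in> helicoid a"
  shows "\<gamma> s \<in> helicoid a"
proof -
  have "v \<bullet> retr a (\<gamma> s) - v \<bullet> \<gamma> s = 0" for v
    by (rule real_entire_eq_0[OF real_entire_diff[OF real_entire_retr[OF \<gamma>] \<gamma>] assms(2)])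
       (use assms(3) mem_helicoid_iff in simp)
  then have "(retr a (\<gamma> s) - \<gamma> s) \<bullet> (retr a (\<gamma> s) - \<gamma> s) = 0"
    by (metis inner_diff_right)
  then show ?thesis
    by (simp add: mem_helicoid_iff)
qed

text \<open>The parameters of the two points are interpolated linearly, so the curve is built from
  polynomials and from sine and cosine of affine functions of \<open>s\<close>.\<close>

lemma helicoid_curve:
  assumes "y0 \<in> helicoid a" "y1 \<in> helicoid a"
  obtains \<gamma> where "continuous_on UNIV \<gamma>" "\<gamma> 0 = y0" "\<gamma> 1 = y1" "\<And>s. \<gamma> s \<in> helicoid a"
    "\<And>v. real_entire (\<lambda>s. v \<bullet> \<gamma> s)"
proof -
  obtain t0 s0 where y0: "y0 = a + t0 *\<^sub>R b + (\<Sum>j<3. s0 j *\<^sub>R P j t0)"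
    using assms(1) unfolding helicoid_def by blast
  obtain t1 s1 where y1: "y1 = a + t1 *\<^sub>R b + (\<Sum>j<3. s1 j *\<^sub>R P j t1)"
    using assms(2) unfolding helicoid_def by blast
  define t where "t s = t0 + s * (t1 - t0)" for s
  define c where "c j s = s0 j + s * (s1 j - s0 j)" for j s
  define \<gamma> where "\<gamma> s = a + t s *\<^sub>R b + (\<Sum>j<3. c j s *\<^sub>R P j (t s))" for s
  have 1: "real_entire t" "real_entire (c j)" for j
    unfolding t_def c_def by (intro real_entire_add real_entire_mult real_entire_const real_entire_id)+
  show thesis
  proof (rule that)
    show "continuous_on UNIV \<gamma>"
      unfolding \<gamma>_def t_def c_def P_def by (intro continuous_intros)
    show "\<gamma> 0 = y0" "\<gamma> 1 = y1"
      by (simp_all add: \<gamma>_def t_def c_def y0 y1)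
    show "\<gamma> s \<in> helicoid a" for s
      unfolding helicoid_def \<gamma>_def
      by (rule CollectI, rule exI[of _ "t s"], rule exI[of _ "\<lambda>j. c j s"]) simp
    show "real_entire (\<lambda>s. v \<bullet> \<gamma> s)" for v
      unfolding \<gamma>_def P_def inner_add_right inner_scaleR_right inner_sum_right
      by (intro real_entire_add real_entire_mult real_entire_sum real_entire_const real_entire_cos
          real_entire_sin 1)
  qed
qed

lemma open_subset_imp_subset:
  assumes "helicoid_frame b' p' q' m'" and O: "openin (top_of_set (helicoid a)) O'" "O' \<noteq> {}"
    and sub: "O' \<subseteq> helicoid_frame.helicoid b' p' q' m' a'"
  shows "helicoid a \<subseteq> helicoid_frame.helicoid b' p' q' m' a'"
proof
  interpret H: helicoid_frame b' p' q' m'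
    by fact
  fix y assume y: "y \<in> helicoid a"
  obtain T where T: "open T" "O' = helicoid a \<inter> T"
    using O(1) by (auto simp: openin_open)
  then obtain y0 where y0: "y0 \<in> helicoid a" "y0 \<in> T"
    using O(2) by auto
  obtain \<gamma> where \<gamma>: "continuous_on UNIV \<gamma>" "\<gamma> 0 = y0" "\<gamma> 1 = y" "\<And>s. \<gamma> s \<in> helicoid a"
    "\<And>v. real_entire (\<lambda>s. v \<bullet> \<gamma> s)"
    by (rule helicoid_curve[OF y0(1) y]) blast
  have "open (\<gamma> -` T)"
    using T(1) \<gamma>(1) by (rule open_vimage)
  moreover have "0 \<in> \<gamma> -` T"
    using \<gamma>(2) y0(2) by simp
  ultimately obtain \<epsilon> where \<epsilon>: "0 < \<epsilon>" "ball 0 \<epsilon> \<subseteq> \<gamma> -` T"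
    by (auto elim: openE)
  have "\<gamma> s \<in> H.helicoid a'" if "\<bar>s\<bar> < \<epsilon>" for s
  proof -
    have "\<gamma> s \<in> T"
      using \<epsilon>(2) that by (auto simp: subset_iff)
    then show ?thesis
      using \<gamma>(4) T(2) sub by blast
  qed
  from H.helicoid_continuation[OF \<gamma>(5) \<epsilon>(1) this, of 1] show "y \<in> H.helicoid a'"
    by (simp add: \<gamma>(3))
qed

lemma generalized_helicoid_helicoid: "generalized_helicoid 4 (helicoid a)"
proof -
  \<comment> \<open>The order of the standard parametrization: the axis, then \<open>p\<close> and
    \<open>q\<close> of each plane alternately. The planes are numbered from 0 here and from 1 in
    \<open>helicoid_coord\<close>, whence the shifts by 1 in \<open>bb\<close> and \<mu>.\<close>
  define bb where "bb k = (if k = 0 then b else if odd k then p ((k + 1) div 2 - 1) else q ((k + 1) div 2 - 1))" for k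
  have bb: "bb 0 = b" "bb 1 = p 0" "bb 2 = q 0" "bb 3 = p 1" "bb 4 = q 1" "bb 5 = p 2" "bb 6 = q 2"
    by (simp_all add: bb_def)
  have seven: "{..<7::nat} = {0, 1, 2, 3, 4, 5, 6}"
    by auto
  have "bb i \<bullet> bb k = (if i = k then 1 else 0)" if "i \<in> {0, 1, 2, 3, 4, 5, 6}" "k \<in> {0, 1, 2, 3, 4, 5, 6}" for i k
  proof -
    have bs: "p j \<bullet> b = 0" "q j \<bullet> b = 0" if "j < 3" for j
      using b_p[OF that] b_q[OF that] by (simp_all add: inner_commute)
    show ?thesis
      using that bb b_b b_p b_q bs p_p q_q p_q q_p by (elim insertE emptyE) simp_all
  qed
  then have orth: "\<forall>i<7. \<forall>k<7. bb i \<bullet> bb k = (if i = k then 1 else 0)"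
    unfolding seven[symmetric] by simp
  define \<mu> where "\<mu> j = m (j - 1)" for j
  have sum: "a + (\<Sum>k<7. helicoid_coord 4 3 \<mu> x k *\<^sub>R bb k)
      = a + x 0 *\<^sub>R b + (\<Sum>j<3. x (Suc j) *\<^sub>R P j (x 0))" for x
  proof -
    have three: "{..<3::nat} = {0, 1, 2}"
      by auto
    have "helicoid_coord 4 3 \<mu> x 0 = x 0"
      "helicoid_coord 4 3 \<mu> x 1 = x 1 * cos (m 0 * x 0)" "helicoid_coord 4 3 \<mu> x 2 = x 1 * sin (m 0 * x 0)"
      "helicoid_coord 4 3 \<mu> x 3 = x 2 * cos (m 1 * x 0)" "helicoid_coord 4 3 \<mu> x 4 = x 2 * sin (m 1 * x 0)"
      "helicoid_coord 4 3 \<mu> x 5 = x 3 * cos (m 2 * x 0)" "helicoid_coord 4 3 \<mu> x 6 = x 3 * sin (m 2 * x 0)"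
      by (simp_all add: helicoid_coord_def \<mu>_def Let_def)
    then show ?thesis
      unfolding seven three
      by (simp add: bb bb[unfolded One_nat_def] P_def scaleR_add_right add.assoc flip: numeral_2_eq_2)
  qed
  have "helicoid a = {a + (\<Sum>k<7. helicoid_coord 4 3 \<mu> x k *\<^sub>R bb k) | x. True}"
  proof (intro set_eqI iffI)
    fix y assume "y \<in> helicoid a"
    then obtain t s where y: "y = a + t *\<^sub>R b + (\<Sum>j<3. s j *\<^sub>R P j t)"
      unfolding helicoid_def by blast
    then have "y = a + (\<Sum>k<7. helicoid_coord 4 3 \<mu> (case_nat t s) k *\<^sub>R bb k)"
      unfolding sum by simp
    then show "y \<in> {a + (\<Sum>k<7. helicoid_coord 4 3 \<mu> x k *\<^sub>R bb k) | x. True}"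
      by blast
  next
    fix y assume "y \<in> {a + (\<Sum>k<7. helicoid_coord 4 3 \<mu> x k *\<^sub>R bb k) | x. True}"
    then obtain x where y: "y = a + x 0 *\<^sub>R b + (\<Sum>j<3. x (Suc j) *\<^sub>R P j (x 0))"
      unfolding sum by blast
    show "y \<in> helicoid a"
      unfolding helicoid_def y
      by (rule CollectI, rule exI[of _ "x 0"], rule exI[of _ "\<lambda>j. x (Suc j)"]) simp
  qed
  then show ?thesis
    unfolding generalized_helicoid_def using orth m_pos
    by (intro exI[of _ 3] exI[of _ \<mu>] exI[of _ a] exI[of _ bb]) (auto simp: \<mu>_def)
qed

end

section \<open>Gluing the local helicoids\<close>

definition is_helicoid :: "'b::euclidean_space set \<Rightarrow> bool" where
  "is_helicoid H \<longleftrightarrow> (\<exists>b p q m a. helicoid_frame b p q m \<and> H = helicoid_frame.helicoid b p q m a)"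

lemma is_helicoid_subset:
  assumes "is_helicoid H" "is_helicoid H'" "openin (top_of_set H) S" "S \<noteq> {}" "S \<subseteq> H'"
  shows "H \<subseteq> H'"
proof -
  obtain b p q m a where H: "helicoid_frame b p q m" "H = helicoid_frame.helicoid b p q m a"
    using assms(1) unfolding is_helicoid_def by blast
  obtain b' p' q' m' a' where H': "helicoid_frame b' p' q' m'" "H' = helicoid_frame.helicoid b' p' q' m' a'"
    using assms(2) unfolding is_helicoid_def by blast
  show ?thesis
    unfolding H(2) H'(2)
    by (rule helicoid_frame.open_subset_imp_subset[OF H(1) H'(1)])
       (use assms(3-5) in \<open>simp_all add: H(2) H'(2)\<close>)
qed

text \<open>Openness is claimed for all smaller open sets \<open>O'\<close> as well, because the
  overlap of two such pieces must again have an image that is open in the helicoid.\<close>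

lemma local_helicoid_exists:
  fixes f :: "'a \<Rightarrow> real ^ 'n"
  assumes imm: "immersed_submanifold M A f" and C: "type_C M A f l1 l2 l3"
    and dim: "first_normal_dim A f 3"
    and const: "\<And>p. p \<in> topspace M \<Longrightarrow> l1 p = m1 \<and> l2 p = m2 \<and> l3 p = m3"
    and p: "p \<in> topspace M"
  shows "\<exists>U H. openin M U \<and> p \<in> U \<and> is_helicoid H \<and>
    (\<forall>O'. openin M O' \<and> O' \<subseteq> U \<longrightarrow> openin (top_of_set H) (f ` O'))"
proof (rule type_C_frame_exists[OF imm C dim const p])
  fix V \<phi> W e
  assume A: "(V, \<phi>) \<in> A" and WV: "W \<subseteq> V" and pW: "p \<in> \<phi> ` W"
    and fr: "type_C_frame W (f \<circ> \<phi>) e (\<lambda>i. if i = 2 then m1 else if i = 3 then m2 else m3)"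
  interpret fr: type_C_frame W "f \<circ> \<phi>" e "\<lambda>i. if i = 2 then m1 else if i = 3 then m2 else m3"
    by (rule fr)
  have par: "type_C_params m1 m2 m3"
    using C p const[OF p] unfolding type_C_def by metis
  have flat: "flat_frame W (f \<circ> \<phi>) e (\<lambda>i. if i = 2 then m1 else if i = 3 then m2 else m3)"
  proof unfold_locales
    show "(if a = 2 then m1 else if a = 3 then m2 else m3) = 0" if "a \<noteq> 1" for a :: 4
    proof -
      have "W \<noteq> {}"
        using pW by blast
      then show ?thesis
        using fr.lam_eq_0[of a] par that by auto
    qed
  qed
  have V: "open V" "openin M (\<phi> ` V)" "homeomorphic_map (top_of_set V) (subtopology M (\<phi> ` V)) \<phi>"
    using imm A unfolding immersed_submanifold_def smooth_manifold_def by blast+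
  have g: "smooth_on (f \<circ> \<phi>) V" "\<And>x. x \<in> V \<Longrightarrow> inj (frechet_derivative (f \<circ> \<phi>) (at x))"
    using imm A unfolding immersed_submanifold_def by blast+
  obtain x0 where x0: "x0 \<in> W" "p = \<phi> x0"
    using pW by blast
  show ?thesis
  proof (rule flat_frame.local_helicoid[OF flat x0(1)])
    fix B a b pp q m
    assume B: "open B" "x0 \<in> B" "B \<subseteq> W" and hel: "helicoid_frame b pp q m"
      and sub: "(f \<circ> \<phi>) ` B \<subseteq> helicoid_frame.helicoid b pp q m a"
    let ?H = "helicoid_frame.helicoid b pp q m a"
    have BV: "B \<subseteq> V"
      using B(3) WV by blast
    have "openin (top_of_set V) B"
      using B(1) BV by (rule open_subset[rotated])
    then have "openin (subtopology M (\<phi> ` V)) (\<phi> ` B)"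
      using homeomorphic_imp_open_map[OF V(3)] unfolding open_map_def by blast
    then have U: "openin M (\<phi> ` B)"
      using V(2) by (simp add: openin_open_subtopology)
    have "openin (top_of_set ?H) (f ` O')" if O': "openin M O'" "O' \<subseteq> \<phi> ` B" for O'
    proof -
      define Q where "Q = {x \<in> V. \<phi> x \<in> O'} \<inter> B"
      have "continuous_map (top_of_set V) M \<phi>"
        using homeomorphic_imp_continuous_map[OF V(3)] continuous_map_in_subtopology by blast
      then have "openin (top_of_set V) {x \<in> V. \<phi> x \<in> O'}"
        using O'(1) unfolding continuous_map by fastforce
      then have "open {x \<in> V. \<phi> x \<in> O'}"
        using V(1) openin_open_eq by blast
      then have Q: "open Q" "Q \<subseteq> B"
        using B(1) by (auto simp: Q_def)
      have "f ` O' = (f \<circ> \<phi>) ` Q"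
        using O'(2) BV by (force simp: Q_def)
      moreover have "openin (top_of_set ?H) ((f \<circ> \<phi>) ` Q)"
        by (rule helicoid_frame.openin_image[OF hel Q(1) smooth_on_subset[OF g(1)] g(2)])
           (use Q(2) BV sub in auto)
      ultimately show ?thesis
        by simp
    qed
    moreover have "is_helicoid ?H"
      unfolding is_helicoid_def using hel by blast
    ultimately show ?thesis
      using U B(2) x0(2) by blast
  qed
qed

theorem proposition14:
  fixes M :: "'a topology" and A :: "(4, 'a) atlas" and f :: "'a \<Rightarrow> real ^ 'n"
    and l1 l2 l3 :: "'a \<Rightarrow> real"
  assumes "immersed_submanifold M A f"
    and "connected_space M" and "topspace M \<noteq> {}"
    and "austere A f"
    and "type_C M A f l1 l2 l3"
    and "first_normal_dim A f 3"
    and "l1 constant_on topspace M" and "l2 constant_on topspace M" and "l3 constant_on topspace M"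
  shows "\<exists>H. generalized_helicoid 4 H \<and> openin (top_of_set H) (f ` topspace M)"
proof -
  obtain m1 m2 m3 where m: "\<And>p. p \<in> topspace M \<Longrightarrow> l1 p = m1 \<and> l2 p = m2 \<and> l3 p = m3"
    using assms(7-9) unfolding constant_on_def by metis
  define good where "good U H \<longleftrightarrow> openin M U \<and> is_helicoid H \<and>
    (\<forall>O'. openin M O' \<and> O' \<subseteq> U \<longrightarrow> openin (top_of_set H) (f ` O'))" for U and H :: "(real ^ 'n) set"
  have ex: "\<exists>U H. p \<in> U \<and> good U H" if "p \<in> topspace M" for p
    using local_helicoid_exists[OF assms(1,5,6) m that] unfolding good_def by blast
  have sub: "H \<subseteq> H'" if "good U H" "good U' H'" "U \<inter> U' \<noteq> {}" for U U' H H'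
  proof (rule is_helicoid_subset)
    have "openin M (U \<inter> U')"
      using that unfolding good_def by blast
    then have O: "openin (top_of_set H) (f ` (U \<inter> U'))" "openin (top_of_set H') (f ` (U \<inter> U'))"
      using that unfolding good_def by (metis Int_lower1, metis Int_lower2)
    then show "openin (top_of_set H) (f ` (U \<inter> U'))" "f ` (U \<inter> U') \<subseteq> H'"
      using openin_imp_subset by blast+
    show "f ` (U \<inter> U') \<noteq> {}"
      using that(3) by blast
  qed (use that in \<open>auto simp: good_def\<close>)
  then have eq: "H = H'" if "good U H" "good U' H'" "U \<inter> U' \<noteq> {}" for U U' H H'
    using that by (metis Int_commute subset_antisym)
  obtain p0 where "p0 \<in> topspace M"
    using assms(3) by blast
  then obtain U0 H where H: "p0 \<in> U0" "good U0 H"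
    using ex by blast
  \<comment> \<open>By \<open>eq\<close> the helicoid of a good set does not change across overlaps,
    so \<open>E1\<close> and \<open>E2\<close> are disjoint open sets that cover
    \<open>M\<close>.\<close>
  define E1 where "E1 = \<Union>{U. good U H}"
  define E2 where "E2 = \<Union>{U. \<exists>H'. good U H' \<and> H' \<noteq> H}"
  have "openin M E1" "openin M E2"
    unfolding E1_def E2_def good_def by (rule openin_Union; blast)+
  moreover have "topspace M \<subseteq> E1 \<union> E2"
    using ex unfolding E1_def E2_def by blast
  moreover have "E1 \<inter> E2 = {}"
    using eq unfolding E1_def E2_def by blast
  moreover have "E1 \<noteq> {}"
    using H unfolding E1_def by blast
  ultimately have "E2 = {}"
    using assms(2) unfolding connected_space_def by blast
  then have E1: "E1 = topspace M"
    using \<open>topspace M \<subseteq> E1 \<union> E2\<close> \<open>openin M E1\<close> openin_subset by blast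
  have "openin (top_of_set H) (f ` U)" if "good U H" for U
    using that unfolding good_def by blast
  then have "openin (top_of_set H) (\<Union>U\<in>{U. good U H}. f ` U)"
    by blast
  also have "(\<Union>U\<in>{U. good U H}. f ` U) = f ` topspace M"
    unfolding E1[symmetric] E1_def by blast
  finally have "openin (top_of_set H) (f ` topspace M)" .
  moreover have "generalized_helicoid 4 H"
    using H(2) helicoid_frame.generalized_helicoid_helicoid unfolding good_def is_helicoid_def by blast
  ultimately show ?thesis
    by blast
qed

end
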